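(* Let $\mathcal M\models T$, $a\in M^k$ and $1\le i\le k$. The map $\iota_{a,i}^{+}$ is a homeomorphism from $\mathcal G_{a,i}^{+}$, equipped with the subspace topology induced by the $\mathcal K$-metric $d_{\mathcal G}$ on $\mathcal G_a$, onto $\mathfrak m_{\mathcal K}^{k-1}$, equipped with the sup metric $d_K(x,y)=\max_{1\le j\le k-1}|x_j-y_j|$. The analogous statement holds for $\iota_{a,i}^{-}:\mathcal G_{a,i}^-\to\mathfrak m_{\mathcal K}^{k-1}$.
   Context: $T$ is a complete o-minimal theory expanding the theory of real closed ordered fields in a language $\mathcal L$, with quantifier elimination and universally axiomatizable; definable means definable with parameters. $\mathcal K=\mathcal H_{0^+}$ (underlying set $K$) is the Hardy field of germs at $0^+$ of $\mathcal L(M)$-definable unary functions, an ordered field containing $M$ as constant germs. $\mathfrak m_{\mathcal K}=\{x\in K:|x|<c\text{ for every }c\in M^{>0}\}$. Metric topologies over $K$ are generated by balls with radii in $K^{>0}$. A curve at $a$ is a continuous $\gamma:(0,1)\to M^k$ with $\lim_{t\to0}\gamma(t)=a$. $\gamma\sim\sigma$ if for some $\varepsilon>0$, $B(a,\varepsilon)\cap\gamma((0,1))=B(a,\varepsilon)\cap\sigma((0,1))$. Here $B(a,\varepsilon)$ is the ball for the sup metric $d$ on $M^k$. $\mathcal G_a$ is the set of classes $[\gamma]$ of $\mathcal L$-definable curves at $a$. Curve germs concern behaviour as $t\to0$: representatives are shrunk (restricted to small $t$ and reparametrized) so that $d(\gamma(t),a)$ is strictly increasing in $t$ (for nonconstant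 germs). $d_{\mathcal G}([\gamma],[\sigma])\in\mathcal K$ is the germ at $0^+$ of $t\mapsto D\bigl(B(a,t)\cap\gamma((0,1)),\,B(a,t)\cap\sigma((0,1))\bigr)$, where $D$ is the Hausdorff distance induced by $d$. $\mathcal G_{a,i}^{+}$ (resp. $\mathcal G_{a,i}^-$) is the set of germs in $\mathcal G_a$ whose representatives are eventually (as $t\to 0$) contained in $\{b\in M^k:b_i>a_i\}$ (resp. $b_i<a_i$). Write $a_{\widehat i}=(a_1,\ldots,a_{i-1},a_{i+1},\ldots,a_k)$ and $\operatorname{ins}_i(u,y)=(u_1,\ldots,u_{i-1},y,u_i,\ldots,u_{k-1})$. Each $[\gamma]\in\mathcal G_{a,i}^{+}$ has a unique normalized representative $\widehat\gamma(s)=\operatorname{ins}_i(u_\gamma(s),a_i+s)$, with $u_\gamma:(0,\varepsilon)\to M^{k-1}$ $\mathcal L(M)$-definable converging to $a_{\widehat i}$ as $s\to0^+$; set $\iota_{a,i}^{+}([\gamma])=[u_\gamma-a_{\widehat i}]_{\mathcal K}\in\mathfrak m_{\mathcal K}^{k-1}$. For $\mathcal G_{a,i}^{-}$ use $\widehat\gamma(s)=\operatorname{ins}_i(u_\gamma(s),a_i-s)$ and $\iota_{a,i}^-([\gamma])=[u_\gamma-a_{\widehat i}]_{\mathcal K}$. *)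

theory Defs
  imports "HOL-Analysis.Abstract_Topology"
begin

section \<open>First-order logic\<close>

text \<open>A language extending the language of ordered rings. All elements of the types
  \<open>'f\<close> and \<open>'r\<close> are symbols, with the given arities.\<close>

record ('f, 'r) language =
  farity :: "'f \<Rightarrow> nat"
  rarity :: "'r \<Rightarrow> nat"
  Zero :: 'f
  One :: 'f
  Plus :: 'f
  Uminus :: 'f
  Times :: 'f
  Less :: 'r

definition ordered_ring_language :: "('f, 'r) language \<Rightarrow> bool" where
  "ordered_ring_language L \<longleftrightarrow>
     farity L (Zero L) = 0 \<and> farity L (One L) = 0 \<and> farity L (Plus L) = 2 \<and>
     farity L (Uminus L) = 1 \<and> farity L (Times L) = 2 \<and> rarity L (Less L) = 2"

datatype 'f trm = Var nat | Fn 'f "'f trm list"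

datatype ('f, 'r) fm =
    Eq "'f trm" "'f trm"
  | Rl 'r "'f trm list"
  | Neg "('f, 'r) fm"
  | Con "('f, 'r) fm" "('f, 'r) fm"
  | All nat "('f, 'r) fm"

abbreviation Dis :: "('f, 'r) fm \<Rightarrow> ('f, 'r) fm \<Rightarrow> ('f, 'r) fm" where
  "Dis p q \<equiv> Neg (Con (Neg p) (Neg q))"

abbreviation Imp :: "('f, 'r) fm \<Rightarrow> ('f, 'r) fm \<Rightarrow> ('f, 'r) fm" where
  "Imp p q \<equiv> Neg (Con p (Neg q))"

abbreviation Iff :: "('f, 'r) fm \<Rightarrow> ('f, 'r) fm \<Rightarrow> ('f, 'r) fm" where
  "Iff p q \<equiv> Con (Imp p q) (Imp q p)"

abbreviation Ex :: "nat \<Rightarrow> ('f, 'r) fm \<Rightarrow> ('f, 'r) fm" where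
  "Ex x p \<equiv> Neg (All x (Neg p))"

fun wf_trm :: "('f, 'r) language \<Rightarrow> 'f trm \<Rightarrow> bool" where
  "wf_trm L (Var x) \<longleftrightarrow> True"
| "wf_trm L (Fn f ts) \<longleftrightarrow> length ts = farity L f \<and> (\<forall>t\<in>set ts. wf_trm L t)"

fun wf_fm :: "('f, 'r) language \<Rightarrow> ('f, 'r) fm \<Rightarrow> bool" where
  "wf_fm L (Eq t u) \<longleftrightarrow> wf_trm L t \<and> wf_trm L u"
| "wf_fm L (Rl r ts) \<longleftrightarrow> length ts = rarity L r \<and> (\<forall>t\<in>set ts. wf_trm L t)"
| "wf_fm L (Neg p) \<longleftrightarrow> wf_fm L p"
| "wf_fm L (Con p q) \<longleftrightarrow> wf_fm L p \<and> wf_fm L q"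
| "wf_fm L (All x p) \<longleftrightarrow> wf_fm L p"

fun fv_trm :: "'f trm \<Rightarrow> nat set" where
  "fv_trm (Var x) = {x}"
| "fv_trm (Fn f ts) = (\<Union>t\<in>set ts. fv_trm t)"

fun fv :: "('f, 'r) fm \<Rightarrow> nat set" where
  "fv (Eq t u) = fv_trm t \<union> fv_trm u"
| "fv (Rl r ts) = (\<Union>t\<in>set ts. fv_trm t)"
| "fv (Neg p) = fv p"
| "fv (Con p q) = fv p \<union> fv q"
| "fv (All x p) = fv p - {x}"

definition sentence :: "('f, 'r) language \<Rightarrow> ('f, 'r) fm \<Rightarrow> bool" where
  "sentence L p \<longleftrightarrow> wf_fm L p \<and> fv p = {}"

fun quantifier_free :: "('f, 'r) fm \<Rightarrow> bool" where
  "quantifier_free (Eq t u) \<longleftrightarrow> True"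
| "quantifier_free (Rl r ts) \<longleftrightarrow> True"
| "quantifier_free (Neg p) \<longleftrightarrow> quantifier_free p"
| "quantifier_free (Con p q) \<longleftrightarrow> quantifier_free p \<and> quantifier_free q"
| "quantifier_free (All x p) \<longleftrightarrow> False"

inductive universal :: "('f, 'r) fm \<Rightarrow> bool" where
  "quantifier_free p \<Longrightarrow> universal p"
| "universal p \<Longrightarrow> universal (All x p)"

record ('f, 'r, 'u) struct =
  Dom :: "'u set"
  fint :: "'f \<Rightarrow> 'u list \<Rightarrow> 'u"
  rint :: "'r \<Rightarrow> 'u list \<Rightarrow> bool"

definition is_struct :: "('f, 'r) language \<Rightarrow> ('f, 'r, 'u) struct \<Rightarrow> bool" where
  "is_struct L N \<longleftrightarrow> Dom N \<noteq> {} \<and>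
     (\<forall>f xs. length xs = farity L f \<and> set xs \<subseteq> Dom N \<longrightarrow> fint N f xs \<in> Dom N)"

fun evalt :: "('f, 'r, 'u) struct \<Rightarrow> (nat \<Rightarrow> 'u) \<Rightarrow> 'f trm \<Rightarrow> 'u" where
  "evalt N e (Var x) = e x"
| "evalt N e (Fn f ts) = fint N f (map (evalt N e) ts)"

fun sat :: "('f, 'r, 'u) struct \<Rightarrow> (nat \<Rightarrow> 'u) \<Rightarrow> ('f, 'r) fm \<Rightarrow> bool" where
  "sat N e (Eq t u) \<longleftrightarrow> evalt N e t = evalt N e u"
| "sat N e (Rl r ts) \<longleftrightarrow> rint N r (map (evalt N e) ts)"
| "sat N e (Neg p) \<longleftrightarrow> \<not> sat N e p"
| "sat N e (Con p q) \<longleftrightarrow> sat N e p \<and> sat N e q"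
| "sat N e (All x p) \<longleftrightarrow> (\<forall>b\<in>Dom N. sat N (e(x := b)) p)"

definition valid_in :: "('f, 'r, 'u) struct \<Rightarrow> ('f, 'r) fm \<Rightarrow> bool" where
  "valid_in N p \<longleftrightarrow> (\<forall>e. range e \<subseteq> Dom N \<longrightarrow> sat N e p)"

definition is_model :: "('f, 'r) language \<Rightarrow> ('f, 'r) fm set \<Rightarrow> ('f, 'r, 'u) struct \<Rightarrow> bool" where
  "is_model L T N \<longleftrightarrow> is_struct L N \<and> (\<forall>p\<in>T. valid_in N p)"

text \<open>Logical consequence. HOL cannot quantify over the type of the universe, so the models
  range over all structures whose universe is a nonempty subset of the type of formulas. The
  cardinality of that type is the maximum of \<open>\<aleph>\<^sub>0\<close> and the number of symbols, so by the
  downward Loewenheim-Skolem theorem this is consequence in arbitrary structures.\<close>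

definition entails :: "('f, 'r) language \<Rightarrow> ('f, 'r) fm set \<Rightarrow> ('f, 'r) fm \<Rightarrow> bool" where
  "entails L T p \<longleftrightarrow> (\<forall>N :: ('f, 'r, ('f, 'r) fm) struct. is_model L T N \<longrightarrow> valid_in N p)"

definition complete_theory :: "('f, 'r) language \<Rightarrow> ('f, 'r) fm set \<Rightarrow> bool" where
  "complete_theory L T \<longleftrightarrow>
     (\<forall>p\<in>T. sentence L p) \<and> (\<forall>p. sentence L p \<longrightarrow> (entails L T (Neg p) \<longleftrightarrow> \<not> entails L T p))"

definition quantifier_elimination :: "('f, 'r) language \<Rightarrow> ('f, 'r) fm set \<Rightarrow> bool" where
  "quantifier_elimination L T \<longleftrightarrow>
     (\<forall>p. wf_fm L p \<longrightarrow>
        (\<exists>q. wf_fm L q \<and> quantifier_free q \<and> fv q \<subseteq> fv p \<and> entails L T (Iff p q)))"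

definition universally_axiomatizable :: "('f, 'r) language \<Rightarrow> ('f, 'r) fm set \<Rightarrow> bool" where
  "universally_axiomatizable L T \<longleftrightarrow>
     (\<exists>U. (\<forall>p\<in>U. sentence L p \<and> universal p) \<and>
        (\<forall>p\<in>U. entails L T p) \<and> (\<forall>p\<in>T. entails L U p))"


section \<open>Real closed ordered fields and o-minimality\<close>

text \<open>\<open>monic_trm L x n\<close> is the polynomial \<open>X^n + v\<^sub>0 * X^(n-1) + \<dots> + v\<^sub>n\<^sub>-\<^sub>1\<close> in Horner form, where
  \<open>X\<close> is the variable with index \<open>x\<close> and the \<open>v\<^sub>j\<close> are those with index \<open>j\<close>.\<close>

primrec monic_trm :: "('f, 'r) language \<Rightarrow> nat \<Rightarrow> nat \<Rightarrow> 'f trm" where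
  "monic_trm L x 0 = Fn (One L) []"
| "monic_trm L x (Suc n) = Fn (Plus L) [Fn (Times L) [monic_trm L x n, Var x], Var n]"

definition RCF :: "('f, 'r) language \<Rightarrow> ('f, 'r) fm set" where
  "RCF L =
    (let zero = Fn (Zero L) []; one = Fn (One L) [];
         add = (\<lambda>s t. Fn (Plus L) [s, t]); mul = (\<lambda>s t. Fn (Times L) [s, t]);
         neg = (\<lambda>t. Fn (Uminus L) [t]); less = (\<lambda>s t. Rl (Less L) [s, t]);
         x = Var 0; y = Var 1; z = Var 2;
         all = (\<lambda>n p. fold All [0..<n] p)
     in
     { all 3 (Eq (add x (add y z)) (add (add x y) z)),
       all 2 (Eq (add x y) (add y x)),
       all 1 (Eq (add x zero) x),
       all 1 (Eq (add x (neg x)) zero),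
       all 3 (Eq (mul x (mul y z)) (mul (mul x y) z)),
       all 2 (Eq (mul x y) (mul y x)),
       all 1 (Eq (mul x one) x),
       all 3 (Eq (mul x (add y z)) (add (mul x y) (mul x z))),
       Neg (Eq zero one),
       all 1 (Imp (Neg (Eq x zero)) (Ex 1 (Eq (mul x y) one))),
       all 1 (Neg (less x x)),
       all 3 (Imp (Con (less x y) (less y z)) (less x z)),
       all 2 (Dis (less x y) (Dis (Eq x y) (less y x))),
       all 3 (Imp (less x y) (less (add x z) (add y z))),
       all 2 (Imp (Con (less zero x) (less zero y)) (less zero (mul x y))),
       all 1 (Imp (less zero x) (Ex 1 (Eq (mul y y) x))) }
     \<union> {all n (Ex n (Eq (monic_trm L n n) zero)) |n. odd n})"

text \<open>Definability is always with parameters: in \<open>p\<close>, the variables \<open>0, \<dots>, n - 1\<close> stand for the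
  coordinates and the remaining ones for the parameters \<open>e n, e (n + 1), \<dots>\<close>.\<close>

definition definable ::
    "('f, 'r) language \<Rightarrow> ('f, 'r, 'u) struct \<Rightarrow> nat \<Rightarrow> 'u list set \<Rightarrow> bool" where
  "definable L N n X \<longleftrightarrow>
     (\<exists>p e. wf_fm L p \<and> range e \<subseteq> Dom N \<and>
        X = {xs. length xs = n \<and> set xs \<subseteq> Dom N \<and>
                 sat N (\<lambda>j. if j < n then xs ! j else e j) p})"

definition basic_interval :: "('f, 'r) language \<Rightarrow> ('f, 'r, 'u) struct \<Rightarrow> 'u set \<Rightarrow> bool" where
  "basic_interval L N I \<longleftrightarrow>
     (let less = (\<lambda>x y. rint N (Less L) [x, y]) in
        I = Dom N
      \<or> (\<exists>b\<in>Dom N. I = {b})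
      \<or> (\<exists>b\<in>Dom N. I = {x \<in> Dom N. less b x})
      \<or> (\<exists>c\<in>Dom N. I = {x \<in> Dom N. less x c})
      \<or> (\<exists>b\<in>Dom N. \<exists>c\<in>Dom N. I = {x \<in> Dom N. less b x \<and> less x c}))"

definition ominimal :: "('f, 'r) language \<Rightarrow> ('f, 'r, 'u) struct \<Rightarrow> bool" where
  "ominimal L N \<longleftrightarrow>
     (\<forall>X. definable L N 1 X \<longrightarrow>
        (\<exists>F. finite F \<and> (\<forall>I\<in>F. basic_interval L N I) \<and> {x. [x] \<in> X} = \<Union>F))"

text \<open>The models range over the structures with universe contained in the type \<open>'u\<close>. For a
  complete theory having a model there this amounts to o-minimality of all models, because
  o-minimality is preserved under elementary equivalence.\<close>

definition ominimal_theory ::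
    "('f, 'r) language \<Rightarrow> ('f, 'r) fm set \<Rightarrow> 'u itself \<Rightarrow> bool" where
  "ominimal_theory L T _ \<longleftrightarrow>
     (\<forall>N :: ('f, 'r, 'u) struct. is_model L T N \<longrightarrow> ominimal L N)"

text \<open>The underlying ordered field of the structure is the ordered field \<open>'m\<close>. As models of
  \<open>RCF\<close> are ordered fields, this only fixes notation.\<close>

definition expands_field ::
    "('f, 'r) language \<Rightarrow> ('f, 'r, 'm::linordered_field) struct \<Rightarrow> bool" where
  "expands_field L M \<longleftrightarrow>
     Dom M = UNIV \<and> fint M (Zero L) [] = 0 \<and> fint M (One L) [] = 1 \<and>
     (\<forall>x y. fint M (Plus L) [x, y] = x + y) \<and> (\<forall>x. fint M (Uminus L) [x] = - x) \<and>
     (\<forall>x y. fint M (Times L) [x, y] = x * y) \<and> (\<forall>x y. rint M (Less L) [x, y] \<longleftrightarrow> x < y)"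


section \<open>The Hardy field of germs at zero from the right\<close>

definition ev :: "('m::linordered_field \<Rightarrow> bool) \<Rightarrow> bool" where
  "ev P \<longleftrightarrow> (\<exists>\<epsilon>>0. \<forall>t. 0 < t \<and> t < \<epsilon> \<longrightarrow> P t)"

text \<open>Points of \<open>M^n\<close> are lists of length \<open>n\<close>.\<close>

definition definable_map ::
    "('f, 'r) language \<Rightarrow> ('f, 'r, 'm::linordered_field) struct \<Rightarrow> 'm set \<Rightarrow> nat \<Rightarrow> ('m \<Rightarrow> 'm list) \<Rightarrow> bool"
  where
  "definable_map L M A n f \<longleftrightarrow> f ` A \<subseteq> {b. length b = n} \<and> definable L M (Suc n) {t # f t |t. t \<in> A}"

text \<open>Germs are represented by total definable functions, a definable function on \<open>(0, \<epsilon>)\<close>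
  being extended by zero. Thus \<open>germ L M f\<close> is the germ of any \<open>f\<close> that is definable on some
  \<open>(0, \<epsilon>)\<close>; outside this interval the values of \<open>f\<close> are irrelevant.\<close>

definition germ :: "('f, 'r) language \<Rightarrow> ('f, 'r, 'm::linordered_field) struct \<Rightarrow> ('m \<Rightarrow> 'm) \<Rightarrow> ('m \<Rightarrow> 'm) set"
  where
  "germ L M f = {g. definable_map L M UNIV 1 (\<lambda>t. [g t]) \<and> ev (\<lambda>t. g t = f t)}"

definition Kset :: "('f, 'r) language \<Rightarrow> ('f, 'r, 'm::linordered_field) struct \<Rightarrow> ('m \<Rightarrow> 'm) set set" where
  "Kset L M = germ L M ` {f. definable_map L M UNIV 1 (\<lambda>t. [f t])}"

definition Kconst :: "('f, 'r) language \<Rightarrow> ('f, 'r, 'm::linordered_field) struct \<Rightarrow> 'm \<Rightarrow> ('m \<Rightarrow> 'm) set" where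
  "Kconst L M c = germ L M (\<lambda>_. c)"

definition Kless :: "('m::linordered_field \<Rightarrow> 'm) set \<Rightarrow> ('m \<Rightarrow> 'm) set \<Rightarrow> bool" where
  "Kless x y \<longleftrightarrow> (\<exists>f\<in>x. \<exists>g\<in>y. ev (\<lambda>t. f t < g t))"

definition Kminus ::
    "('f, 'r) language \<Rightarrow> ('f, 'r, 'm::linordered_field) struct \<Rightarrow>
     ('m \<Rightarrow> 'm) set \<Rightarrow> ('m \<Rightarrow> 'm) set \<Rightarrow> ('m \<Rightarrow> 'm) set" where
  "Kminus L M x y = (\<Union>f\<in>x. \<Union>g\<in>y. germ L M (\<lambda>t. f t - g t))"

definition Kabs ::
    "('f, 'r) language \<Rightarrow> ('f, 'r, 'm::linordered_field) struct \<Rightarrow> ('m \<Rightarrow> 'm) set \<Rightarrow> ('m \<Rightarrow> 'm) set" where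
  "Kabs L M x = (if Kless x (Kconst L M 0) then Kminus L M (Kconst L M 0) x else x)"

definition Kmax :: "('m::linordered_field \<Rightarrow> 'm) set \<Rightarrow> ('m \<Rightarrow> 'm) set \<Rightarrow> ('m \<Rightarrow> 'm) set" where
  "Kmax x y = (if Kless x y then y else x)"

definition infinitesimals :: "('f, 'r) language \<Rightarrow> ('f, 'r, 'm::linordered_field) struct \<Rightarrow> ('m \<Rightarrow> 'm) set set"
  where
  "infinitesimals L M = {x \<in> Kset L M. \<forall>c>0. Kless (Kabs L M x) (Kconst L M c)}"

definition infinitesimal_tuples ::
    "('f, 'r) language \<Rightarrow> ('f, 'r, 'm::linordered_field) struct \<Rightarrow> nat \<Rightarrow> ('m \<Rightarrow> 'm) set list set" where
  "infinitesimal_tuples L M n = {xs. length xs = n \<and> set xs \<subseteq> infinitesimals L M}"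

text \<open>The maximum over the empty index set is zero.\<close>

definition Kdist ::
    "('f, 'r) language \<Rightarrow> ('f, 'r, 'm::linordered_field) struct \<Rightarrow>
     ('m \<Rightarrow> 'm) set list \<Rightarrow> ('m \<Rightarrow> 'm) set list \<Rightarrow> ('m \<Rightarrow> 'm) set" where
  "Kdist L M xs ys = foldr Kmax (map2 (\<lambda>x y. Kabs L M (Kminus L M x y)) xs ys) (Kconst L M 0)"

definition K_metric_topology ::
    "('f, 'r) language \<Rightarrow> ('f, 'r, 'm::linordered_field) struct \<Rightarrow>
     'x set \<Rightarrow> ('x \<Rightarrow> 'x \<Rightarrow> ('m \<Rightarrow> 'm) set) \<Rightarrow> 'x topology" where
  "K_metric_topology L M S D =
     topology_generated_by
       {{y \<in> S. Kless (D x y) r} |x r. x \<in> S \<and> r \<in> Kset L M \<and> Kless (Kconst L M 0) r}"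


section \<open>Germs of definable curves\<close>

definition sdist :: "'m::linordered_field list \<Rightarrow> 'm list \<Rightarrow> 'm" where
  "sdist x y = Max (insert 0 {\<bar>x ! j - y ! j\<bar> |j. j < length x})"

definition sball :: "'m::linordered_field list \<Rightarrow> 'm \<Rightarrow> 'm list set" where
  "sball a r = {b. length b = length a \<and> sdist a b < r}"

text \<open>\<open>'m\<close> need not be Dedekind complete, but the suprema and infima below exist because they
  are taken over definable sets.\<close>

definition hausdorff_dist :: "'m::linordered_field list set \<Rightarrow> 'm list set \<Rightarrow> 'm" where
  "hausdorff_dist A B =
     (let inf = (\<lambda>X. GREATEST s. \<forall>x\<in>X. s \<le> x); sup = (\<lambda>X. LEAST s. \<forall>x\<in>X. x \<le> s)
      in max (sup {inf {sdist x y |y. y \<in> B} |x. x \<in> A})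
             (sup {inf {sdist x y |x. x \<in> A} |y. y \<in> B}))"

definition tends_at_zero :: "('m::linordered_field \<Rightarrow> 'm list) \<Rightarrow> 'm list \<Rightarrow> bool" where
  "tends_at_zero f b \<longleftrightarrow> (\<forall>\<epsilon>>0. \<exists>\<delta>>0. \<forall>t. 0 < t \<and> t < \<delta> \<longrightarrow> sdist (f t) b < \<epsilon>)"

text \<open>Only the values on \<open>(0, 1)\<close> of the functions representing curves are relevant.\<close>

definition curve_at :: "'m::linordered_field list \<Rightarrow> ('m \<Rightarrow> 'm list) \<Rightarrow> bool" where
  "curve_at a \<gamma> \<longleftrightarrow>
     (\<forall>t\<in>{0<..<1}. length (\<gamma> t) = length a) \<and>
     (\<forall>t\<in>{0<..<1}. \<forall>\<epsilon>>0. \<exists>\<delta>>0. \<forall>s\<in>{0<..<1}. \<bar>s - t\<bar> < \<delta> \<longrightarrow> sdist (\<gamma> s) (\<gamma> t) < \<epsilon>) \<and>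
     tends_at_zero \<gamma> a"

definition definable_curves ::
    "('f, 'r) language \<Rightarrow> ('f, 'r, 'm::linordered_field) struct \<Rightarrow> 'm list \<Rightarrow> ('m \<Rightarrow> 'm list) set" where
  "definable_curves L M a =
     {\<gamma>. curve_at a \<gamma> \<and> definable_map L M {0<..<1} (length a) \<gamma>}"

definition curve_equiv :: "'m::linordered_field list \<Rightarrow> ('m \<Rightarrow> 'm list) \<Rightarrow> ('m \<Rightarrow> 'm list) \<Rightarrow> bool" where
  "curve_equiv a \<gamma> \<sigma> \<longleftrightarrow>
     (\<exists>\<epsilon>>0. sball a \<epsilon> \<inter> \<gamma> ` {0<..<1} = sball a \<epsilon> \<inter> \<sigma> ` {0<..<1})"

definition shrunk_curves ::
    "('f, 'r) language \<Rightarrow> ('f, 'r, 'm::linordered_field) struct \<Rightarrow> 'm list \<Rightarrow> ('m \<Rightarrow> 'm list) set" where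
  "shrunk_curves L M a =
     {\<gamma> \<in> definable_curves L M a.
        (\<forall>t\<in>{0<..<1}. \<gamma> t = a) \<or> strict_mono_on {0<..<1} (\<lambda>t. sdist (\<gamma> t) a)}"

text \<open>A definable curve may come back to \<open>a\<close> away from \<open>t = 0\<close>, which must not affect its germ.
  So \<open>curve_germ L M a \<gamma>\<close> is the equivalence class, among shrunk curves, of a restriction of \<open>\<gamma>\<close>
  to some \<open>(0, c)\<close>, rescaled to \<open>(0, 1)\<close>, that is shrunk. By o-minimality there is such a \<open>c\<close>, and
  any two of them yield equivalent curves.\<close>

definition curve_germ ::
    "('f, 'r) language \<Rightarrow> ('f, 'r, 'm::linordered_field) struct \<Rightarrow>
     'm list \<Rightarrow> ('m \<Rightarrow> 'm list) \<Rightarrow> ('m \<Rightarrow> 'm list) set" where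
  "curve_germ L M a \<gamma> =
     {\<sigma> \<in> shrunk_curves L M a.
        \<exists>c. 0 < c \<and> c \<le> 1 \<and> (\<lambda>t. \<gamma> (c * t)) \<in> shrunk_curves L M a \<and>
            curve_equiv a (\<lambda>t. \<gamma> (c * t)) \<sigma>}"

definition curve_germs ::
    "('f, 'r) language \<Rightarrow> ('f, 'r, 'm::linordered_field) struct \<Rightarrow> 'm list \<Rightarrow> ('m \<Rightarrow> 'm list) set set" where
  "curve_germs L M a = curve_germ L M a ` definable_curves L M a"

text \<open>The germ below does not depend on the representatives, so the union is over a constant family.\<close>

definition germ_dist ::
    "('f, 'r) language \<Rightarrow> ('f, 'r, 'm::linordered_field) struct \<Rightarrow> 'm list \<Rightarrow>
     ('m \<Rightarrow> 'm list) set \<Rightarrow> ('m \<Rightarrow> 'm list) set \<Rightarrow> ('m \<Rightarrow> 'm) set" where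
  "germ_dist L M a g h =
     (\<Union>\<gamma>\<in>g. \<Union>\<sigma>\<in>h. germ L M (\<lambda>t.
        hausdorff_dist (sball a t \<inter> \<gamma> ` {0<..<1}) (sball a t \<inter> \<sigma> ` {0<..<1})))"

text \<open>In the following, \<open>\<sigma> = 1\<close> gives the notions for the half-space \<open>b\<^sub>i > a\<^sub>i\<close>, and \<open>\<sigma> = -1\<close> those
  for \<open>b\<^sub>i < a\<^sub>i\<close>. Coordinates \<open>i\<close> are counted from 1, positions in lists from 0.\<close>

definition side_germs ::
    "('f, 'r) language \<Rightarrow> ('f, 'r, 'm::linordered_field) struct \<Rightarrow> 'm list \<Rightarrow> nat \<Rightarrow> 'm \<Rightarrow>
     ('m \<Rightarrow> 'm list) set set" where
  "side_germs L M a i \<sigma> =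
     {g \<in> curve_germs L M a. \<forall>\<gamma>\<in>g. ev (\<lambda>t. \<sigma> * (\<gamma> t ! (i - 1) - a ! (i - 1)) > 0)}"

definition del :: "nat \<Rightarrow> 'x list \<Rightarrow> 'x list" where
  "del i a = take (i - 1) a @ drop i a"

definition ins :: "nat \<Rightarrow> 'x list \<Rightarrow> 'x \<Rightarrow> 'x list" where
  "ins i u y = take (i - 1) u @ y # drop (i - 1) u"

text \<open>The curve \<open>s \<mapsto> ins i (u s) (a\<^sub>i + \<sigma> * s)\<close> on \<open>(0, \<epsilon>)\<close>, rescaled to \<open>(0, 1)\<close>, represents \<open>g\<close>.\<close>

definition normalized_rep ::
    "('f, 'r) language \<Rightarrow> ('f, 'r, 'm::linordered_field) struct \<Rightarrow> 'm list \<Rightarrow> nat \<Rightarrow> 'm \<Rightarrow>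
     ('m \<Rightarrow> 'm list) set \<Rightarrow> 'm \<Rightarrow> ('m \<Rightarrow> 'm list) \<Rightarrow> bool" where
  "normalized_rep L M a i \<sigma> g \<epsilon> u \<longleftrightarrow>
     0 < \<epsilon> \<and> definable_map L M {0<..<\<epsilon>} (length a - 1) u \<and> tends_at_zero u (del i a) \<and>
     (let \<gamma> = (\<lambda>t. ins i (u (\<epsilon> * t)) (a ! (i - 1) + \<sigma> * (\<epsilon> * t)))
      in \<gamma> \<in> definable_curves L M a \<and> curve_germ L M a \<gamma> = g)"

text \<open>The germ of \<open>u\<close> is determined by \<open>g\<close>.\<close>

definition iota ::
    "('f, 'r) language \<Rightarrow> ('f, 'r, 'm::linordered_field) struct \<Rightarrow> 'm list \<Rightarrow> nat \<Rightarrow> 'm \<Rightarrow>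
     ('m \<Rightarrow> 'm list) set \<Rightarrow> ('m \<Rightarrow> 'm) set list" where
  "iota L M a i \<sigma> g =
     (THE x. \<exists>\<epsilon> u. normalized_rep L M a i \<sigma> g \<epsilon> u \<and>
        x = map (\<lambda>j. germ L M (\<lambda>s. u s ! j - del i a ! j)) [0..<length a - 1])"

end

theory Submission
  imports Defs
begin

text \<open>On one side of \<open>a\<close>, the \<open>i\<close>-th coordinate of a definable curve is eventually strictly monotone
  by o-minimality and can serve as its parameter. The curve germ is then the germ of
  \<open>s \<mapsto> (s, U s)\<close> for a tuple \<open>U\<close> of infinitesimal germs, and \<open>iota\<close> is the bijection
  reading off \<open>U\<close>. For the topologies, let \<open>rho U s = max (s, |U s|)\<close> be the distance of this
  point to \<open>a\<close>; it is eventually strictly increasing. If \<open>V\<close> is close to \<open>U\<close>, a point of one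
  curve in the ball of radius \<open>t\<close> is matched with the point of the other curve at a slightly smaller
  parameter, which stays in the ball as soon as \<open>|U - V|\<close> is below the decrease of \<open>rho U\<close>.
  Conversely, if the curves are close in Hausdorff distance, the point \<open>V s\<close> is close to \<open>U s'\<close> for
  some \<open>s'\<close> near \<open>s\<close>, and \<open>U s'\<close> is close to \<open>U s\<close> by continuity. Since the moduli of continuity
  are definable, all bounds are elements of the Hardy field.

  The monotonicity theorem itself is obtained from the fact that a positive definable function on an
  interval has a positive lower bound on a subinterval: applied to the radius in which a
  one-sided relation \<open>f x < f y\<close>, \<open>f x = f y\<close> or \<open>f x > f y\<close> holds, it makes \<open>f\<close> monotone there.\<close>

section \<open>Renaming variables in formulas\<close>

text \<open>The two metrics run on different clocks: \<open>germ_dist\<close> is a germ in the ball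
  radius \<open>t\<close>, \<open>Kdist\<close> a germ in the coordinate \<open>s\<close>, and the
  point with parameter \<open>s\<close> has distance \<open>rho n U s\<close> to \<open>a\<close>,
  which can be much larger than \<open>s\<close>. A radius for one metric has to be converted
  through \<open>rho n U\<close>, and since a ball around \<open>U\<close> fixes its radius before
  the second curve is chosen, the conversion may depend on \<open>U\<close> only. Truncation is the
  other obstacle: a point of one curve just inside the ball may have its natural partner on the
  other curve just outside. They are replaced by three facts about a definable subset of the line:
  it is decided just to the right of each point, it has a supremum if nonempty and bounded above,
  and it is finite or contains an interval. To apply them, every auxiliary predicate and modulus has
  to be shown definable; the closure rules for this work on semantic predicates instead of
  formulas.\<close>

lemma finite_fv_trm: "finite (fv_trm t)"
  by (induction t) auto

lemma finite_fv: "finite (fv p)"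
  by (induction p) (auto simp: finite_fv_trm)

lemma evalt_cong: "(\<And>x. x \<in> fv_trm t \<Longrightarrow> e x = e' x) \<Longrightarrow> evalt N e t = evalt N e' t"
proof (induction t)
  case (Fn f ts)
  have "map (evalt N e) ts = map (evalt N e') ts"
    using Fn by (intro map_cong refl Fn.IH) auto
  then show ?case by (metis evalt.simps(2))
qed simp

lemma sat_cong: "(\<And>x. x \<in> fv p \<Longrightarrow> e x = e' x) \<Longrightarrow> sat N e p = sat N e' p"
proof (induction p arbitrary: e e')
  case (Eq t u)
  have "evalt N e t = evalt N e' t" "evalt N e u = evalt N e' u"
    using Eq by (auto intro!: evalt_cong)
  then show ?case by simp
next
  case (Rl r ts)
  have "map (evalt N e) ts = map (evalt N e') ts"
    using Rl by (intro map_cong refl evalt_cong) auto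
  then show ?case by (metis sat.simps(2))
next
  case (Neg p)
  have "sat N e p = sat N e' p" by (rule Neg.IH) (use Neg.prems in auto)
  then show ?case by simp
next
  case (Con p q)
  have "sat N e p = sat N e' p" by (rule Con.IH) (use Con.prems in auto)
  moreover have "sat N e q = sat N e' q" by (rule Con.IH) (use Con.prems in auto)
  ultimately show ?case by simp
next
  case (All x p)
  have "sat N (e(x := b)) p = sat N (e'(x := b)) p" for b
    by (rule All.IH) (use All.prems in auto)
  then show ?case by simp
qed

primrec rename_trm :: "(nat \<Rightarrow> nat) \<Rightarrow> 'f trm \<Rightarrow> 'f trm" where
  "rename_trm h (Var x) = Var (h x)"
| "rename_trm h (Fn f ts) = Fn f (map (rename_trm h) ts)"

lemma evalt_rename: "evalt N v (rename_trm h t) = evalt N (v \<circ> h) t"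
proof (induction t)
  case (Fn f ts)
  have "map (evalt N v \<circ> rename_trm h) ts = map (evalt N (v \<circ> h)) ts"
    using Fn by (simp add: o_def)
  then show ?case by (metis evalt.simps(2) list.map_comp rename_trm.simps(2))
qed simp

lemma wf_rename_trm: "wf_trm L t \<Longrightarrow> wf_trm L (rename_trm h t)"
  by (induction t) auto

text \<open>The map \<open>h\<close> need not be injective, so the bound variable gets a new name
  outside the image of \<open>fv p\<close>; otherwise the quantifier could capture the image of a
  free variable.\<close>

primrec rename_fm :: "(nat \<Rightarrow> nat) \<Rightarrow> ('f, 'r) fm \<Rightarrow> ('f, 'r) fm" where
  "rename_fm h (Eq t u) = Eq (rename_trm h t) (rename_trm h u)"
| "rename_fm h (Rl r ts) = Rl r (map (rename_trm h) ts)"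
| "rename_fm h (Neg p) = Neg (rename_fm h p)"
| "rename_fm h (Con p q) = Con (rename_fm h p) (rename_fm h q)"
| "rename_fm h (All x p) =
     (let y = (SOME y. y \<notin> h ` fv p) in All y (rename_fm (h(x := y)) p))"

lemma wf_rename_fm: "wf_fm L p \<Longrightarrow> wf_fm L (rename_fm h p)"
  by (induction p arbitrary: h) (auto simp: wf_rename_trm Let_def)

lemma sat_rename_fm: "sat N v (rename_fm h p) = sat N (v \<circ> h) p"
proof (induction p arbitrary: h v)
  case (Rl r ts)
  have "map (evalt N v) (map (rename_trm h) ts) = map (evalt N (v \<circ> h)) ts"
    by (simp add: evalt_rename)
  then show ?case by (metis rename_fm.simps(2) sat.simps(2))
next
  case (All x p)
  define y where "y = (SOME y. y \<notin> h ` fv p)"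
  have "\<exists>y. y \<notin> h ` fv p"
    by (meson finite_fv ex_new_if_finite finite_imageI infinite_UNIV_nat)
  then have y: "y \<notin> h ` fv p" unfolding y_def by (rule someI_ex)
  have "sat N (v(y := b) \<circ> h(x := y)) p = sat N ((v \<circ> h)(x := b)) p" for b
    by (rule sat_cong) (use y in auto)
  then show ?case by (simp only: rename_fm.simps Let_def sat.simps All.IH flip: y_def)
qed (auto simp: evalt_rename)

section \<open>Definable predicates\<close>

abbreviation assign :: "(nat \<Rightarrow> nat + 'a) \<Rightarrow> (nat \<Rightarrow> 'a) \<Rightarrow> nat \<Rightarrow> 'a" where
  "assign s v \<equiv> (\<lambda>j. case_sum v (\<lambda>c. c) (s j))"

locale ominimal_field =
  fixes L :: "('f, 'r) language" and M :: "('f, 'r, 'm::linordered_field) struct"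
  assumes lang: "ordered_ring_language L"
    and expands: "expands_field L M"
    and ominimal: "ominimal L M"
begin

lemma Dom_M [simp]: "Dom M = UNIV"
  using expands by (simp add: expands_field_def)

text \<open>A predicate on assignments is definable if it is given by a formula each of whose variables is
  either read from the assignment or a fixed parameter; the map \<open>s\<close> tells which. In the closure
  rules for binders, variable \<open>0\<close> is the one that has just been bound.\<close>

definition dfn :: "((nat \<Rightarrow> 'm) \<Rightarrow> bool) \<Rightarrow> bool" where
  "dfn P \<longleftrightarrow> (\<exists>p s. wf_fm L p \<and> (\<forall>v. P v = sat M (assign s v) p))"

definition dff :: "((nat \<Rightarrow> 'm) \<Rightarrow> 'm) \<Rightarrow> bool" where
  "dff f \<longleftrightarrow> dfn (\<lambda>v. v 0 = f (\<lambda>i. v (Suc i)))"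

named_theorems dfn_intros

lemma dfn_fm: "wf_fm L p \<Longrightarrow> dfn (\<lambda>v. sat M (assign s v) p)"
  unfolding dfn_def by blast

lemma dfn_subst: "dfn P \<Longrightarrow> dfn (\<lambda>v. P (\<lambda>i. case_sum v (\<lambda>c. c) (\<sigma> i)))"
proof -
  assume "dfn P"
  then obtain p s where p: "wf_fm L p" and P: "\<And>v. P v = sat M (assign s v) p"
    unfolding dfn_def by blast
  define s' where "s' j = case_sum \<sigma> Inr (s j)" for j
  have "case_sum (\<lambda>i. case_sum v (\<lambda>c. c) (\<sigma> i)) (\<lambda>c. c) (s j) = case_sum v (\<lambda>c. c) (s' j)" for v j
    by (auto simp: s'_def split: sum.splits)
  then show ?thesis
    unfolding dfn_def P using p by auto
qed

lemma dfn_reindex: "dfn P \<Longrightarrow> dfn (\<lambda>v. P (\<lambda>i. v (h i)))"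
  using dfn_subst[where \<sigma> = "\<lambda>i. Inl (h i)"] by simp

section \<open>Closure under connectives and quantifiers\<close>

lemma dfn_not [dfn_intros]: "dfn P \<Longrightarrow> dfn (\<lambda>v. \<not> P v)"
proof -
  assume "dfn P"
  then obtain p s where p: "wf_fm L p" and P: "\<And>v. P v = sat M (assign s v) p"
    unfolding dfn_def by blast
  from p have "dfn (\<lambda>v. sat M (assign s v) (Neg p))"
    by (intro dfn_fm) simp
  then show ?thesis by (simp add: P)
qed

lemma dfn_conj [dfn_intros]:
  assumes "dfn P" "dfn Q"
  shows "dfn (\<lambda>v. P v \<and> Q v)"
proof -
  obtain p s where p: "wf_fm L p" and P: "\<And>v. P v = sat M (assign s v) p"
    using assms unfolding dfn_def by blast
  obtain q t where q: "wf_fm L q" and Q: "\<And>v. Q v = sat M (assign t v) q"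
    using assms unfolding dfn_def by blast
  \<comment> \<open>Even variables serve the first formula and odd ones the second, so the two
    reading maps do not interfere.\<close>
  define r where "r = Con (rename_fm (\<lambda>j. 2 * j) p) (rename_fm (\<lambda>j. 2 * j + 1) q)"
  define s' where "s' j = (if even j then s (j div 2) else t (j div 2))" for j
  have "wf_fm L r" using p q by (simp add: r_def wf_rename_fm)
  moreover have "(P v \<and> Q v) = sat M (assign s' v) r" for v
    by (simp add: r_def sat_rename_fm o_def P Q s'_def)
  ultimately show ?thesis unfolding dfn_def by blast
qed

lemma dfn_all [dfn_intros]:
  assumes "dfn (\<lambda>v. P (\<lambda>i. v (Suc i)) (v 0))"
  shows "dfn (\<lambda>v. \<forall>x. P v x)"
proof -
  obtain p s where p: "wf_fm L p"
    and P: "\<And>v. P (\<lambda>i. v (Suc i)) (v 0) = sat M (assign s v) p"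
    using assms unfolding dfn_def by blast
  \<comment> \<open>Several variables of \<open>p\<close> may read slot 0; all of them become
    variable 0 and are bound by one quantifier. The others move up by one to make room, and
    \<open>s'\<close> lowers the slots they read, since the bound slot disappears.\<close>
  define h where "h j = (if s j = Inl 0 then 0 else Suc j)" for j
  define s' where "s' j = (case s (j - 1) of Inl i \<Rightarrow> Inl (i - 1) | Inr c \<Rightarrow> Inr c)" for j
  have "P v x = sat M ((assign s' v)(0 := x)) (rename_fm h p)" for v x
  proof -
    have "case_sum (case_nat x v) (\<lambda>c. c) (s j)
        = ((assign s' v)(0 := x) \<circ> h) j" for j
      by (auto simp: h_def s'_def split: sum.splits nat.splits)
    then have "(\<lambda>j. case_sum (case_nat x v) (\<lambda>c. c) (s j))
        = (assign s' v)(0 := x) \<circ> h" by (rule ext)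
    with P[of "case_nat x v"] show ?thesis by (simp add: sat_rename_fm)
  qed
  then have "(\<forall>x. P v x) = sat M (assign s' v) (All 0 (rename_fm h p))" for v
    by simp
  moreover have "wf_fm L (All 0 (rename_fm h p))" using p by (simp add: wf_rename_fm)
  ultimately show ?thesis unfolding dfn_def by blast
qed

lemma dfn_disj [dfn_intros]: "dfn P \<Longrightarrow> dfn Q \<Longrightarrow> dfn (\<lambda>v. P v \<or> Q v)"
  using dfn_not[OF dfn_conj[OF dfn_not dfn_not]] by simp

lemma dfn_imp [dfn_intros]: "dfn P \<Longrightarrow> dfn Q \<Longrightarrow> dfn (\<lambda>v. P v \<longrightarrow> Q v)"
  unfolding imp_conv_disj by (rule dfn_disj[OF dfn_not])

lemma dfn_iff [dfn_intros]: "dfn P \<Longrightarrow> dfn Q \<Longrightarrow> dfn (\<lambda>v. P v = Q v)"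
proof -
  assume "dfn P" "dfn Q"
  then have "dfn (\<lambda>v. (P v \<longrightarrow> Q v) \<and> (Q v \<longrightarrow> P v))" by (intro dfn_conj dfn_imp)
  moreover have "(\<lambda>v. P v = Q v) = (\<lambda>v. (P v \<longrightarrow> Q v) \<and> (Q v \<longrightarrow> P v))" by auto
  ultimately show ?thesis by simp
qed

lemma dfn_ex [dfn_intros]: "dfn (\<lambda>v. P (\<lambda>i. v (Suc i)) (v 0)) \<Longrightarrow> dfn (\<lambda>v. \<exists>x. P v x)"
  using dfn_not[OF dfn_all[of "\<lambda>v x. \<not> P v x", OF dfn_not]] by simp

lemma dfn_const [dfn_intros]: "dfn (\<lambda>v. b)"
proof -
  have "dfn (\<lambda>v. sat M (\<lambda>j. case_sum v (\<lambda>c. c) (Inr (0::'m))) (Eq (Var 0) (Var 0)))"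
    by (rule dfn_fm) simp
  then have "dfn (\<lambda>v. True)" by simp
  with dfn_not[OF this] show ?thesis by (cases b) auto
qed

lemma dfn_ball_less:
  "(\<And>j. j < n \<Longrightarrow> dfn (\<lambda>v. P v j)) \<Longrightarrow> dfn (\<lambda>v. \<forall>j<n::nat. P v j)"
proof (induction n)
  case (Suc n)
  have "dfn (\<lambda>v. (\<forall>j<n. P v j) \<and> P v n)"
    using Suc by (intro dfn_conj) auto
  moreover have "(\<lambda>v. \<forall>j<Suc n. P v j) = (\<lambda>v. (\<forall>j<n. P v j) \<and> P v n)"
    by (auto simp: less_Suc_eq)
  ultimately show ?case by simp
qed (simp add: dfn_const)

section \<open>Definable functions and composition\<close>

lemma dff_I: "dfn (\<lambda>v. v 0 = f (\<lambda>i. v (Suc i))) \<Longrightarrow> dff f"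
  by (simp add: dff_def)

lemma dff_reindex: "dff f \<Longrightarrow> dff (\<lambda>v. f (\<lambda>j. v (h j)))"
  unfolding dff_def
  using dfn_reindex[of "\<lambda>v. v 0 = f (\<lambda>i. v (Suc i))" "case_nat 0 (\<lambda>j. Suc (h j))"] by simp

text \<open>Definable functions need not be terms, so a value is inserted by quantifying over it.
  The composition rules below reduce to this one.\<close>

lemma dfn_bind:
  assumes "dff f" and "dfn (\<lambda>v. P (\<lambda>i. v (Suc i)) (v 0))"
  shows "dfn (\<lambda>v. P v (f v))"
proof -
  have "dfn (\<lambda>v. \<exists>x. x = f v \<and> P v x)"
    using assms by (intro dfn_ex dfn_conj) (simp_all add: dff_def)
  then show ?thesis by simp
qed

lemma dfn_comp1:
  assumes "dfn (\<lambda>v. P (v 0))" and "dff f"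
  shows "dfn (\<lambda>v. P (f v))"
  using dfn_bind[of f "\<lambda>v. P"] assms by simp

lemma dfn_comp2:
  assumes P: "dfn (\<lambda>v. P (v 0) (v (Suc 0)))" and f: "dff f" and g: "dff g"
  shows "dfn (\<lambda>v. P (f v) (g v))"
proof -
  \<comment> \<open>\<open>dfn_bind\<close> fills slot 0 only, so the arguments are permuted and
    inserted one at a time.\<close>
  have "dfn (\<lambda>v. P (v (Suc 0)) (v 0))"
    using dfn_reindex[OF P, of "\<lambda>i. if i = 0 then 1 else 0"] by simp
  then have "dfn (\<lambda>v. P (v 0) (g (\<lambda>i. v (Suc i))))"
    using dfn_bind[of "\<lambda>v. g (\<lambda>i. v (Suc i))" "\<lambda>v. P (v 0)"] dff_reindex[OF g] by simp
  then show ?thesis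
    using dfn_bind[of f "\<lambda>v x. P x (g v)"] f by simp
qed

lemma dfn_comp3:
  assumes P: "dfn (\<lambda>v. P (v 0) (v (Suc 0)) (v (Suc (Suc 0))))" and f: "dff f" and g: "dff g" and h: "dff h"
  shows "dfn (\<lambda>v. P (f v) (g v) (h v))"
proof -
  have "dfn (\<lambda>v. P (v (Suc 0)) (v (Suc (Suc 0))) (v 0))"
    using dfn_reindex[OF P, of "\<lambda>i. if i = 0 then 1 else if i = 1 then 2 else 0"] by (simp add: numeral_2_eq_2)
  then have "dfn (\<lambda>v. P (v 0) (v (Suc 0)) (h (\<lambda>i. v (Suc (Suc i)))))"
    using dfn_bind[of "\<lambda>v. h (\<lambda>i. v (Suc (Suc i)))" "\<lambda>v. P (v 0) (v (Suc 0))"] dff_reindex[OF h] by simp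
  then have "dfn (\<lambda>v. P (v (Suc 0)) (v 0) (h (\<lambda>i. v (Suc (Suc i)))))"
    using dfn_reindex[of "\<lambda>v. P (v 0) (v (Suc 0)) (h (\<lambda>i. v (Suc (Suc i))))"
        "\<lambda>i. if i = 0 then 1 else if i = 1 then 0 else i"] by simp
  then have "dfn (\<lambda>v. P (v 0) (g (\<lambda>i. v (Suc i))) (h (\<lambda>i. v (Suc i))))"
    using dfn_bind[of "\<lambda>v. g (\<lambda>i. v (Suc i))" "\<lambda>v x. P (v 0) x (h (\<lambda>i. v (Suc i)))"] dff_reindex[OF g] by simp
  then show ?thesis
    using dfn_bind[of f "\<lambda>v x. P x (g v) (h v)"] f by simp
qed

lemma dff_comp1:
  assumes "dff (\<lambda>v. F (v 0))" and "dff f"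
  shows "dff (\<lambda>v. F (f v))"
proof -
  have "dfn (\<lambda>v. v 0 = F (f (\<lambda>i. v (Suc i))))"
  proof (rule dfn_bind[of "\<lambda>v. f (\<lambda>i. v (Suc i))" "\<lambda>v x. v 0 = F x"])
    show "dfn (\<lambda>v. v (Suc 0) = F (v 0))"
      using assms(1) dfn_reindex[of "\<lambda>v. v 0 = F (v (Suc 0))" "\<lambda>i. if i = 0 then 1 else 0"]
      by (simp add: dff_def)
  qed (rule dff_reindex[OF assms(2)])
  then show ?thesis by (rule dff_I)
qed

section \<open>Closure under the ordered field operations\<close>

lemma dff_var [dfn_intros]: "dff (\<lambda>v. v i)"
proof -
  have "dfn (\<lambda>v. sat M (\<lambda>j. case_sum v (\<lambda>c. c) (Inl (if j = 0 then 0 else Suc i) :: nat + 'm))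
      (Eq (Var 0) (Var 1)))"
    by (rule dfn_fm) simp
  then show ?thesis by (simp add: dff_def)
qed

lemma dff_const [dfn_intros]: "dff (\<lambda>v. c)"
proof -
  have "dfn (\<lambda>v. sat M (\<lambda>j. case_sum v (\<lambda>c. c) (if j = 0 then Inl 0 else Inr c))
      (Eq (Var 0) (Var 1)))"
    by (rule dfn_fm) simp
  then show ?thesis by (simp add: dff_def)
qed

lemma dfn_eq [dfn_intros]: "dff f \<Longrightarrow> dff g \<Longrightarrow> dfn (\<lambda>v. f v = g v)"
proof (rule dfn_comp2)
  show "dfn (\<lambda>v. v 0 = v (Suc 0))"
    using dff_var[of 0] by (simp add: dff_def)
qed

lemma dfn_less [dfn_intros]: "dff f \<Longrightarrow> dff g \<Longrightarrow> dfn (\<lambda>v. f v < g v)"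
proof (rule dfn_comp2)
  have "dfn (\<lambda>v. sat M (\<lambda>j. case_sum v (\<lambda>c. c) (Inl j)) (Rl (Less L) [Var 0, Var 1]))"
    using lang by (intro dfn_fm) (simp add: ordered_ring_language_def)
  then show "dfn (\<lambda>v. v 0 < v (Suc 0))"
    using expands by (simp add: expands_field_def)
qed

lemma dfn_le [dfn_intros]: "dff f \<Longrightarrow> dff g \<Longrightarrow> dfn (\<lambda>v. f v \<le> g v)"
  using dfn_not[OF dfn_less, of g f] by (simp add: not_less)

lemma dff_comp2:
  assumes F: "dfn (\<lambda>v. v 0 = F (v (Suc 0)) (v (Suc (Suc 0))))" and f: "dff f" and g: "dff g"
  shows "dff (\<lambda>v. F (f v) (g v))"
  by (rule dff_I, rule dfn_comp3[where P = "\<lambda>x y z. x = F y z"])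
     (use F dff_var dff_reindex[OF f] dff_reindex[OF g] in auto)

lemma dff_add [dfn_intros]: "dff f \<Longrightarrow> dff g \<Longrightarrow> dff (\<lambda>v. f v + g v)"
proof (rule dff_comp2[where F = "(+)"])
  have "dfn (\<lambda>v. sat M (\<lambda>j. case_sum v (\<lambda>c. c) (Inl j)) (Eq (Var 0) (Fn (Plus L) [Var 1, Var 2])))"
    using lang by (intro dfn_fm) (simp add: ordered_ring_language_def)
  then show "dfn (\<lambda>v. v 0 = v (Suc 0) + v (Suc (Suc 0)))"
    using expands by (simp add: expands_field_def numeral_2_eq_2)
qed

lemma dff_mult [dfn_intros]: "dff f \<Longrightarrow> dff g \<Longrightarrow> dff (\<lambda>v. f v * g v)"
proof (rule dff_comp2[where F = "(*)"])
  have "dfn (\<lambda>v. sat M (\<lambda>j. case_sum v (\<lambda>c. c) (Inl j)) (Eq (Var 0) (Fn (Times L) [Var 1, Var 2])))"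
    using lang by (intro dfn_fm) (simp add: ordered_ring_language_def)
  then show "dfn (\<lambda>v. v 0 = v (Suc 0) * v (Suc (Suc 0)))"
    using expands by (simp add: expands_field_def numeral_2_eq_2)
qed

lemma dff_uminus [dfn_intros]: "dff f \<Longrightarrow> dff (\<lambda>v. - f v)"
  using dff_mult[OF dff_const[of "-1"], of f] by simp

lemma dff_diff [dfn_intros]: "dff f \<Longrightarrow> dff g \<Longrightarrow> dff (\<lambda>v. f v - g v)"
  using dff_add[OF _ dff_uminus, of f g] by simp

lemma dff_divide_const [dfn_intros]: "dff f \<Longrightarrow> dff (\<lambda>v. f v / c)"
  using dff_mult[OF dff_const[of "1 / c"], of f] by simp

lemma dff_if [dfn_intros]:
  assumes "dfn P" "dff f" "dff g"
  shows "dff (\<lambda>v. if P v then f v else g v)"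
proof (rule dff_I)
  have "dfn (\<lambda>v. (P (\<lambda>i. v (Suc i)) \<and> v 0 = f (\<lambda>i. v (Suc i)))
      \<or> (\<not> P (\<lambda>i. v (Suc i)) \<and> v 0 = g (\<lambda>i. v (Suc i))))"
    by (intro dfn_disj dfn_conj dfn_not dfn_eq dff_var dff_reindex[OF assms(2)]
        dff_reindex[OF assms(3)] dfn_reindex[OF assms(1)])
  then show "dfn (\<lambda>v. v 0 = (if P (\<lambda>i. v (Suc i)) then f (\<lambda>i. v (Suc i)) else g (\<lambda>i. v (Suc i))))"
    by (rule arg_cong[of _ _ dfn, THEN iffD1, rotated]) auto
qed

lemma dff_abs [dfn_intros]: "dff f \<Longrightarrow> dff (\<lambda>v. \<bar>f v\<bar>)"
  unfolding abs_if by (intro dff_if dfn_less dff_const dff_uminus)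

lemma dff_max [dfn_intros]: "dff f \<Longrightarrow> dff g \<Longrightarrow> dff (\<lambda>v. max (f v) (g v))"
  unfolding max_def by (intro dff_if dfn_le)

lemma dff_min [dfn_intros]: "dff f \<Longrightarrow> dff g \<Longrightarrow> dff (\<lambda>v. min (f v) (g v))"
  unfolding min_def by (intro dff_if dfn_le)

text \<open>For a unique witness, the graph of the description is \<open>P\<close> itself.
  Uniqueness is required at every assignment, so applications supply a default value where no
  witness exists.\<close>

lemma dff_The:
  assumes "dfn (\<lambda>v. P (\<lambda>i. v (Suc i)) (v 0))" and "\<And>v. \<exists>!x. P v x"
  shows "dff (\<lambda>v. THE x. P v x)"
proof (rule dff_I)
  have "(v 0 = (THE x. P (\<lambda>i. v (Suc i)) x)) = P (\<lambda>i. v (Suc i)) (v 0)" for v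
    using theI'[OF assms(2)] assms(2) by metis
  then show "dfn (\<lambda>v. v 0 = (THE x. P (\<lambda>i. v (Suc i)) x))" using assms(1) by simp
qed

subsection \<open>Definable sets and maps\<close>

lemma definable_iff_dfn:
  "definable L M n X \<longleftrightarrow> X \<subseteq> {xs. length xs = n} \<and> dfn (\<lambda>v. map v [0..<n] \<in> X)"
proof
  assume "definable L M n X"
  then obtain p e where p: "wf_fm L p"
    and X: "X = {xs. length xs = n \<and> sat M (\<lambda>j. if j < n then xs ! j else e j) p}"
    unfolding definable_def by auto
  have *: "(\<lambda>j. if j < n then map v [0..<n] ! j else e j)
      = (\<lambda>j. case_sum v (\<lambda>c. c) (if j < n then Inl j else Inr (e j)))" for v
    by auto
  have "dfn (\<lambda>v. map v [0..<n] \<in> X)"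
    using dfn_fm[OF p, of "\<lambda>j. if j < n then Inl j else Inr (e j)"]
    unfolding X mem_Collect_eq * by simp
  then show "X \<subseteq> {xs. length xs = n} \<and> dfn (\<lambda>v. map v [0..<n] \<in> X)" using X by auto
next
  assume *: "X \<subseteq> {xs. length xs = n} \<and> dfn (\<lambda>v. map v [0..<n] \<in> X)"
  then obtain p s where p: "wf_fm L p"
    and P: "\<And>v. (map v [0..<n] \<in> X) = sat M (assign s v) p"
    unfolding dfn_def by blast
  \<comment> \<open>In \<open>definable\<close> the parameters occupy the positions from
    \<open>n\<close> on. A variable reading a slot below \<open>n\<close> is sent to that slot; any
    other variable \<open>j\<close> goes to \<open>n + j\<close>, where \<open>e\<close> stores its
    parameter, or a dummy 0 for a slot beyond the list.\<close>
  define h where "h j = (case s j of Inl i \<Rightarrow> if i < n then i else n + j | Inr c \<Rightarrow> n + j)" for j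
  define e where "e j = (case s (j - n) of Inl i \<Rightarrow> 0 | Inr c \<Rightarrow> c)" for j
  have "xs \<in> X \<longleftrightarrow> sat M (\<lambda>j. if j < n then xs ! j else e j) (rename_fm h p)" if "length xs = n" for xs
  proof -
    define v where "v j = (if j < n then xs ! j else 0)" for j
    have "map v [0..<n] = xs" using that by (auto simp: v_def intro: nth_equalityI)
    moreover have "(assign s v) = (\<lambda>j. if j < n then xs ! j else e j) \<circ> h"
      by (auto simp: v_def h_def e_def fun_eq_iff split: sum.splits)
    ultimately show ?thesis using P[of v] by (simp add: sat_rename_fm)
  qed
  then have "X = {xs. length xs = n \<and> set xs \<subseteq> Dom M \<and> sat M (\<lambda>j. if j < n then xs ! j else e j) (rename_fm h p)}"
    using * by auto
  moreover have "range e \<subseteq> Dom M" by simp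
  ultimately show "definable L M n X"
    unfolding definable_def using wf_rename_fm[OF p] by blast
qed

text \<open>Block quantification is needed to project the graph of a map to a single component. The
  induction splits off the last entry, which becomes slot 0 of the remaining assignment.\<close>

lemma dfn_ex_list:
  assumes "dfn P"
  shows "dfn (\<lambda>v. \<exists>ys. length ys = n \<and> P (\<lambda>i. if i < n then ys ! i else v (i - n)))"
  using assms
proof (induction n arbitrary: P)
  case (Suc n)
  define Q where "Q v = (\<exists>ys. length ys = n \<and> P (\<lambda>i. if i < n then ys ! i else v (i - n)))" for v
  have "(\<exists>ys. length ys = Suc n \<and> P (\<lambda>i. if i < Suc n then ys ! i else v (i - Suc n)))
     = (\<exists>y. Q (case_nat y v))" for v
  proof -
    have *: "(\<lambda>i. if i < Suc n then (ys @ [y]) ! i else v (i - Suc n))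
        = (\<lambda>i. if i < n then ys ! i else case_nat y v (i - n))" if "length ys = n" for ys y
    proof
      fix i
      consider "i < n" | "i = n" | k where "i = Suc (n + k)"
        using less_linear[of i n] by (auto simp: less_iff_Suc_add[of n i])
      then show "(if i < Suc n then (ys @ [y]) ! i else v (i - Suc n))
        = (if i < n then ys ! i else case_nat y v (i - n))"
        using that by cases (auto simp: nth_append)
    qed
    show ?thesis
    proof
      assume "\<exists>ys. length ys = Suc n \<and> P (\<lambda>i. if i < Suc n then ys ! i else v (i - Suc n))"
      then obtain ys where "length ys = Suc n" "P (\<lambda>i. if i < Suc n then ys ! i else v (i - Suc n))" by blast
      moreover from this(1) obtain zs y where zs: "ys = zs @ [y]" "length zs = n"
        by (metis length_Suc_conv_rev)
      ultimately have "P (\<lambda>i. if i < n then zs ! i else case_nat y v (i - n))"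
        using *[OF zs(2), of y] by (simp only:)
      with zs(2) show "\<exists>y. Q (case_nat y v)" unfolding Q_def by blast
    next
      assume "\<exists>y. Q (case_nat y v)"
      then obtain y ys where "length ys = n" "P (\<lambda>i. if i < n then ys ! i else case_nat y v (i - n))"
        unfolding Q_def by blast
      with *[of ys y] show "\<exists>ys. length ys = Suc n \<and> P (\<lambda>i. if i < Suc n then ys ! i else v (i - Suc n))"
        by (intro exI[of _ "ys @ [y]"] conjI) (simp_all only: length_append_singleton)
    qed
  qed
  moreover have "dfn (\<lambda>v. \<exists>y. Q (case_nat y v))"
  proof (rule dfn_ex)
    have "dfn Q" using Suc unfolding Q_def by blast
    moreover have "case_nat (v 0) (\<lambda>i. v (Suc i)) = v" for v :: "nat \<Rightarrow> 'm"
      by (auto split: nat.splits)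
    ultimately show "dfn (\<lambda>v. Q (case_nat (v 0) (\<lambda>i. v (Suc i))))" by simp
  qed
  ultimately show ?case by simp
qed simp

text \<open>Off the domain \<open>A\<close> the components are set to zero.\<close>

lemma definable_map_component:
  assumes "definable_map L M A n f" and "j < n"
  shows "dff (\<lambda>v. if v 0 \<in> A then f (v 0) ! j else 0)"
proof -
  define P where "P v \<longleftrightarrow> map v [0..<Suc n] \<in> {t # f t |t. t \<in> A}" for v
  have len: "length (f t) = n" if "t \<in> A" for t
    using assms that by (auto simp: definable_map_def)
  have "dfn P" using assms unfolding definable_map_def definable_iff_dfn P_def by blast
  have P_eq: "P (case_nat t v) \<longleftrightarrow> t \<in> A \<and> f t = map v [0..<n]" for t v
    by (auto simp: P_def map_upt_Suc simp del: upt_Suc)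
  \<comment> \<open>The graph lists the argument before the values, whereas the block quantifier
    binds the first \<open>n\<close> slots. So the argument moves to slot \<open>n\<close>, and slot
    \<open>n + 1\<close> holds the candidate for the component.\<close>
  define Q where "Q v \<longleftrightarrow> P (\<lambda>i. if i = 0 then v n else v (i - 1)) \<and> v j = v (Suc n)" for v
  have "dfn Q" unfolding Q_def
    using dfn_reindex[OF \<open>dfn P\<close>, of "\<lambda>i. if i = 0 then n else i - 1"]
    by (intro dfn_conj dfn_eq dff_var) (simp add: if_distrib[where f = "\<lambda>x. _ x"] cong: if_cong)
  have Qeq: "(\<exists>ys. length ys = n \<and> Q (\<lambda>i. if i < n then ys ! i else v (i - n))) \<longleftrightarrow> v 0 \<in> A \<and> f (v 0) ! j = v 1" for v
  proof -
    have "(\<lambda>i. if i = 0 then v (n - n) else if i - 1 < n then ys ! (i - 1) else v (i - 1 - n))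
       = case_nat (v 0) (\<lambda>i. if i < n then ys ! i else v (i - n))" for ys
      by (auto split: nat.splits)
    moreover have "map (\<lambda>i. if i < n then ys ! i else v (i - n)) [0..<n] = ys" if "length ys = n" for ys
      using that by (auto intro: nth_equalityI)
    ultimately have "Q (\<lambda>i. if i < n then ys ! i else v (i - n)) \<longleftrightarrow> v 0 \<in> A \<and> f (v 0) = ys \<and> ys ! j = v 1"
      if "length ys = n" for ys
      using that P_eq \<open>j < n\<close> by (simp add: Q_def)
    then show ?thesis using len by auto
  qed
  have R: "dfn (\<lambda>v. v 0 \<in> A \<and> f (v 0) ! j = v (Suc 0))"
    using dfn_ex_list[OF \<open>dfn Q\<close>, of n] unfolding Qeq by simp
  have R': "dfn (\<lambda>v. v (Suc 0) \<in> A \<and> f (v (Suc 0)) ! j = v 0)"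
    using dfn_reindex[OF R, of "\<lambda>i. if i = 0 then 1 else 0"] by simp
  have "dfn (\<lambda>v. \<exists>y. v 0 \<in> A \<and> f (v 0) ! j = y)"
    by (rule dfn_ex) (rule R')
  then have "dfn (\<lambda>v. v 0 \<in> A)" by simp
  then have A: "dfn (\<lambda>v. v (Suc 0) \<in> A)"
    using dfn_reindex[of "\<lambda>v. v 0 \<in> A" "\<lambda>i. Suc i"] by simp
  have "dfn (\<lambda>v. (v (Suc 0) \<in> A \<and> f (v (Suc 0)) ! j = v 0) \<or> (v (Suc 0) \<notin> A \<and> v 0 = 0))"
    by (rule dfn_disj[OF R' dfn_conj[OF dfn_not[OF A] dfn_eq[OF dff_var dff_const]]])
  then have "dfn (\<lambda>v. v 0 = (if v (Suc 0) \<in> A then f (v (Suc 0)) ! j else 0))"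
    by (rule arg_cong[of _ _ dfn, THEN iffD1, rotated]) auto
  then show ?thesis by (rule dff_I)
qed

lemma definable_mapI:
  assumes A: "dfn (\<lambda>v. v 0 \<in> A)" and len: "\<And>t. t \<in> A \<Longrightarrow> length (f t) = n"
    and F: "\<And>j. j < n \<Longrightarrow> dff (\<lambda>v. F j (v 0))" and eq: "\<And>t j. t \<in> A \<Longrightarrow> j < n \<Longrightarrow> f t ! j = F j t"
  shows "definable_map L M A n f"
proof -
  have "map v [0..<Suc n] \<in> {t # f t |t. t \<in> A} \<longleftrightarrow> v 0 \<in> A \<and> (\<forall>j<n. v (Suc j) = F j (v 0))" for v
  proof -
    have "map v [0..<Suc n] = v 0 # map (\<lambda>i. v (Suc i)) [0..<n]"
      by (rule map_upt_Suc)
    moreover have "map (\<lambda>i. v (Suc i)) [0..<n] = f (v 0) \<longleftrightarrow> (\<forall>j<n. v (Suc j) = F j (v 0))" if "v 0 \<in> A"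
      using that len eq by (auto simp: list_eq_iff_nth_eq)
    ultimately show ?thesis by auto
  qed
  moreover have "dfn (\<lambda>v. v 0 \<in> A \<and> (\<forall>j<n. v (Suc j) = F j (v 0)))"
    by (intro dfn_conj A dfn_ball_less dfn_eq dff_var F)
  ultimately show ?thesis
    using len by (auto simp: definable_map_def definable_iff_dfn)
qed

end

section \<open>Eventual properties at zero\<close>

lemma evI: "0 < \<epsilon> \<Longrightarrow> (\<And>t. 0 < t \<Longrightarrow> t < \<epsilon> \<Longrightarrow> P t) \<Longrightarrow> ev P"
  unfolding ev_def by blast

lemma evE:
  assumes "ev P"
  obtains \<epsilon> where "0 < \<epsilon>" "\<And>t. 0 < t \<Longrightarrow> t < \<epsilon> \<Longrightarrow> P t"
  using assms unfolding ev_def by blast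

lemma ev_mono: "ev P \<Longrightarrow> (\<And>t. 0 < t \<Longrightarrow> P t \<Longrightarrow> Q t) \<Longrightarrow> ev Q"
  unfolding ev_def by blast

lemma ev_conj: "ev P \<Longrightarrow> ev Q \<Longrightarrow> ev (\<lambda>t. P t \<and> Q t)"
proof (elim evE)
  fix \<epsilon> \<epsilon>'
  assume "0 < \<epsilon>" "0 < \<epsilon>'" "\<And>t. 0 < t \<Longrightarrow> t < \<epsilon> \<Longrightarrow> P t" "\<And>t. 0 < t \<Longrightarrow> t < \<epsilon>' \<Longrightarrow> Q t"
  then show ?thesis by (intro evI[of "min \<epsilon> \<epsilon>'"]) auto
qed

lemma ev_mono2: "ev P \<Longrightarrow> ev Q \<Longrightarrow> (\<And>t. 0 < t \<Longrightarrow> P t \<Longrightarrow> Q t \<Longrightarrow> R t) \<Longrightarrow> ev R"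
  using ev_mono[OF ev_conj, of P Q R] by blast

lemma ev_decided_conj:
  assumes "ev P \<or> ev (\<lambda>t. \<not> P t)" "ev Q \<or> ev (\<lambda>t. \<not> Q t)"
  shows "ev (\<lambda>t. P t \<and> Q t) \<or> ev (\<lambda>t. \<not> (P t \<and> Q t))"
  using assms(1)
proof
  assume P: "ev P"
  from assms(2) show ?thesis
  proof
    assume "ev Q" with P show ?thesis by (blast intro: ev_conj)
  next
    assume "ev (\<lambda>t. \<not> Q t)" then show ?thesis by (blast intro: ev_mono)
  qed
next
  assume "ev (\<lambda>t. \<not> P t)" then show ?thesis by (blast intro: ev_mono)
qed

lemma ev_decided_disj:
  assumes "ev P \<or> ev (\<lambda>t. \<not> P t)" "ev Q \<or> ev (\<lambda>t. \<not> Q t)"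
  shows "ev (\<lambda>t. P t \<or> Q t) \<or> ev (\<lambda>t. \<not> (P t \<or> Q t))"
  using ev_decided_conj[of "\<lambda>t. \<not> P t" "\<lambda>t. \<not> Q t"] assms by auto

text \<open>Intervals to the right of zero are nonempty by density. This is how a witness is
  extracted from an eventual statement: its existence does not depend on \<open>t\<close>.\<close>

lemma ev_const [simp]: "ev (\<lambda>_. b) = b"
proof -
  have "\<exists>t. 0 < t \<and> t < \<epsilon>" if "0 < \<epsilon>" for \<epsilon> :: 'a
    using that dense by blast
  then show ?thesis by (auto simp: ev_def intro: exI[of _ 1])
qed

lemma ev_less: "0 < \<epsilon> \<Longrightarrow> ev (\<lambda>t. t < \<epsilon>)"
  by (auto intro: evI)

lemma ev_pos: "ev (\<lambda>t. 0 < t)"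
  by (rule evI[of 1]) auto

lemma ev_ball_less: "(\<And>j. j < n \<Longrightarrow> ev (P j)) \<Longrightarrow> ev (\<lambda>t. \<forall>j<n::nat. P j t)"
proof (induction n)
  case (Suc n)
  then have "ev (\<lambda>t. (\<forall>j<n. P j t) \<and> P n t)" by (intro ev_conj) auto
  then show ?case by (rule ev_mono) (auto simp: less_Suc_eq)
qed simp

section \<open>One-variable consequences of o-minimality\<close>

context ominimal_field
begin

abbreviation dfn1 :: "('m \<Rightarrow> bool) \<Rightarrow> bool" where
  "dfn1 P \<equiv> dfn (\<lambda>v. P (v 0))"

abbreviation dff1 :: "('m \<Rightarrow> 'm) \<Rightarrow> bool" where
  "dff1 f \<equiv> dff (\<lambda>v. f (v 0))"

lemma basic_interval_iff:
  "basic_interval L M I \<longleftrightarrow> I = UNIV \<or> (\<exists>b. I = {b}) \<or> (\<exists>b. I = {b<..}) \<or> (\<exists>c. I = {..<c})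
     \<or> (\<exists>b c. I = {b<..<c})"
  using expands unfolding basic_interval_def expands_field_def
  by (auto simp: greaterThan_def lessThan_def greaterThanLessThan_def Int_def Let_def)

text \<open>Packages o-minimality as an induction principle, so that each consequence below has to
  be checked only on basic intervals and binary unions.\<close>

lemma dfn1_induct:
  assumes "dfn1 P" "Q {}" "Q UNIV" "\<And>b. Q {b}" "\<And>b. Q {b<..}" "\<And>c. Q {..<c}" "\<And>b c. Q {b<..<c}"
    and un: "\<And>A B. Q A \<Longrightarrow> Q B \<Longrightarrow> Q (A \<union> B)"
  shows "Q {x. P x}"
proof -
  have eq: "map v [0..<1] \<in> {[x] |x. P x} \<longleftrightarrow> P (v 0)" for v by auto
  have "definable L M 1 {[x] |x. P x}"
    unfolding definable_iff_dfn eq using assms(1) by auto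
  then obtain F where F: "finite F" "\<forall>I\<in>F. basic_interval L M I" "{x. P x} = \<Union>F"
    using ominimal[unfolded ominimal_def, rule_format, of "{[x] |x. P x}"] by auto
  have "Q (\<Union>F)"
    using F(1,2)
  proof (induction F)
    case (insert I F)
    then have "Q I" using assms(3-7) unfolding basic_interval_iff by auto
    with insert un show ?case by simp
  qed (use assms(2) in simp)
  with F(3) show ?thesis by simp
qed

text \<open>The zero-one law behind the linear order on germs: a definable property that does not
  hold eventually fails eventually.\<close>

lemma dfn1_ev_at:
  assumes "dfn1 P"
  shows "ev (\<lambda>t. P (a + t)) \<or> ev (\<lambda>t. \<not> P (a + t))"
proof -
  have right: "ev (\<lambda>t. a + t < c) \<or> ev (\<lambda>t. \<not> a + t < c)" for c
  proof (cases "a < c")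
    case True
    then show ?thesis by (auto intro!: evI[of "c - a"] simp: algebra_simps)
  next
    case False
    then show ?thesis by (auto intro!: ev_mono[OF ev_pos])
  qed
  have left: "ev (\<lambda>t. c < a + t) \<or> ev (\<lambda>t. \<not> c < a + t)" for c
  proof (cases "a < c")
    case True
    then show ?thesis by (auto intro!: evI[of "c - a"] simp: algebra_simps)
  next
    case False
    then show ?thesis by (auto intro!: ev_mono[OF ev_pos])
  qed
  have "ev (\<lambda>t. a + t \<in> {x. P x}) \<or> ev (\<lambda>t. a + t \<notin> {x. P x})"
    using assms
  proof (rule dfn1_induct)
    show "ev (\<lambda>t. a + t \<in> {b}) \<or> ev (\<lambda>t. a + t \<notin> {b})" for b
    proof (cases "a < b")
      case True
      then show ?thesis by (auto intro!: evI[of "b - a"] simp: algebra_simps)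
    next
      case False
      then show ?thesis by (auto intro!: ev_mono[OF ev_pos])
    qed
    show "ev (\<lambda>t. a + t \<in> {b<..<c}) \<or> ev (\<lambda>t. a + t \<notin> {b<..<c})" for b c
      using ev_decided_conj[OF left[of b] right[of c]] by simp
    show "ev (\<lambda>t. a + t \<in> A \<union> B) \<or> ev (\<lambda>t. a + t \<notin> A \<union> B)"
      if "ev (\<lambda>t. a + t \<in> A) \<or> ev (\<lambda>t. a + t \<notin> A)" "ev (\<lambda>t. a + t \<in> B) \<or> ev (\<lambda>t. a + t \<notin> B)" for A B
      using ev_decided_disj[OF that] by simp
  qed (use left right in auto)
  then show ?thesis by simp
qed

lemma dfn1_ev: "dfn1 P \<Longrightarrow> ev P \<or> ev (\<lambda>t. \<not> P t)"
  using dfn1_ev_at[of P 0] by simp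

text \<open>Definable completeness, the substitute for Dedekind completeness. The supremum of a
  union is the larger of the two suprema.\<close>

lemma dfn1_lub:
  assumes "dfn1 P" and "P x" and "\<And>x. P x \<Longrightarrow> x \<le> u"
  obtains s where "\<And>x. P x \<Longrightarrow> x \<le> s" and "\<And>u. (\<And>x. P x \<Longrightarrow> x \<le> u) \<Longrightarrow> s \<le> u"
proof -
  have no_top: "\<exists>y. x < y" "\<exists>y. y < x" for x :: 'm by (rule gt_ex lt_ex)+
  define Q where "Q A \<longleftrightarrow> A \<noteq> {} \<and> (\<exists>u. \<forall>x\<in>A. x \<le> u)
      \<longrightarrow> (\<exists>s. (\<forall>x\<in>A. x \<le> s) \<and> (\<forall>u. (\<forall>x\<in>A. x \<le> u) \<longrightarrow> s \<le> u))" for A :: "'m set"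
  have "Q {x. P x}"
    using assms(1)
  proof (rule dfn1_induct)
    show "Q UNIV" unfolding Q_def using no_top by (meson UNIV_I not_le)
    show "Q {b<..}" for b
    proof -
      have "\<exists>x>b. u < x" for u using gt_ex[of "max b u"] by auto
      then show ?thesis unfolding Q_def by (meson greaterThan_iff not_le)
    qed
    show "Q {..<c}" for c
      unfolding Q_def by (intro impI exI[of _ c]) (auto intro: dense_le)
    show "Q {b<..<c}" for b c
      unfolding Q_def by (intro impI exI[of _ c]) (auto intro: dense_le_bounded[of b c])
    show "Q (A \<union> B)" if "Q A" "Q B" for A B
    proof (cases "A = {} \<or> B = {}")
      case False
      show ?thesis unfolding Q_def
      proof
        assume "A \<union> B \<noteq> {} \<and> (\<exists>u. \<forall>x\<in>A \<union> B. x \<le> u)"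
        then have "\<exists>u. \<forall>x\<in>A. x \<le> u" "\<exists>u. \<forall>x\<in>B. x \<le> u" by auto
        with that False have "\<exists>s. (\<forall>x\<in>A. x \<le> s) \<and> (\<forall>u. (\<forall>x\<in>A. x \<le> u) \<longrightarrow> s \<le> u)"
          "\<exists>s. (\<forall>x\<in>B. x \<le> s) \<and> (\<forall>u. (\<forall>x\<in>B. x \<le> u) \<longrightarrow> s \<le> u)"
          unfolding Q_def by simp_all
        then obtain s s' where
          "\<forall>x\<in>A. x \<le> s" "\<forall>u. (\<forall>x\<in>A. x \<le> u) \<longrightarrow> s \<le> u"
          "\<forall>x\<in>B. x \<le> s'" "\<forall>u. (\<forall>x\<in>B. x \<le> u) \<longrightarrow> s' \<le> u"
          by blast
        then show "\<exists>s. (\<forall>x\<in>A \<union> B. x \<le> s) \<and> (\<forall>u. (\<forall>x\<in>A \<union> B. x \<le> u) \<longrightarrow> s \<le> u)"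
          by (intro exI[of _ "max s s'"]) (auto simp: le_max_iff_disj)
      qed
    qed (use that in auto)
  qed (auto simp: Q_def)
  moreover have "{x. P x} \<noteq> {}" "\<exists>u. \<forall>x\<in>{x. P x}. x \<le> u" using assms(2,3) by auto
  ultimately obtain s where "\<forall>x\<in>{x. P x}. x \<le> s" "\<forall>u. (\<forall>x\<in>{x. P x}. x \<le> u) \<longrightarrow> s \<le> u"
    unfolding Q_def by blast
  then show ?thesis using that by auto
qed

text \<open>The dichotomy is used in both directions: a nonempty definable set without a subinterval
  is finite and has a minimum, and an infinite one contains an interval.\<close>

lemma dfn1_finite_or_interval:
  assumes "dfn1 P"
  shows "finite {x. P x} \<or> (\<exists>p q. p < q \<and> {p<..<q} \<subseteq> {x. P x})"
  using assms
proof (rule dfn1_induct)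
  fix b c :: 'm
  show "finite UNIV \<or> (\<exists>p q :: 'm. p < q \<and> {p<..<q} \<subseteq> UNIV)"
    by (intro disjI2 exI[of _ 0] exI[of _ 1]) auto
  show "finite {b<..} \<or> (\<exists>p q. p < q \<and> {p<..<q} \<subseteq> {b<..})"
    by (intro disjI2 exI[of _ b] exI[of _ "b + 1"]) auto
  show "finite {..<c} \<or> (\<exists>p q. p < q \<and> {p<..<q} \<subseteq> {..<c})"
    by (intro disjI2 exI[of _ "c - 1"] exI[of _ "c"]) auto
  show "finite {b<..<c} \<or> (\<exists>p q. p < q \<and> {p<..<q} \<subseteq> {b<..<c})"
    by (cases "b < c") auto
  show "finite (A \<union> B) \<or> (\<exists>p q. p < q \<and> {p<..<q} \<subseteq> A \<union> B)"
    if "finite A \<or> (\<exists>p q. p < q \<and> {p<..<q} \<subseteq> A)" "finite B \<or> (\<exists>p q. p < q \<and> {p<..<q} \<subseteq> B)" for A B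
    using that by (elim disjE) (simp, blast+)
qed simp_all

text \<open>A definable relation \<open>P x r\<close> that is downward closed in \<open>r > 0\<close> has the definable selection
  given by half of the supremum of \<open>{r \<le> 1. P x r}\<close>.\<close>

lemma dff1_selection:
  assumes P: "dfn (\<lambda>v. P (v 0) (v (Suc 0)))"
    and down: "\<And>x r r'. P x r \<Longrightarrow> 0 < r' \<Longrightarrow> r' \<le> r \<Longrightarrow> P x r'"
  obtains \<delta> where "dff1 \<delta>" "\<And>x. 0 < \<delta> x" "\<And>x r. P x r \<Longrightarrow> 0 < r \<Longrightarrow> P x (\<delta> x)"
proof -
  define S where "S x r \<longleftrightarrow> 0 < r \<and> r \<le> 1 \<and> P x r" for x r
  \<comment> \<open>The cap \<open>r \<le> 1\<close> in \<open>S\<close> bounds the supremum, and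
    the default 1 keeps \<open>\<delta>\<close> positive where no radius works.\<close>
  define G where "G x s \<longleftrightarrow> (if \<exists>r. S x r
      then (\<forall>r. S x r \<longrightarrow> r \<le> s) \<and> (\<forall>u. (\<forall>r. S x r \<longrightarrow> r \<le> u) \<longrightarrow> s \<le> u) else s = 1)" for x s
  define \<delta> where "\<delta> x = (THE s. G x s) / 2" for x
  have Sd: "dfn (\<lambda>v. S (v 0) (v (Suc 0)))" unfolding S_def by (intro dfn_intros P)
  have ex1: "\<exists>!s. G x s" for x
  proof (cases "\<exists>r. S x r")
    case True
    have "dfn (\<lambda>v. S x (v 0))" by (rule dfn_comp2[OF Sd]) (intro dfn_intros)+
    from True dfn1_lub[OF this, of _ 1]
    obtain s where "\<And>r. S x r \<Longrightarrow> r \<le> s" "\<And>u. (\<And>r. S x r \<Longrightarrow> r \<le> u) \<Longrightarrow> s \<le> u"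
      unfolding S_def by (metis (no_types, lifting))
    with True have "G x s" unfolding G_def by auto
    moreover have "s' = s" if "G x s'" for s'
      using that \<open>G x s\<close> True unfolding G_def by (auto intro: order.antisym)
    ultimately show ?thesis by blast
  qed (auto simp: G_def)
  have G: "G x (2 * \<delta> x)" for x
    using theI'[OF ex1, of x] by (simp add: \<delta>_def)
  have "dfn (\<lambda>v. G (v (Suc 0)) (v 0))"
    unfolding G_def if_bool_eq_conj by (intro dfn_intros dfn_comp2[OF Sd])
  then have "dff1 \<delta>"
    unfolding \<delta>_def by (intro dfn_intros dff_The) (use ex1 in auto)
  moreover have *: "0 < \<delta> x \<and> (P x r \<longrightarrow> 0 < r \<longrightarrow> P x (\<delta> x))" for x r
  proof (cases "\<exists>r. S x r")
    case True
    then obtain r where r: "S x r" by blast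
    with G[of x] True have "r \<le> 2 * \<delta> x" unfolding G_def by (simp only: if_True)
    with r have pos: "0 < \<delta> x" unfolding S_def by auto
    \<comment> \<open>The supremum itself need not be admissible, but half of it is no upper bound,
      so an admissible radius exceeds it and downward closure applies.\<close>
    have "\<exists>r'. S x r' \<and> \<delta> x < r'"
    proof (rule ccontr)
      assume "\<not> (\<exists>r'. S x r' \<and> \<delta> x < r')"
      then have "2 * \<delta> x \<le> \<delta> x" using G[of x] True unfolding G_def by (auto simp: not_less)
      with pos show False by simp
    qed
    with down pos show ?thesis unfolding S_def by (meson less_imp_le)
  next
    case False
    have "\<not> P x r" if "0 < r"
      using False down[of x r "min r 1"] that unfolding S_def by force
    moreover have "2 * \<delta> x = 1" using G[of x] False unfolding G_def by (simp only: if_False)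
    then have "0 < \<delta> x" by (metis zero_less_mult_pos zero_less_numeral zero_less_one)
    ultimately show ?thesis by blast
  qed
  ultimately show ?thesis using that by blast
qed

text \<open>If the conclusion fails, the sets \<open>{x. e \<le> \<delta> x}\<close> are finite and their least elements are record
  points of \<open>\<delta>\<close> arbitrarily close to \<open>p\<close>. So all points near \<open>p\<close> are records, which means that
  \<open>\<delta>\<close> increases there.\<close>

lemma positive_bounded_below:
  assumes \<delta>: "dff1 \<delta>" and "p < q" and pos: "\<And>x. p < x \<Longrightarrow> x < q \<Longrightarrow> 0 < \<delta> x"
  obtains p' q' e where "p' < q'" "{p'<..<q'} \<subseteq> {p<..<q}" "0 < e" "\<And>x. p' < x \<Longrightarrow> x < q' \<Longrightarrow> e \<le> \<delta> x"
proof (rule ccontr)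
  assume "\<not> thesis"
  with that have no: "\<not> (p' < q' \<and> {p'<..<q'} \<subseteq> {p<..<q} \<and> 0 < e \<and> (\<forall>x\<in>{p'<..<q'}. e \<le> \<delta> x))" for p' q' e
    by (metis greaterThanLessThan_iff)
  \<comment> \<open>A subinterval of this set would be one on which \<open>e\<close> bounds
    \<open>\<delta>\<close> from below, against the assumption.\<close>
  have fin: "finite {x. p < x \<and> x < q \<and> e \<le> \<delta> x}" if "0 < e" for e
  proof -
    have "dfn1 (\<lambda>x. p < x \<and> x < q \<and> e \<le> \<delta> x)" by (intro dfn_intros \<delta>)
    moreover have "\<not> {p'<..<q'} \<subseteq> {x. p < x \<and> x < q \<and> e \<le> \<delta> x}" if "p' < q'" for p' q'
      using no[of p' q' e] that \<open>0 < e\<close> by (auto simp: subset_iff)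
    ultimately show ?thesis using dfn1_finite_or_interval[of "\<lambda>x. p < x \<and> x < q \<and> e \<le> \<delta> x"] by blast
  qed
  define R where "R x \<longleftrightarrow> p < x \<and> x < q \<and> (\<forall>y. p < y \<longrightarrow> y < x \<longrightarrow> \<delta> y < \<delta> x)" for x
  have "dfn1 R" unfolding R_def by (intro dfn_intros dff_comp1[OF \<delta>])
  from dfn1_ev_at[OF this, of p] show False
  proof
    assume "ev (\<lambda>t. R (p + t))"
    from evE[OF this] obtain \<eta> where "0 < \<eta>" and \<eta>: "\<And>t. 0 < t \<Longrightarrow> t < \<eta> \<Longrightarrow> R (p + t)" by blast
    have R: "R x" if "p < x" "x < p + \<eta>" for x
      using \<eta>[of "x - p"] that by (simp add: algebra_simps)
    define x0 where "x0 = p + \<eta> / 2"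
    have x0: "p < x0" "x0 < p + \<eta>" using \<open>0 < \<eta>\<close> by (auto simp: x0_def)
    have "\<delta> x0 \<le> \<delta> x" if "x0 < x" "x < p + \<eta>" for x
      using R[of x] that x0 unfolding R_def by auto
    moreover have "{x0<..<p + \<eta>} \<subseteq> {p<..<q}" using R x0 unfolding R_def by fastforce
    moreover have "0 < \<delta> x0" using R[OF x0] pos x0 unfolding R_def by auto
    ultimately show False using no[of x0 "p + \<eta>" "\<delta> x0"] x0 by auto
  next
    assume "ev (\<lambda>t. \<not> R (p + t))"
    from evE[OF this] obtain \<eta> where "0 < \<eta>" and \<eta>: "\<And>t. 0 < t \<Longrightarrow> t < \<eta> \<Longrightarrow> \<not> R (p + t)" by blast
    define x0 where "x0 = p + min \<eta> (q - p) / 2"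
    have x0: "p < x0" "x0 < p + \<eta>" "x0 < q"
      using \<open>0 < \<eta>\<close> \<open>p < q\<close> by (auto simp: x0_def min_def field_simps)
    define A where "A = {x. p < x \<and> x < q \<and> \<delta> x0 \<le> \<delta> x}"
    have "x0 \<in> A" using x0 by (simp add: A_def)
    have "finite A" using fin[of "\<delta> x0"] pos x0 by (simp add: A_def)
    \<comment> \<open>Points of the interval to the left of \<open>m\<close> have values below
      \<open>\<delta> x0\<close>, hence below \<open>\<delta> m\<close>, so \<open>m\<close> is a
      record.\<close>
    define m where "m = Min A"
    have m: "m \<in> A" "m \<le> x0" "\<And>y. y < m \<Longrightarrow> y \<notin> A"
      using \<open>finite A\<close> \<open>x0 \<in> A\<close> unfolding m_def by (auto intro!: Min_in dest: Min_le simp: not_le[symmetric])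
    then have "R m" unfolding R_def A_def by fastforce
    moreover have "\<not> R m" using \<eta>[of "m - p"] m x0 unfolding A_def by (auto simp: algebra_simps)
    ultimately show False by simp
  qed
qed

section \<open>Monotonicity on a subinterval, uniformly for the three order relations\<close>

definition strictly_monotone_on :: "'m set \<Rightarrow> ('m \<Rightarrow> 'm) \<Rightarrow> bool" where
  "strictly_monotone_on S f \<longleftrightarrow>
     (\<exists>R\<in>{(<), (=), (>)}. \<forall>x\<in>S. \<forall>y\<in>S. x < y \<longrightarrow> R (f x) (f y))"

lemma strictly_monotone_onI:
  "R \<in> {(<), (=), (>)} \<Longrightarrow> (\<And>x y. x \<in> S \<Longrightarrow> y \<in> S \<Longrightarrow> x < y \<Longrightarrow> R (f x) (f y)) \<Longrightarrow> strictly_monotone_on S f"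
  unfolding strictly_monotone_on_def by (rule bexI[of _ R]) auto

lemma strictly_monotone_onE:
  assumes "strictly_monotone_on S f"
  obtains R where "R \<in> {(<), (=), (>)}" "\<And>x y. x \<in> S \<Longrightarrow> y \<in> S \<Longrightarrow> x < y \<Longrightarrow> R (f x) (f y)"
  using assms unfolding strictly_monotone_on_def by (elim bexE) auto

lemma dfn_relations:
  "R \<in> {(<), (=), (>)} \<Longrightarrow> dff f \<Longrightarrow> dff g \<Longrightarrow> dfn (\<lambda>v. R (f v) (g v))"
  by (auto intro: dfn_less dfn_eq)

lemma relation_at:
  assumes f: "dff1 f"
  shows "\<exists>R\<in>{(<), (=), (>)}. ev (\<lambda>t. R (f x) (f (x + t)))"
proof -
  have "dfn1 (\<lambda>y. f x < f y)" "dfn1 (\<lambda>y. f x = f y)" by (intro dfn_intros f)+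
  from this[THEN dfn1_ev_at, of x] show ?thesis
  proof (elim disjE)
    assume "ev (\<lambda>t. \<not> f x < f (x + t))" "ev (\<lambda>t. f x \<noteq> f (x + t))"
    then have "ev (\<lambda>t. f x > f (x + t))" by (rule ev_conj[THEN ev_mono]) auto
    then show ?thesis by simp
  qed auto
qed

text \<open>If each of the three relations failed eventually, all three would fail on a common
  interval next to \<open>p\<close>, contrary to the hypothesis.\<close>

lemma relation_ev:
  assumes P: "\<And>R. R \<in> {(<), (=), (>)} \<Longrightarrow> dfn1 (P R)"
    and ex: "\<And>\<epsilon>. 0 < \<epsilon> \<Longrightarrow> \<exists>t. 0 < t \<and> t < \<epsilon> \<and> (\<exists>R\<in>{(<), (=), (>)}. P R (p + t))"
  shows "\<exists>R\<in>{(<), (=), (>) :: 'm \<Rightarrow> 'm \<Rightarrow> bool}. ev (\<lambda>t. P R (p + t))"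
proof (rule ccontr)
  assume no: "\<not> ?thesis"
  have "ev (\<lambda>t. \<not> P R (p + t))" if "R \<in> {(<), (=), (>)}" for R
    using dfn1_ev_at[OF P[OF that], of p] no that by blast
  from this[of "(<)"] this[of "(=)"] this[of "(>)"]
  have "ev (\<lambda>t. \<not> P (<) (p + t) \<and> \<not> P (=) (p + t) \<and> \<not> P (>) (p + t))"
    by (intro ev_conj) auto
  from evE[OF this] ex show False by (metis (no_types, lifting) empty_iff insert_iff)
qed

lemma strictly_monotone_subinterval:
  assumes f: "dff1 f" and "p < q"
  obtains p' q' where "p' < q'" "{p'<..<q'} \<subseteq> {p<..<q}" "strictly_monotone_on {p'<..<q'} f"
proof -
  define P where "P R x \<longleftrightarrow> ev (\<lambda>t. R (f x) (f (x + t)))" for R x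
  have Pd: "dfn1 (P R)" if "R \<in> {(<), (=), (>)}" for R
    unfolding P_def ev_def by (intro dfn_intros dfn_relations[OF that] dff_comp1[OF f])
  have "\<exists>R\<in>{(<), (=), (>)}. P R x" for x
    unfolding P_def by (rule relation_at[OF f])
  then have "\<exists>t. 0 < t \<and> t < \<epsilon> \<and> (\<exists>R\<in>{(<), (=), (>)}. P R (p + t))" if "0 < \<epsilon>" for \<epsilon>
    using dense[OF that] by blast
  from relation_ev[of P p, OF Pd this]
  obtain R where R: "R \<in> {(<), (=), (>)}" and evR: "ev (\<lambda>t. P R (p + t))" by blast
  from evE[OF evR] obtain \<eta> where "0 < \<eta>" and \<eta>: "\<And>t. 0 < t \<Longrightarrow> t < \<eta> \<Longrightarrow> P R (p + t)" by blast
  define q1 where "q1 = min q (p + \<eta>)"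
  have q1: "p < q1" "q1 \<le> q" using \<open>0 < \<eta>\<close> \<open>p < q\<close> by (auto simp: q1_def)
  have PR: "P R x" if "p < x" "x < q1" for x
    using \<eta>[of "x - p"] that by (auto simp: q1_def algebra_simps)
  have "dfn (\<lambda>v. \<forall>t. 0 < t \<longrightarrow> t < v (Suc 0) \<longrightarrow> R (f (v 0)) (f (v 0 + t)))"
    by (intro dfn_intros dfn_relations[OF R] dff_comp1[OF f])
  then obtain \<delta> where \<delta>: "dff1 \<delta>" "\<And>x. 0 < \<delta> x"
    and R\<delta>: "\<And>x r. \<forall>t. 0 < t \<longrightarrow> t < r \<longrightarrow> R (f x) (f (x + t)) \<Longrightarrow> 0 < r \<Longrightarrow>
        \<forall>t. 0 < t \<longrightarrow> t < \<delta> x \<longrightarrow> R (f x) (f (x + t))"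
    by (rule dff1_selection[where P = "\<lambda>x r. \<forall>t. 0 < t \<longrightarrow> t < r \<longrightarrow> R (f x) (f (x + t))"]) auto
  obtain p2 q2 e where 2: "p2 < q2" "{p2<..<q2} \<subseteq> {p<..<q1}" "0 < e"
    "\<And>x. p2 < x \<Longrightarrow> x < q2 \<Longrightarrow> e \<le> \<delta> x"
    using positive_bounded_below[OF \<delta>(1) q1(1) \<delta>(2)] by blast
  \<comment> \<open>On an interval of length at most \<open>e\<close>, the relation holding to the
    right of the smaller of two points reaches the larger one.\<close>
  define q3 where "q3 = min q2 (p2 + e)"
  show thesis
  proof
    show "p2 < q3" "{p2<..<q3} \<subseteq> {p<..<q}" using 2 q1 by (auto simp: q3_def subset_iff)
    have "R (f x) (f y)" if "x \<in> {p2<..<q3}" "y \<in> {p2<..<q3}" "x < y" for x y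
    proof -
      have "x \<in> {p<..<q1}" using subsetD[OF 2(2), of x] that by (auto simp: q3_def)
      then have "P R x" using PR by simp
      then have "\<forall>t. 0 < t \<longrightarrow> t < \<delta> x \<longrightarrow> R (f x) (f (x + t))"
        unfolding P_def ev_def using R\<delta> by blast
      moreover have "y - x < \<delta> x" using 2(4)[of x] that by (auto simp: q3_def)
      ultimately show ?thesis using that by (auto dest: spec[of _ "y - x"])
    qed
    then show "strictly_monotone_on {p2<..<q3} f" by (rule strictly_monotone_onI[OF R])
  qed
qed

section \<open>Continuity on a subinterval and near zero\<close>

definition continuous_at :: "('m \<Rightarrow> 'm) \<Rightarrow> 'm \<Rightarrow> bool" where
  "continuous_at f x \<longleftrightarrow> (\<forall>e>0. \<exists>d>0. \<forall>y. \<bar>y - x\<bar> < d \<longrightarrow> \<bar>f y - f x\<bar> < e)"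

lemma dfn_continuous_at:
  assumes "dff1 f"
  shows "dfn1 (continuous_at f)"
  unfolding continuous_at_def by (intro dfn_intros dff_comp1[OF assms])

text \<open>An injective function on an interval has infinite image, so the image contains an
  interval. An increasing function cannot jump over values that it attains, which gives continuity
  at the points mapped inside that interval.\<close>

lemma increasing_continuous_subinterval:
  assumes f: "dff1 f" and "p < q" and mono: "\<And>x y. x \<in> {p<..<q} \<Longrightarrow> y \<in> {p<..<q} \<Longrightarrow> x < y \<Longrightarrow> f x < f y"
  obtains p' q' where "p' < q'" "{p'<..<q'} \<subseteq> {p<..<q}" "\<And>x. x \<in> {p'<..<q'} \<Longrightarrow> continuous_at f x"
proof -
  have mono_iff: "f x < f y \<longleftrightarrow> x < y" if "x \<in> {p<..<q}" "y \<in> {p<..<q}" for x y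
    using mono[of x y] mono[of y x] that by (metis less_asym linorder_neqE)
  have "dfn1 (\<lambda>y. \<exists>x. p < x \<and> x < q \<and> y = f x)"
    by (intro dfn_intros dff_comp1[OF f])
  from dfn1_finite_or_interval[OF this]
  have "finite (f ` {p<..<q}) \<or> (\<exists>r s. r < s \<and> {r<..<s} \<subseteq> f ` {p<..<q})"
    by (simp add: image_def Bex_def conj_assoc)
  moreover have "inj_on f {p<..<q}"
    by (rule linorder_inj_onI) (use mono in \<open>auto dest: less_imp_neq\<close>)
  then have "infinite (f ` {p<..<q})"
    using \<open>p < q\<close> by (simp add: finite_image_iff)
  ultimately obtain r s where "r < s" and rs: "{r<..<s} \<subseteq> f ` {p<..<q}" by blast
  obtain r1 where r1: "r < r1" "r1 < s" using dense \<open>r < s\<close> by blast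
  obtain s1 where s1: "r1 < s1" "s1 < s" using dense r1 by blast
  obtain p1 where p1: "p1 \<in> {p<..<q}" "f p1 = r1" using subsetD[OF rs, of r1] r1 by auto
  obtain q1 where q1: "q1 \<in> {p<..<q}" "f q1 = s1" using subsetD[OF rs, of s1] r1 s1 by auto
  show thesis
  proof
    show "p1 < q1" using mono_iff[OF p1(1) q1(1)] p1 q1 s1 by simp
    show sub: "{p1<..<q1} \<subseteq> {p<..<q}" using p1 q1 by auto
    fix x assume x: "x \<in> {p1<..<q1}"
    then have x': "x \<in> {p<..<q}" using sub by blast
    have fx: "r1 < f x" "f x < s1"
      using x mono_iff[OF p1(1) x'] mono_iff[OF x' q1(1)] p1 q1 by auto
    show "continuous_at f x" unfolding continuous_at_def
    proof (intro allI impI)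
      fix e :: 'm assume "0 < e"
      obtain y1 where y1: "max r1 (f x - e) < y1" "y1 < f x" using dense[of "max r1 (f x - e)" "f x"] fx \<open>0 < e\<close> by auto
      obtain y2 where y2: "f x < y2" "y2 < min s1 (f x + e)" using dense[of "f x" "min s1 (f x + e)"] fx \<open>0 < e\<close> by auto
      obtain z1 where z1: "z1 \<in> {p<..<q}" "f z1 = y1" using subsetD[OF rs, of y1] r1 s1 y1 fx by auto
      obtain z2 where z2: "z2 \<in> {p<..<q}" "f z2 = y2" using subsetD[OF rs, of y2] r1 s1 y2 fx by auto
      have z: "z1 < x" "x < z2"
        using mono_iff[OF z1(1) x'] mono_iff[OF x' z2(1)] y1 y2 z1 z2 by auto
      show "\<exists>d>0. \<forall>y. \<bar>y - x\<bar> < d \<longrightarrow> \<bar>f y - f x\<bar> < e"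
      proof (intro exI[of _ "min (x - z1) (z2 - x)"] conjI allI impI)
        fix y assume "\<bar>y - x\<bar> < min (x - z1) (z2 - x)"
        then have "z1 < y" "y < z2" by auto
        moreover from this have "y \<in> {p<..<q}" using z1 z2 by auto
        ultimately have "y1 < f y" "f y < y2" using mono z1 z2 by auto
        then show "\<bar>f y - f x\<bar> < e" using y1 y2 by auto
      qed (use z in auto)
    qed
  qed
qed

lemma continuous_subinterval:
  assumes f: "dff1 f" and "p < q"
  obtains p' q' where "p' < q'" "{p'<..<q'} \<subseteq> {p<..<q}" "\<And>x. x \<in> {p'<..<q'} \<Longrightarrow> continuous_at f x"
proof -
  obtain p1 q1 where 1: "p1 < q1" "{p1<..<q1} \<subseteq> {p<..<q}" "strictly_monotone_on {p1<..<q1} f"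
    using strictly_monotone_subinterval assms by blast
  then consider (inc) "\<forall>x\<in>{p1<..<q1}. \<forall>y\<in>{p1<..<q1}. x < y \<longrightarrow> f x < f y"
    | (const) "\<forall>x\<in>{p1<..<q1}. \<forall>y\<in>{p1<..<q1}. x < y \<longrightarrow> f x = f y"
    | (dec) "\<forall>x\<in>{p1<..<q1}. \<forall>y\<in>{p1<..<q1}. x < y \<longrightarrow> f y < f x"
    unfolding strictly_monotone_on_def by blast
  then show thesis
  proof cases
    case inc
    with increasing_continuous_subinterval[OF f 1(1)] 1(2) that show ?thesis by (metis order_trans)
  next
    case dec
    have "dff1 (\<lambda>x. - f x)" by (intro dfn_intros f)
    from increasing_continuous_subinterval[OF this 1(1)] dec
    obtain p' q' where "p' < q'" "{p'<..<q'} \<subseteq> {p1<..<q1}" "\<And>x. x \<in> {p'<..<q'} \<Longrightarrow> continuous_at (\<lambda>x. - f x) x"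
      by (metis neg_less_iff_less)
    moreover have "continuous_at f x" if "continuous_at (\<lambda>x. - f x) x" for x
      using that unfolding continuous_at_def by (simp add: abs_minus_commute)
    ultimately show ?thesis using 1(2) that by (metis order_trans)
  next
    case const
    have "continuous_at f x" if "x \<in> {p1<..<q1}" for x
      unfolding continuous_at_def
    proof (intro allI impI exI[of _ "min (x - p1) (q1 - x)"] conjI)
      fix e y :: 'm assume "0 < e" "\<bar>y - x\<bar> < min (x - p1) (q1 - x)"
      moreover from this have "y \<in> {p1<..<q1}" by auto
      then have "f y = f x" using const that by (metis linorder_neqE)
      ultimately show "\<bar>f y - f x\<bar> < e" by simp
    qed (use that in auto)
    with 1 that show ?thesis by blast
  qed
qed

text \<open>By the zero-one law, failure would mean discontinuity throughout some
  \<open>(0, \<epsilon>)\<close>, but every interval contains a subinterval of continuity.\<close>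

lemma ev_continuous:
  assumes f: "dff1 f"
  shows "ev (continuous_at f)"
proof (rule ccontr)
  assume "\<not> ev (continuous_at f)"
  with dfn1_ev[OF dfn_continuous_at[OF f]] obtain \<epsilon> where \<epsilon>: "0 < \<epsilon>" "\<And>t. 0 < t \<Longrightarrow> t < \<epsilon> \<Longrightarrow> \<not> continuous_at f t"
    by (auto elim: evE)
  obtain p q where "p < q" "{p<..<q} \<subseteq> {0<..<\<epsilon>}" "\<And>x. x \<in> {p<..<q} \<Longrightarrow> continuous_at f x"
    using continuous_subinterval[OF f \<epsilon>(1)] by blast
  moreover obtain x where "x \<in> {p<..<q}" using \<open>p < q\<close> dense by (meson greaterThanLessThan_iff)
  ultimately show False using \<epsilon>(2) by (auto simp: subset_iff)
qed

text \<open>A connectedness argument: the points up to which the relation with \<open>f x\<close>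
  holds form a definable set, and the local hypothesis at its supremum pushes it further unless
  \<open>y\<close> is reached. The local hypothesis compares points on both sides of
  \<open>z\<close>, so the relation passes through \<open>z\<close>.\<close>

lemma local_to_global:
  assumes f: "dff1 f" and R: "R \<in> {(<), (=), (>)}" and xy: "x < y"
    and loc: "\<And>z. x \<le> z \<Longrightarrow> z \<le> y \<Longrightarrow> \<exists>d>0. \<forall>u w. z - d < u \<longrightarrow> u < w \<longrightarrow> w < z + d \<longrightarrow> R (f u) (f w)"
  shows "R (f x) (f y)"
proof -
  have trans: "R a c" if "R a b" "R b c" for a b c using R that by auto
  define S where "S z \<longleftrightarrow> x < z \<and> z \<le> y \<and> (\<forall>w. x < w \<longrightarrow> w \<le> z \<longrightarrow> R (f x) (f w))" for z
  have "dfn1 S" unfolding S_def by (intro dfn_intros dfn_relations[OF R] dff_comp1[OF f])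
  obtain d where d: "0 < d" "\<forall>u w. x - d < u \<longrightarrow> u < w \<longrightarrow> w < x + d \<longrightarrow> R (f u) (f w)"
    using loc[of x] xy by auto
  obtain z0 where z0: "x < z0" "z0 < min y (x + d)" using dense[of x "min y (x + d)"] xy d by auto
  have "S z0" using d z0 unfolding S_def by auto
  moreover have "z \<le> y" if "S z" for z using that by (simp add: S_def)
  ultimately obtain c where c: "\<And>z. S z \<Longrightarrow> z \<le> c" "\<And>u. (\<And>z. S z \<Longrightarrow> z \<le> u) \<Longrightarrow> c \<le> u"
    using dfn1_lub[OF \<open>dfn1 S\<close>] by metis
  have "c \<le> y" using c(2) \<open>\<And>z. S z \<Longrightarrow> z \<le> y\<close> by blast
  have "x < c" using c(1)[OF \<open>S z0\<close>] z0 by simp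
  obtain d where d: "0 < d" "\<forall>u w. c - d < u \<longrightarrow> u < w \<longrightarrow> w < c + d \<longrightarrow> R (f u) (f w)"
    using loc[of c] \<open>x < c\<close> \<open>c \<le> y\<close> by auto
  have below: "\<exists>z. S z \<and> b < z" if "b < c" for b using c(2) that by (meson not_le)
  \<comment> \<open>The supremum is not known to be attained, so the relation with
    \<open>f c\<close> goes through a point of \<open>S\<close> just below \<open>c\<close>.\<close>
  have Rc: "R (f x) (f c)"
  proof -
    obtain z where z: "S z" "c - d < z" using below[of "c - d"] d by auto
    then have "R (f x) (f z)" by (auto simp: S_def)
    moreover have "z = c \<or> R (f z) (f c)" using d z c(1)[OF z(1)] by force
    ultimately show ?thesis using trans by auto
  qed
  have "R (f x) (f w)" if "x < w" "w \<le> c" for w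
  proof (cases "w = c")
    case False
    then have "w < c" using that by simp
    then obtain z where "S z" "w < z" using below by blast
    with that show ?thesis by (auto simp: S_def)
  qed (use Rc in simp)
  moreover have "c = y"
  proof (rule ccontr)
    assume "c \<noteq> y"
    then have "c < min y (c + d)" using \<open>c \<le> y\<close> d by auto
    then obtain z where z: "c < z" "z < min y (c + d)" using dense by blast
    have "R (f x) (f w)" if "x < w" "w \<le> z" for w
    proof (cases "w \<le> c")
      case False
      have "c - d < c" "c < w" "w < c + d" using d False that z by auto
      then have "R (f c) (f w)" using d(2) by blast
      then show ?thesis using trans Rc by blast
    qed (use calculation that in blast)
    then have "S z" using z \<open>x < c\<close> by (auto simp: S_def)
    with c(1) z show False by (meson not_le)
  qed
  ultimately show ?thesis using xy by blast
qed

text \<open>A subinterval of monotonicity need not end at zero. But such subintervals provide points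
  of local monotonicity arbitrarily close to zero; by \<open>relation_ev\<close> these fill an
  interval with one fixed relation, and \<open>local_to_global\<close> glues.\<close>

lemma ev_strictly_monotone:
  assumes f: "dff1 f"
  shows "\<exists>\<epsilon>>0. strictly_monotone_on {0<..<\<epsilon>} f"
proof -
  define P where "P R x \<longleftrightarrow> (\<exists>d>0. \<forall>u w. x - d < u \<longrightarrow> u < w \<longrightarrow> w < x + d \<longrightarrow> R (f u) (f w))" for R x
  have Pd: "dfn1 (P R)" if "R \<in> {(<), (=), (>)}" for R
    unfolding P_def by (intro dfn_intros dfn_relations[OF that] dff_comp1[OF f])
  have "\<exists>t. 0 < t \<and> t < \<epsilon> \<and> (\<exists>R\<in>{(<), (=), (>)}. P R (0 + t))" if e: "0 < \<epsilon>" for \<epsilon>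
  proof -
    obtain p q where pq: "p < q" "{p<..<q} \<subseteq> {0<..<\<epsilon>}" "strictly_monotone_on {p<..<q} f"
      using strictly_monotone_subinterval[OF f e] by blast
    obtain x where x: "p < x" "x < q" using \<open>p < q\<close> dense by blast
    from strictly_monotone_onE[OF pq(3)]
    obtain R where R: "R \<in> {(<), (=), (>)}" "\<And>x y. x \<in> {p<..<q} \<Longrightarrow> y \<in> {p<..<q} \<Longrightarrow> x < y \<Longrightarrow> R (f x) (f y)"
      by blast
    have "P R x" unfolding P_def
      by (intro exI[of _ "min (x - p) (q - x)"] conjI allI impI R(2)) (use x in auto)
    moreover have "0 < x" "x < \<epsilon>" using x subsetD[OF pq(2), of x] by auto
    ultimately show ?thesis using R(1) unfolding add_0 by blast
  qed
  from relation_ev[of P 0, OF Pd this] have "\<exists>R\<in>{(<), (=), (>)}. ev (P R)" by simp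
  then obtain R where R: "R \<in> {(<), (=), (>)}" and evR: "ev (P R)" by blast
  from evE[OF evR] obtain \<epsilon> where \<epsilon>: "0 < \<epsilon>" "\<And>x. 0 < x \<Longrightarrow> x < \<epsilon> \<Longrightarrow> P R x" by blast
  have "R (f x) (f y)" if "x \<in> {0<..<\<epsilon>}" "y \<in> {0<..<\<epsilon>}" "x < y" for x y
    by (rule local_to_global[OF f R that(3)]) (use that \<epsilon>(2) in \<open>auto simp: P_def\<close>)
  with \<epsilon>(1) show ?thesis using strictly_monotone_onI[OF R] by blast
qed

text \<open>A positive function tending to zero can be neither constant nor decreasing near zero.
  Applied to \<open>rho\<close>, to moduli and to radii, this turns a bound at one parameter into
  bounds at all larger or all smaller ones.\<close>

lemma ev_increasing:
  assumes f: "dff1 f" and pos: "ev (\<lambda>t. 0 < f t)" and lim: "\<And>e. 0 < e \<Longrightarrow> ev (\<lambda>t. f t < e)"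
  obtains \<epsilon> where "0 < \<epsilon>" "\<And>x y. 0 < x \<Longrightarrow> x < y \<Longrightarrow> y < \<epsilon> \<Longrightarrow> f x < f y"
proof -
  obtain \<epsilon> where \<epsilon>: "0 < \<epsilon>" "strictly_monotone_on {0<..<\<epsilon>} f" using ev_strictly_monotone[OF f] by blast
  from strictly_monotone_onE[OF this(2)]
  obtain R where R: "R \<in> {(<), (=), (>)}" "\<And>x y. x \<in> {0<..<\<epsilon>} \<Longrightarrow> y \<in> {0<..<\<epsilon>} \<Longrightarrow> x < y \<Longrightarrow> R (f x) (f y)"
    by blast
  obtain y where y: "0 < y" "y < \<epsilon>" "0 < f y"
  proof -
    have "ev (\<lambda>t. 0 < t \<and> t < \<epsilon> \<and> 0 < f t)" using pos \<epsilon>(1) ev_pos ev_less[of \<epsilon>] by (intro ev_conj)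
    then have "ev (\<lambda>t::'m. \<exists>y. 0 < y \<and> y < \<epsilon> \<and> 0 < f y)" by (rule ev_mono) blast
    with that show thesis by auto
  qed
  have "ev (\<lambda>t. 0 < t \<and> t < y \<and> f t < f y)" using lim[of "f y"] y ev_pos ev_less[of y] by (intro ev_conj)
  then have "ev (\<lambda>t::'m. \<exists>x. 0 < x \<and> x < y \<and> f x < f y)" by (rule ev_mono) blast
  then obtain x where x: "0 < x" "x < y" "f x < f y" by auto
  with R(2)[of x y] y have "R (f x) (f y)" by auto
  with R(1) x(3) have "R = (<)" by auto
  with R(2) \<epsilon>(1) that show ?thesis by auto
qed

end

section \<open>The Hardy field and its metrics\<close>

context ominimal_field
begin

lemma definable_map_germ [simp]: "definable_map L M UNIV (Suc 0) (\<lambda>t. [f t]) \<longleftrightarrow> dff1 f"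
proof
  assume "definable_map L M UNIV (Suc 0) (\<lambda>t. [f t])"
  from definable_map_component[OF this, of 0] show "dff1 f" by simp
next
  assume "dff1 f"
  then show "definable_map L M UNIV (Suc 0) (\<lambda>t. [f t])"
    by (intro definable_mapI[where F = "\<lambda>_. f"]) (auto intro: dfn_const)
qed

section \<open>Germs, their order and their arithmetic through representatives\<close>

definition pos_germ :: "('m \<Rightarrow> 'm) \<Rightarrow> bool" where
  "pos_germ r \<longleftrightarrow> dff1 r \<and> ev (\<lambda>t. 0 < r t)"

abbreviation gm :: "('m \<Rightarrow> 'm) \<Rightarrow> ('m \<Rightarrow> 'm) set" where
  "gm \<equiv> germ L M"

lemma gm_eq: "gm f = {g. dff1 g \<and> ev (\<lambda>t. g t = f t)}"
  unfolding germ_def by simp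

lemma gm_self: "dff1 f \<Longrightarrow> f \<in> gm f"
  by (simp add: gm_eq)

lemma gm_cong: "ev (\<lambda>t. f t = g t) \<Longrightarrow> gm f = gm g"
proof -
  assume *: "ev (\<lambda>t. f t = g t)"
  have "ev (\<lambda>t. h t = f t) \<longleftrightarrow> ev (\<lambda>t. h t = g t)" for h
  proof
    show "ev (\<lambda>t. h t = g t)" if "ev (\<lambda>t. h t = f t)" using that * by (rule ev_mono2) simp
    show "ev (\<lambda>t. h t = f t)" if "ev (\<lambda>t. h t = g t)" using that * by (rule ev_mono2) simp
  qed
  then show ?thesis unfolding gm_eq by simp
qed

lemma gm_inject:
  assumes "dff1 f"
  shows "gm f = gm g \<longleftrightarrow> ev (\<lambda>t. f t = g t)"
proof
  assume "gm f = gm g"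
  with gm_self[OF assms] have "f \<in> gm g" by simp
  then show "ev (\<lambda>t. f t = g t)" by (simp add: gm_eq)
qed (rule gm_cong)

lemma Kset_eq: "Kset L M = gm ` {f. dff1 f}"
  unfolding Kset_def by simp

lemma Kless_gm_right: "Kless x (gm g) \<Longrightarrow> \<exists>f\<in>x. ev (\<lambda>t. f t < g t)"
proof -
  assume "Kless x (gm g)"
  then obtain f g' where "f \<in> x" "ev (\<lambda>t. g' t = g t)" "ev (\<lambda>t. f t < g' t)"
    unfolding Kless_def gm_eq by blast
  moreover from this(2,3) have "ev (\<lambda>t. f t < g t)" by (rule ev_mono2) simp
  ultimately show ?thesis by blast
qed

lemma Kless_gm:
  assumes "dff1 f" "dff1 g"
  shows "Kless (gm f) (gm g) \<longleftrightarrow> ev (\<lambda>t. f t < g t)"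
proof
  assume "Kless (gm f) (gm g)"
  then obtain f' where "ev (\<lambda>t. f' t = f t)" "ev (\<lambda>t. f' t < g t)"
    using Kless_gm_right by (auto simp: gm_eq)
  then show "ev (\<lambda>t. f t < g t)" by (rule ev_mono2) auto
qed (auto simp: Kless_def intro: gm_self assms)

lemma Kless_mono:
  assumes "Kless x (gm g)" "dff1 h" "ev (\<lambda>t. g t \<le> h t)"
  shows "Kless x (gm h)"
proof -
  obtain f where "f \<in> x" and f: "ev (\<lambda>t. f t < g t)" using Kless_gm_right[OF assms(1)] by blast
  from f assms(3) have "ev (\<lambda>t. f t < h t)" by (rule ev_mono2) simp
  then show ?thesis unfolding Kless_def using \<open>f \<in> x\<close> gm_self[OF assms(2)] by blast
qed

lemma Kminus_gm:
  assumes "dff1 f" "dff1 g"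
  shows "Kminus L M (gm f) (gm g) = gm (\<lambda>t. f t - g t)"
proof -
  have "gm (\<lambda>t. f' t - g' t) = gm (\<lambda>t. f t - g t)" if "f' \<in> gm f" "g' \<in> gm g" for f' g'
  proof (rule gm_cong)
    have "ev (\<lambda>t. f' t = f t)" "ev (\<lambda>t. g' t = g t)" using that by (auto simp: gm_eq)
    then show "ev (\<lambda>t. f' t - g' t = f t - g t)" by (rule ev_mono2) auto
  qed
  then show ?thesis unfolding Kminus_def using gm_self assms by blast
qed

text \<open>\<open>Kabs\<close> decides the sign once for the whole germ; by the zero-one law this
  agrees with the pointwise absolute value. \<open>Kmax\<close> is treated in the same way.\<close>

lemma Kabs_gm:
  assumes "dff1 f"
  shows "Kabs L M (gm f) = gm (\<lambda>t. \<bar>f t\<bar>)"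
proof (cases "ev (\<lambda>t. f t < 0)")
  case True
  have "ev (\<lambda>t. 0 - f t = \<bar>f t\<bar>)" using True by (rule ev_mono) auto
  then show ?thesis
    using True by (simp add: Kabs_def Kconst_def Kless_gm Kminus_gm assms dff_const gm_cong)
next
  case False
  have "dfn1 (\<lambda>t. f t < 0)" by (intro dfn_intros assms)
  from dfn1_ev[OF this] False have "ev (\<lambda>t. f t = \<bar>f t\<bar>)" by (auto elim: ev_mono)
  then have "gm f = gm (\<lambda>t. \<bar>f t\<bar>)" by (rule gm_cong)
  moreover have "Kabs L M (gm f) = gm f"
    using False by (simp add: Kabs_def Kconst_def Kless_gm assms dff_const)
  ultimately show ?thesis by simp
qed

lemma Kmax_gm:
  assumes "dff1 f" "dff1 g"
  shows "Kmax (gm f) (gm g) = gm (\<lambda>t. max (f t) (g t))"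
proof (cases "ev (\<lambda>t. f t < g t)")
  case True
  have "ev (\<lambda>t. g t = max (f t) (g t))" using True by (rule ev_mono) auto
  from gm_cong[OF this] have "gm g = gm (\<lambda>t. max (f t) (g t))" .
  moreover have "Kmax (gm f) (gm g) = gm g" using True by (simp add: Kmax_def Kless_gm assms)
  ultimately show ?thesis by simp
next
  case False
  have "dfn1 (\<lambda>t. f t < g t)" by (intro dfn_intros assms)
  from dfn1_ev[OF this] False have "ev (\<lambda>t. f t = max (f t) (g t))" by (auto elim: ev_mono)
  from gm_cong[OF this] have "gm f = gm (\<lambda>t. max (f t) (g t))" .
  moreover have "Kmax (gm f) (gm g) = gm f" using False by (simp add: Kmax_def Kless_gm assms)
  ultimately show ?thesis by simp
qed

lemma infinitesimals_gm:
  "x \<in> infinitesimals L M \<longleftrightarrow> (\<exists>f. dff1 f \<and> (\<forall>c>0. ev (\<lambda>t. \<bar>f t\<bar> < c)) \<and> x = gm f)"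
proof -
  have "Kless (Kabs L M (gm f)) (Kconst L M c) \<longleftrightarrow> ev (\<lambda>t. \<bar>f t\<bar> < c)" if "dff1 f" for f c
    using that by (simp add: Kabs_gm Kconst_def Kless_gm dff_const dff_abs)
  then show ?thesis unfolding infinitesimals_def Kset_eq by auto
qed

subsection \<open>Topologies given by metrics with values in the Hardy field\<close>

text \<open>The axioms are stated for representatives \<open>d x y\<close>, which avoids addition of
  germs. Distance zero to itself puts the centre into each ball, and the triangle inequality makes
  balls open.\<close>

definition K_metric :: "'x set \<Rightarrow> ('x \<Rightarrow> 'x \<Rightarrow> ('m \<Rightarrow> 'm) set) \<Rightarrow> bool" where
  "K_metric S D \<longleftrightarrow> (\<exists>d. \<forall>x\<in>S. \<forall>y\<in>S. D x y = gm (d x y) \<and> dff1 (d x y) \<and> ev (\<lambda>t. d x x t = 0) \<and>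
     (\<forall>z\<in>S. ev (\<lambda>t. d x z t \<le> d x y t + d y z t)))"

definition K_ball :: "'x set \<Rightarrow> ('x \<Rightarrow> 'x \<Rightarrow> ('m \<Rightarrow> 'm) set) \<Rightarrow> 'x \<Rightarrow> ('m \<Rightarrow> 'm) \<Rightarrow> 'x set" where
  "K_ball S D x r = {y \<in> S. Kless (D x y) (gm r)}"

lemma K_metric_topology_balls:
  "K_metric_topology L M S D = topology_generated_by {K_ball S D x r |x r. x \<in> S \<and> pos_germ r}"
proof -
  have *: "(\<exists>\<rho>. B = {y \<in> S. Kless (D x y) \<rho>} \<and> \<rho> \<in> Kset L M \<and> Kless (Kconst L M 0) \<rho>)
     \<longleftrightarrow> (\<exists>r. B = K_ball S D x r \<and> pos_germ r)" for B x
    unfolding Kset_eq K_ball_def pos_germ_def Kconst_def using Kless_gm[OF dff_const] by auto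
  have "{{y \<in> S. Kless (D x y) r} |x r. x \<in> S \<and> r \<in> Kset L M \<and> Kless (Kconst L M 0) r}
      = {K_ball S D x r |x r. x \<in> S \<and> pos_germ r}" (is "?A = ?B")
  proof (rule set_eqI)
    fix B
    have "B \<in> ?A \<longleftrightarrow> (\<exists>x. x \<in> S \<and> (\<exists>\<rho>. B = {y \<in> S. Kless (D x y) \<rho>} \<and> \<rho> \<in> Kset L M \<and> Kless (Kconst L M 0) \<rho>))"
      by blast
    also have "\<dots> \<longleftrightarrow> B \<in> ?B" unfolding * by blast
    finally show "B \<in> ?A \<longleftrightarrow> B \<in> ?B" .
  qed
  then show ?thesis unfolding K_metric_topology_def by simp
qed

lemma K_ball_center:
  assumes "K_metric S D" "x \<in> S" "pos_germ r"
  shows "x \<in> K_ball S D x r"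
proof -
  from assms(1) obtain d where d: "\<forall>x\<in>S. \<forall>y\<in>S. D x y = gm (d x y) \<and> dff1 (d x y) \<and> ev (\<lambda>t. d x x t = 0)"
    unfolding K_metric_def by blast
  have "ev (\<lambda>t. d x x t = 0)" "ev (\<lambda>t. 0 < r t)" using d assms by (auto simp: pos_germ_def)
  then have "ev (\<lambda>t. d x x t < r t)" by (rule ev_mono2) simp
  then show ?thesis using d assms unfolding K_ball_def pos_germ_def by (simp add: Kless_gm)
qed

lemma K_ball_refine:
  assumes "K_metric S D" "x \<in> S" "pos_germ r" "y \<in> K_ball S D x r"
  shows "\<exists>r'. pos_germ r' \<and> K_ball S D y r' \<subseteq> K_ball S D x r"
proof -
  from assms(1) obtain d where D: "\<And>x y. x \<in> S \<Longrightarrow> y \<in> S \<Longrightarrow> D x y = gm (d x y)"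
    and d: "\<And>x y. x \<in> S \<Longrightarrow> y \<in> S \<Longrightarrow> dff1 (d x y)"
    and tri: "\<And>x y z. x \<in> S \<Longrightarrow> y \<in> S \<Longrightarrow> z \<in> S \<Longrightarrow> ev (\<lambda>t. d x z t \<le> d x y t + d y z t)"
    unfolding K_metric_def by blast
  have y: "y \<in> S" "ev (\<lambda>t. d x y t < r t)"
    using assms D d unfolding K_ball_def pos_germ_def by (auto simp: Kless_gm)
  have r: "dff1 r" using assms by (simp add: pos_germ_def)
  define r' where "r' t = r t - d x y t" for t
  have r'd: "dff1 r'" unfolding r'_def by (intro dfn_intros r d y assms)
  moreover have "ev (\<lambda>t. 0 < r' t)" using y(2) by (rule ev_mono) (simp add: r'_def)
  moreover have "K_ball S D y r' \<subseteq> K_ball S D x r"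
  proof
    fix z assume "z \<in> K_ball S D y r'"
    then have z: "z \<in> S" "ev (\<lambda>t. d y z t < r' t)"
      using D d y r'd unfolding K_ball_def by (auto simp: Kless_gm)
    have "ev (\<lambda>t. d x z t < r t)"
      using ev_conj[OF z(2) tri[OF assms(2) y(1) z(1)]] by (rule ev_mono) (auto simp: r'_def)
    then show "z \<in> K_ball S D x r"
      using z D d r assms(2) unfolding K_ball_def by (simp add: Kless_gm)
  qed
  ultimately show ?thesis unfolding pos_germ_def by blast
qed

lemma K_ball_min:
  assumes "pos_germ r" "pos_germ s"
  shows "pos_germ (\<lambda>t. min (r t) (s t))"
    and "K_ball S D x (\<lambda>t. min (r t) (s t)) \<subseteq> K_ball S D x r \<inter> K_ball S D x s"
proof -
  show "pos_germ (\<lambda>t. min (r t) (s t))"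
  proof -
    have "ev (\<lambda>t. 0 < r t)" "ev (\<lambda>t. 0 < s t)" using assms by (auto simp: pos_germ_def)
    then have "ev (\<lambda>t. 0 < min (r t) (s t))" by (rule ev_mono2) simp
    moreover have "dff1 (\<lambda>t. min (r t) (s t))" using assms by (intro dff_min) (auto simp: pos_germ_def)
    ultimately show ?thesis by (simp add: pos_germ_def)
  qed
  show "K_ball S D x (\<lambda>t. min (r t) (s t)) \<subseteq> K_ball S D x r \<inter> K_ball S D x s"
  proof -
    have "ev (\<lambda>t. min (r t) (s t) \<le> r t)" "ev (\<lambda>t. min (r t) (s t) \<le> s t)"
      by (rule ev_mono[OF ev_pos]; simp)+
    then show ?thesis
      using assms Kless_mono[of _ "\<lambda>t. min (r t) (s t)"] unfolding K_ball_def pos_germ_def by blast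
  qed
qed

lemma topspace_K_metric [simp]:
  assumes "K_metric S D"
  shows "topspace (K_metric_topology L M S D) = S"
proof -
  have "pos_germ (\<lambda>_. 1)" by (simp add: pos_germ_def dff_const)
  then have "x \<in> \<Union> {K_ball S D x r |x r. x \<in> S \<and> pos_germ r}" if "x \<in> S" for x
    using K_ball_center[OF assms that] that by blast
  moreover have "K_ball S D x r \<subseteq> S" for x r by (auto simp: K_ball_def)
  ultimately show ?thesis unfolding K_metric_topology_balls topology_generated_by_topspace by blast
qed

text \<open>\<open>K_metric_topology\<close> takes the balls as a subbase. Since balls can be
  refined around their points and radii have minima, they form a base.\<close>

lemma openin_K_metric:
  assumes "K_metric S D"
  shows "openin (K_metric_topology L M S D) U
    \<longleftrightarrow> U \<subseteq> S \<and> (\<forall>x\<in>U. \<exists>r. pos_germ r \<and> K_ball S D x r \<subseteq> U)"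
proof
  assume "openin (K_metric_topology L M S D) U"
  then have "generate_topology_on {K_ball S D x r |x r. x \<in> S \<and> pos_germ r} U"
    unfolding K_metric_topology_balls openin_topology_generated_by_iff .
  then show "U \<subseteq> S \<and> (\<forall>x\<in>U. \<exists>r. pos_germ r \<and> K_ball S D x r \<subseteq> U)"
  proof induction
    case (Int A B)
    have "\<exists>r. pos_germ r \<and> K_ball S D x r \<subseteq> A \<inter> B" if x: "x \<in> A \<inter> B" for x
    proof -
      from Int.IH x obtain r s where "pos_germ r" "K_ball S D x r \<subseteq> A" "pos_germ s" "K_ball S D x s \<subseteq> B"
        by blast
      with K_ball_min(1)[of r s] K_ball_min(2)[of r s S D x] show ?thesis by blast
    qed
    with Int show ?case by blast
  next
    case (UN \<A>)
    have "\<exists>r. pos_germ r \<and> K_ball S D x r \<subseteq> \<Union>\<A>" if "x \<in> B" "B \<in> \<A>" for x B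
      using UN[OF that(2)] that by blast
    with UN show ?case by blast
  next
    case (Basis B)
    then obtain x r where B: "B = K_ball S D x r" "x \<in> S" "pos_germ r" by blast
    with K_ball_refine[OF assms] show ?case by (auto simp: K_ball_def)
  qed simp
next
  assume U: "U \<subseteq> S \<and> (\<forall>x\<in>U. \<exists>r. pos_germ r \<and> K_ball S D x r \<subseteq> U)"
  have "\<exists>B. openin (K_metric_topology L M S D) B \<and> x \<in> B \<and> B \<subseteq> U" if "x \<in> U" for x
  proof -
    from U that obtain r where r: "pos_germ r" "K_ball S D x r \<subseteq> U" by blast
    have "openin (K_metric_topology L M S D) (K_ball S D x r)"
      unfolding K_metric_topology_balls
      by (rule topology_generated_by_Basis) (use r U that in blast)
    moreover have "x \<in> K_ball S D x r" using K_ball_center[OF assms] r U that by blast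
    ultimately show ?thesis using r by blast
  qed
  then show "openin (K_metric_topology L M S D) U"
    by (subst openin_subopen) blast
qed

text \<open>\<open>cont\<close> and \<open>opn\<close> are the epsilon-delta conditions for
  \<open>f\<close> and for its inverse at one point, the form in which
  \<open>hclose_imp_close\<close> and \<open>close_imp_hclose\<close> compare the two
  metrics.\<close>

lemma K_homeomorphic_map:
  assumes K: "K_metric S D" and K': "K_metric S' D'" and "A \<subseteq> S" and bij: "bij_betw f A S'"
    and cont: "\<And>x r. x \<in> A \<Longrightarrow> pos_germ r \<Longrightarrow>
       \<exists>r'. pos_germ r' \<and> (\<forall>y\<in>A. Kless (D x y) (gm r') \<longrightarrow> Kless (D' (f x) (f y)) (gm r))"
    and opn: "\<And>x r. x \<in> A \<Longrightarrow> pos_germ r \<Longrightarrow>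
       \<exists>r'. pos_germ r' \<and> (\<forall>y\<in>A. Kless (D' (f x) (f y)) (gm r') \<longrightarrow> Kless (D x y) (gm r))"
  shows "homeomorphic_map (subtopology (K_metric_topology L M S D) A) (K_metric_topology L M S' D') f"
proof -
  have top: "topspace (subtopology (K_metric_topology L M S D) A) = A"
    using K \<open>A \<subseteq> S\<close> by (simp add: Int_absorb1)
  have fA: "f ` A = S'" and inj: "inj_on f A" using bij by (auto simp: bij_betw_def)
  have "openin (K_metric_topology L M S' D') (f ` (V \<inter> A))" if V: "openin (K_metric_topology L M S D) V" for V
    unfolding openin_K_metric[OF K']
  proof (intro conjI ballI)
    show "f ` (V \<inter> A) \<subseteq> S'" using fA by blast
    fix y assume "y \<in> f ` (V \<inter> A)"
    then obtain x where x: "x \<in> V" "x \<in> A" "y = f x" by blast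
    then obtain r where r: "pos_germ r" "K_ball S D x r \<subseteq> V"
      using V unfolding openin_K_metric[OF K] by blast
    obtain r' where r': "pos_germ r'" "\<forall>y\<in>A. Kless (D' (f x) (f y)) (gm r') \<longrightarrow> Kless (D x y) (gm r)"
      using opn[OF x(2) r(1)] by blast
    have "K_ball S' D' y r' \<subseteq> f ` (V \<inter> A)"
    proof
      fix z assume z: "z \<in> K_ball S' D' y r'"
      then obtain w where w: "w \<in> A" "z = f w" using fA by (auto simp: K_ball_def)
      with r' z x have "w \<in> K_ball S D x r" using \<open>A \<subseteq> S\<close> by (auto simp: K_ball_def)
      with r w show "z \<in> f ` (V \<inter> A)" by blast
    qed
    with r' show "\<exists>r. pos_germ r \<and> K_ball S' D' y r \<subseteq> f ` (V \<inter> A)" by blast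
  qed
  then have "open_map (subtopology (K_metric_topology L M S D) A) (K_metric_topology L M S' D') f"
    unfolding open_map_def openin_subtopology by blast
  moreover have "continuous_map (subtopology (K_metric_topology L M S D) A) (K_metric_topology L M S' D') f"
    unfolding continuous_map
  proof (intro conjI allI impI)
    show "f ` topspace (subtopology (K_metric_topology L M S D) A) \<subseteq> topspace (K_metric_topology L M S' D')"
      unfolding top using K' fA by simp
    fix V assume V: "openin (K_metric_topology L M S' D') V"
    \<comment> \<open>An open set of the subspace must be the trace of an open set of the whole
      space. \<open>W\<close> collects the ambient balls, centred in \<open>A\<close>, whose points
      in \<open>A\<close> are mapped into \<open>V\<close>.\<close>
    define W where "W = {w \<in> S. \<exists>x r. x \<in> A \<and> f x \<in> V \<and> pos_germ r \<and> w \<in> K_ball S D x r \<and> f ` (K_ball S D x r \<inter> A) \<subseteq> V}"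
    have "openin (K_metric_topology L M S D) W"
      unfolding openin_K_metric[OF K]
    proof (intro conjI ballI)
      fix w assume "w \<in> W"
      then obtain x r where xr: "x \<in> A" "f x \<in> V" "pos_germ r" "w \<in> K_ball S D x r" "f ` (K_ball S D x r \<inter> A) \<subseteq> V"
        unfolding W_def by blast
      from K_ball_refine[OF K _ xr(3,4)] xr(1) \<open>A \<subseteq> S\<close>
      obtain r' where "pos_germ r'" "K_ball S D w r' \<subseteq> K_ball S D x r" by blast
      moreover have "K_ball S D x r \<subseteq> W"
      proof
        fix y assume y: "y \<in> K_ball S D x r"
        then have "y \<in> S" by (simp add: K_ball_def)
        with y xr show "y \<in> W" unfolding W_def by blast
      qed
      ultimately show "\<exists>r. pos_germ r \<and> K_ball S D w r \<subseteq> W" by blast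
    qed (auto simp: W_def)
    moreover have "{x \<in> A. f x \<in> V} = W \<inter> A"
    proof
      show "W \<inter> A \<subseteq> {x \<in> A. f x \<in> V}" unfolding W_def by blast
      show "{x \<in> A. f x \<in> V} \<subseteq> W \<inter> A"
      proof
        fix x assume "x \<in> {x \<in> A. f x \<in> V}"
        then have x: "x \<in> A" "f x \<in> V" by auto
        then obtain r where r: "pos_germ r" "K_ball S' D' (f x) r \<subseteq> V"
          using V unfolding openin_K_metric[OF K'] by blast
        from cont[OF x(1) r(1)] obtain r' where r': "pos_germ r'"
          "\<forall>y\<in>A. Kless (D x y) (gm r') \<longrightarrow> Kless (D' (f x) (f y)) (gm r)" by blast
        have "f ` (K_ball S D x r' \<inter> A) \<subseteq> V"
          using r r' fA by (auto simp: K_ball_def)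
        with r' x K_ball_center[OF K _ r'(1)] \<open>A \<subseteq> S\<close> show "x \<in> W \<inter> A" unfolding W_def by blast
      qed
    qed
    ultimately show "openin (subtopology (K_metric_topology L M S D) A)
        {x \<in> topspace (subtopology (K_metric_topology L M S D) A). f x \<in> V}"
      unfolding top openin_subtopology by auto
  qed
  ultimately show ?thesis
    using fA inj K K' \<open>A \<subseteq> S\<close> by (intro bijective_open_imp_homeomorphic_map) (simp_all add: Int_absorb1)
qed

subsection \<open>Infinitesimal tuples\<close>

definition tup :: "nat \<Rightarrow> (nat \<Rightarrow> 'm \<Rightarrow> 'm) \<Rightarrow> ('m \<Rightarrow> 'm) set list" where
  "tup n U = map (\<lambda>j. gm (U j)) [0..<n]"

definition inf_family :: "nat \<Rightarrow> (nat \<Rightarrow> 'm \<Rightarrow> 'm) \<Rightarrow> bool" where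
  "inf_family n U \<longleftrightarrow> (\<forall>j<n. dff1 (U j) \<and> (\<forall>c>0. ev (\<lambda>t. \<bar>U j t\<bar> < c)))"

lemma infinitesimal_tuples_eq:
  "infinitesimal_tuples L M n = tup n ` {U. inf_family n U}"
proof
  show "tup n ` {U. inf_family n U} \<subseteq> infinitesimal_tuples L M n"
    unfolding infinitesimal_tuples_def tup_def inf_family_def
    by (fastforce simp: infinitesimals_gm)
  show "infinitesimal_tuples L M n \<subseteq> tup n ` {U. inf_family n U}"
  proof
    fix xs assume "xs \<in> infinitesimal_tuples L M n"
    then have len: "length xs = n" and "\<forall>j<n. xs ! j \<in> infinitesimals L M"
      unfolding infinitesimal_tuples_def by (auto simp: subset_iff)
    then have "\<forall>j. \<exists>f. j < n \<longrightarrow> dff1 f \<and> (\<forall>c>0. ev (\<lambda>t. \<bar>f t\<bar> < c)) \<and> xs ! j = gm f"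
      unfolding infinitesimals_gm by blast
    then obtain U where U: "\<forall>j. j < n \<longrightarrow> dff1 (U j) \<and> (\<forall>c>0. ev (\<lambda>t. \<bar>U j t\<bar> < c)) \<and> xs ! j = gm (U j)"
      using choice[of "\<lambda>j f. j < n \<longrightarrow> dff1 f \<and> (\<forall>c>0. ev (\<lambda>t. \<bar>f t\<bar> < c)) \<and> xs ! j = gm f"] by blast
    then have "xs = tup n U" using len by (auto simp: tup_def intro: nth_equalityI)
    moreover have "inf_family n U" using U unfolding inf_family_def by blast
    ultimately show "xs \<in> tup n ` {U. inf_family n U}" by blast
  qed
qed

lemma tup_eq_iff:
  "inf_family n U \<Longrightarrow> tup n U = tup n V \<longleftrightarrow> (\<forall>j<n. ev (\<lambda>t. U j t = V j t))"
  by (simp add: tup_def inf_family_def gm_inject Ball_def)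

text \<open>The fold has the shape of \<open>Kdist\<close>, so the two are compared by induction on
  the index list.\<close>

definition fdist :: "nat list \<Rightarrow> (nat \<Rightarrow> 'm \<Rightarrow> 'm) \<Rightarrow> (nat \<Rightarrow> 'm \<Rightarrow> 'm) \<Rightarrow> 'm \<Rightarrow> 'm" where
  "fdist js U V t = foldr (\<lambda>j m. max \<bar>U j t - V j t\<bar> m) js 0"

lemma fdist_less_iff: "fdist js U V t < r \<longleftrightarrow> 0 < r \<and> (\<forall>j\<in>set js. \<bar>U j t - V j t\<bar> < r)"
  unfolding fdist_def by (induction js) auto

lemma fdist_le_iff: "fdist js U V t \<le> r \<longleftrightarrow> 0 \<le> r \<and> (\<forall>j\<in>set js. \<bar>U j t - V j t\<bar> \<le> r)"
  unfolding fdist_def by (induction js) auto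

lemma dff_fdist: "(\<And>j. j \<in> set js \<Longrightarrow> dff1 (U j) \<and> dff1 (V j)) \<Longrightarrow> dff1 (fdist js U V)"
proof (induction js)
  case (Cons j js)
  then show ?case
    unfolding fdist_def foldr.simps o_apply by (intro dff_max dff_abs dff_diff) auto
qed (simp add: fdist_def dff_const)

lemma Kdist_gm:
  assumes "\<And>j. j \<in> set js \<Longrightarrow> dff1 (U j) \<and> dff1 (V j)"
  shows "Kdist L M (map (\<lambda>j. gm (U j)) js) (map (\<lambda>j. gm (V j)) js) = gm (fdist js U V)"
  using assms
proof (induction js)
  case (Cons j js)
  have "dff1 (fdist js U V)" "dff1 (U j)" "dff1 (V j)" using Cons.prems by (auto intro: dff_fdist)
  moreover from this have "dff1 (\<lambda>t. U j t - V j t)" "dff1 (\<lambda>t. \<bar>U j t - V j t\<bar>)"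
    by (auto intro: dfn_intros)
  ultimately show ?case
    using Cons by (simp add: Kdist_def Kminus_gm Kabs_gm Kmax_gm fdist_def)
qed (simp add: Kdist_def Kconst_def fdist_def[abs_def])

lemma Kless_Kdist:
  assumes U: "inf_family n U" and V: "inf_family n V" and r: "pos_germ r"
  shows "Kless (Kdist L M (tup n U) (tup n V)) (gm r) \<longleftrightarrow> ev (\<lambda>t. \<forall>j<n. \<bar>U j t - V j t\<bar> < r t)"
proof -
  have "Kless (Kdist L M (tup n U) (tup n V)) (gm r) \<longleftrightarrow> ev (\<lambda>t. fdist [0..<n] U V t < r t)"
  proof -
    have d: "dff1 (U j) \<and> dff1 (V j)" if "j \<in> set [0..<n]" for j
      using that U V by (simp add: inf_family_def)
    have "Kdist L M (tup n U) (tup n V) = gm (fdist [0..<n] U V)"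
      unfolding tup_def by (rule Kdist_gm[OF d])
    moreover have "dff1 r" using r by (simp add: pos_germ_def)
    moreover have "dff1 (fdist [0..<n] U V)" by (rule dff_fdist[OF d])
    ultimately show ?thesis by (simp add: Kless_gm)
  qed
  also have "\<dots> \<longleftrightarrow> ev (\<lambda>t. \<forall>j<n. \<bar>U j t - V j t\<bar> < r t)"
  proof
    show "ev (\<lambda>t. \<forall>j<n. \<bar>U j t - V j t\<bar> < r t)" if "ev (\<lambda>t. fdist [0..<n] U V t < r t)"
      using that by (rule ev_mono) (simp add: fdist_less_iff)
    show "ev (\<lambda>t. fdist [0..<n] U V t < r t)" if "ev (\<lambda>t. \<forall>j<n. \<bar>U j t - V j t\<bar> < r t)"
    proof -
      have "ev (\<lambda>t. 0 < r t)" using r by (simp add: pos_germ_def)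
      from this that show ?thesis by (rule ev_mono2) (simp add: fdist_less_iff)
    qed
  qed
  finally show ?thesis .
qed

lemma K_metric_infinitesimal_tuples: "K_metric (infinitesimal_tuples L M n) (Kdist L M)"
proof -
  have "\<forall>x\<in>infinitesimal_tuples L M n. \<exists>U. inf_family n U \<and> x = tup n U"
    unfolding infinitesimal_tuples_eq by blast
  then obtain R where R: "\<And>x. x \<in> infinitesimal_tuples L M n \<Longrightarrow> inf_family n (R x) \<and> x = tup n (R x)"
    by metis
  have fd: "dff1 (R x j)" if "x \<in> infinitesimal_tuples L M n" "j < n" for x j
    using R that unfolding inf_family_def by blast
  have D: "Kdist L M x y = gm (fdist [0..<n] (R x) (R y))"
    if x: "x \<in> infinitesimal_tuples L M n" and y: "y \<in> infinitesimal_tuples L M n" for x y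
  proof -
    have "Kdist L M (tup n (R x)) (tup n (R y)) = gm (fdist [0..<n] (R x) (R y))"
      unfolding tup_def using fd x y by (intro Kdist_gm) auto
    then show ?thesis using R x y by metis
  qed
  have zero: "fdist [0..<n] U U t = 0" for U t
    using fdist_le_iff[of "[0..<n]" U U t 0] fdist_less_iff[of "[0..<n]" U U t 0] by auto
  have tri: "fdist js U W t \<le> fdist js U V t + fdist js V W t" for js U V W t
  proof -
    have "0 \<le> fdist js U V t \<and> (\<forall>j\<in>set js. \<bar>U j t - V j t\<bar> \<le> fdist js U V t)"
      "0 \<le> fdist js V W t \<and> (\<forall>j\<in>set js. \<bar>V j t - W j t\<bar> \<le> fdist js V W t)"
      unfolding fdist_le_iff[symmetric] by auto
    moreover have "\<bar>U j t - W j t\<bar> \<le> \<bar>U j t - V j t\<bar> + \<bar>V j t - W j t\<bar>" for j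
      using abs_triangle_ineq[of "U j t - V j t" "V j t - W j t"] by simp
    ultimately show ?thesis unfolding fdist_le_iff by (meson add_mono add_nonneg_nonneg order_trans)
  qed
  show ?thesis
    unfolding K_metric_def
    by (rule exI[of _ "\<lambda>x y. fdist [0..<n] (R x) (R y)"])
       (use D fd zero tri in \<open>auto intro!: dff_fdist\<close>)
qed

end

section \<open>Comparison of the two metrics\<close>

context ominimal_field
begin

definition rho :: "nat \<Rightarrow> (nat \<Rightarrow> 'm \<Rightarrow> 'm) \<Rightarrow> 'm \<Rightarrow> 'm" where
  "rho n U s = max \<bar>s\<bar> (fdist [0..<n] U (\<lambda>_ _. 0) s)"

lemma rho_less_iff: "rho n U s < e \<longleftrightarrow> \<bar>s\<bar> < e \<and> (\<forall>j<n. \<bar>U j s\<bar> < e)"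
  by (auto simp: rho_def fdist_less_iff)

lemma rho_le_iff: "rho n U s \<le> e \<longleftrightarrow> \<bar>s\<bar> \<le> e \<and> (\<forall>j<n. \<bar>U j s\<bar> \<le> e)"
  by (auto simp: rho_def fdist_le_iff)

lemma le_rho: "s \<le> rho n U s"
  unfolding rho_def by (auto simp: le_max_iff_disj)

lemma rho_pos: "0 < s \<Longrightarrow> 0 < rho n U s"
  using le_rho less_le_trans by blast

text \<open>The triangle inequality of the sup metric, in coordinates centred at
  \<open>a\<close>.\<close>

lemma rho_le_add:
  assumes "\<bar>s - s'\<bar> \<le> e" "\<And>j. j < n \<Longrightarrow> \<bar>U j s - V j s'\<bar> \<le> e"
  shows "rho n U s \<le> rho n V s' + e"
proof -
  have V: "\<bar>s'\<bar> \<le> rho n V s'" "\<And>j. j < n \<Longrightarrow> \<bar>V j s'\<bar> \<le> rho n V s'"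
    using rho_le_iff[of n V s' "rho n V s'"] by auto
  have "\<bar>U j s\<bar> \<le> rho n V s' + e" if "j < n" for j
    using assms(2)[OF that] V(2)[OF that] abs_triangle_ineq2[of "U j s" "V j s'"] by linarith
  moreover have "\<bar>s\<bar> \<le> rho n V s' + e"
    using assms(1) V(1) abs_triangle_ineq2[of s s'] by linarith
  ultimately show ?thesis unfolding rho_le_iff by blast
qed

lemma dff_rho:
  assumes "inf_family n U"
  shows "dff1 (rho n U)"
  unfolding rho_def
  by (intro dff_max dff_abs dff_var dff_fdist) (use assms in \<open>auto simp: inf_family_def dff_const\<close>)

lemma ev_rho_less:
  assumes "inf_family n U" "0 < e"
  shows "ev (\<lambda>s. rho n U s < e)"
proof -
  have "ev (\<lambda>s. \<forall>j<n. \<bar>U j s\<bar> < e)"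
    using assms by (intro ev_ball_less) (auto simp: inf_family_def)
  from this ev_less[OF assms(2)] show ?thesis
    by (rule ev_mono2) (auto simp: rho_less_iff)
qed

lemma rho_increasing:
  assumes "inf_family n U"
  obtains \<epsilon> where "0 < \<epsilon>" "\<And>x y. 0 < x \<Longrightarrow> x < y \<Longrightarrow> y < \<epsilon> \<Longrightarrow> rho n U x < rho n U y"
  using ev_increasing[OF dff_rho[OF assms] ev_mono[OF ev_pos] ev_rho_less[OF assms]] rho_pos
  by blast

section \<open>Joint continuity and a definable modulus for it\<close>

definition jointly_continuous_at :: "nat \<Rightarrow> (nat \<Rightarrow> 'm \<Rightarrow> 'm) \<Rightarrow> 'm \<Rightarrow> bool" where
  "jointly_continuous_at n U s \<longleftrightarrow> (\<forall>e>0. \<exists>d>0. \<forall>s'. \<bar>s' - s\<bar> < d \<longrightarrow> (\<forall>j<n. \<bar>U j s' - U j s\<bar> < e))"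

lemma jointly_continuous_atI:
  assumes "\<And>j. j < n \<Longrightarrow> continuous_at (U j) s"
  shows "jointly_continuous_at n U s"
  unfolding jointly_continuous_at_def
proof (intro allI impI)
  fix e :: 'm assume "0 < e"
  show "\<exists>d>0. \<forall>s'. \<bar>s' - s\<bar> < d \<longrightarrow> (\<forall>j<n. \<bar>U j s' - U j s\<bar> < e)"
    using assms
  proof (induction n)
    case 0
    then show ?case by (intro exI[of _ 1]) auto
  next
    case (Suc n)
    then obtain d where d: "0 < d" "\<forall>s'. \<bar>s' - s\<bar> < d \<longrightarrow> (\<forall>j<n. \<bar>U j s' - U j s\<bar> < e)" by auto
    have "continuous_at (U n) s" using Suc.prems by simp
    then obtain d' where d': "0 < d'" "\<forall>s'. \<bar>s' - s\<bar> < d' \<longrightarrow> \<bar>U n s' - U n s\<bar> < e"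
      using \<open>0 < e\<close> unfolding continuous_at_def by blast
    have "\<forall>s'. \<bar>s' - s\<bar> < min d d' \<longrightarrow> (\<forall>j<Suc n. \<bar>U j s' - U j s\<bar> < e)"
      using d d' by (auto simp: less_Suc_eq)
    then show ?case using d d' by (intro exI[of _ "min d d'"]) auto
  qed
qed

lemma ev_jointly_continuous:
  assumes "inf_family n U"
  shows "ev (jointly_continuous_at n U)"
proof -
  have "ev (\<lambda>s. \<forall>j<n. continuous_at (U j) s)"
    using assms by (intro ev_ball_less ev_continuous) (auto simp: inf_family_def)
  then show ?thesis by (rule ev_mono) (auto intro: jointly_continuous_atI)
qed

text \<open>Definable selection among the admissible \<open>d\<close>. The bound by
  \<open>s / 4\<close> makes \<open>w\<close> tend to zero, hence increase near zero, and keeps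
  shifted parameters comparable to \<open>s\<close>. The bound by \<open>E s\<close> lets
  \<open>w s\<close> double as an error bound.\<close>

lemma modulus:
  assumes U: "inf_family n U" and E: "pos_germ E"
  obtains w \<epsilon> where "dff1 w" "\<And>s. 0 < w s" "0 < \<epsilon>"
    "\<And>s. 0 < s \<Longrightarrow> s < \<epsilon> \<Longrightarrow> w s \<le> s / 4 \<and> w s \<le> E s \<and>
       (\<forall>s'. \<bar>s' - s\<bar> < w s \<longrightarrow> (\<forall>j<n. \<bar>U j s' - U j s\<bar> < E s))"
    "\<And>x y. 0 < x \<Longrightarrow> x < y \<Longrightarrow> y < \<epsilon> \<Longrightarrow> w x < w y"
proof -
  define Q where "Q s d \<longleftrightarrow> d \<le> s / 4 \<and> d \<le> E s \<and>
       (\<forall>s'. \<bar>s' - s\<bar> < d \<longrightarrow> (\<forall>j<n. \<bar>U j s' - U j s\<bar> < E s))" for s d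
  have Ud: "dff1 (U j)" if "j < n" for j using U that by (simp add: inf_family_def)
  have Ed: "dff1 E" "ev (\<lambda>s. 0 < E s)" using E by (auto simp: pos_germ_def)
  have "dfn (\<lambda>v. Q (v 0) (v (Suc 0)))"
    unfolding Q_def
    by (intro dfn_intros dff_comp1[OF Ed(1)] dfn_ball_less)
       (erule dff_comp1[OF Ud], intro dfn_intros)+
  then obtain w where w: "dff1 w" "\<And>s. 0 < w s" "\<And>s d. Q s d \<Longrightarrow> 0 < d \<Longrightarrow> Q s (w s)"
    by (rule dff1_selection) (auto simp: Q_def)
  have "ev (\<lambda>s. Q s (w s))"
    using ev_jointly_continuous[OF U] Ed(2)
  proof (rule ev_mono2)
    fix s assume s: "0 < s" "jointly_continuous_at n U s" "0 < E s"
    then obtain d where d: "0 < d" "\<forall>s'. \<bar>s' - s\<bar> < d \<longrightarrow> (\<forall>j<n. \<bar>U j s' - U j s\<bar> < E s)"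
      unfolding jointly_continuous_at_def by blast
    have "Q s (min d (min (s / 4) (E s)))" using d unfolding Q_def by auto
    with w(3) show "Q s (w s)" using d s by simp
  qed
  then obtain \<epsilon> where \<epsilon>: "0 < \<epsilon>" "\<And>s. 0 < s \<Longrightarrow> s < \<epsilon> \<Longrightarrow> Q s (w s)" by (rule evE) blast
  have "ev (\<lambda>s. w s < e)" if "0 < e" for e
  proof (rule evI[of "min \<epsilon> e"])
    fix t assume t: "0 < t" "t < min \<epsilon> e"
    then have "w t \<le> t / 4" using \<epsilon>(2)[of t] by (simp add: Q_def)
    also have "t / 4 < e" using t by simp
    finally show "w t < e" .
  qed (use \<epsilon> that in simp)
  moreover have "ev (\<lambda>s. 0 < w s)" using w(2) by simp
  ultimately obtain \<epsilon>' where \<epsilon>': "0 < \<epsilon>'" "\<And>x y. 0 < x \<Longrightarrow> x < y \<Longrightarrow> y < \<epsilon>' \<Longrightarrow> w x < w y"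
    using ev_increasing[OF w(1)] by blast
  show thesis
  proof (rule that[of w "min \<epsilon> \<epsilon>'"])
    show "w s \<le> s / 4 \<and> w s \<le> E s \<and>
       (\<forall>s'. \<bar>s' - s\<bar> < w s \<longrightarrow> (\<forall>j<n. \<bar>U j s' - U j s\<bar> < E s))" if "0 < s" "s < min \<epsilon> \<epsilon>'" for s
      using \<epsilon>(2)[of s] that unfolding Q_def by simp
  qed (use w \<epsilon> \<epsilon>' in auto)
qed

text \<open>In the coordinates \<open>s \<mapsto> (s, U s)\<close>, this says that the parts of two normalized curves lying in the
  ball of radius \<open>t\<close> are within Hausdorff distance \<open>e\<close>.\<close>

definition hclose_at :: "nat \<Rightarrow> (nat \<Rightarrow> 'm \<Rightarrow> 'm) \<Rightarrow> (nat \<Rightarrow> 'm \<Rightarrow> 'm) \<Rightarrow> 'm \<Rightarrow> 'm \<Rightarrow> bool" where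
  "hclose_at n U V t e \<longleftrightarrow>
     (\<forall>s>0. rho n U s < t \<longrightarrow> (\<exists>s'>0. rho n V s' < t \<and> \<bar>s - s'\<bar> < e \<and> (\<forall>j<n. \<bar>U j s - V j s'\<bar> < e))) \<and>
     (\<forall>s>0. rho n V s < t \<longrightarrow> (\<exists>s'>0. rho n U s' < t \<and> \<bar>s' - s\<bar> < e \<and> (\<forall>j<n. \<bar>U j s' - V j s\<bar> < e)))"

text \<open>The point with parameter \<open>s\<close> on the second curve is close to one with parameter \<open>s'\<close> on the first.
  The radius \<open>R\<close> is so small, measured against the inverse of \<open>rho n U\<close>, that \<open>s'\<close> lies within the
  modulus of continuity of \<open>U\<close> at \<open>s\<close>.\<close>

lemma hclose_imp_close:
  assumes U: "inf_family n U" and r: "pos_germ r"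
  shows "\<exists>R. pos_germ R \<and> (\<forall>V. inf_family n V \<longrightarrow> ev (\<lambda>t. hclose_at n U V t (R t))
           \<longrightarrow> ev (\<lambda>s. \<forall>j<n. \<bar>U j s - V j s\<bar> < r s))"
proof -
  \<comment> \<open>One half pays for the variation of \<open>U\<close>, the other for the distance
    between the two curves.\<close>
  define E where "E s = r s / 2" for s
  have E: "pos_germ E" using r unfolding pos_germ_def E_def by (auto intro!: dff_divide_const)
  obtain w \<epsilon>1 where w: "dff1 w" "\<And>s. 0 < w s" and \<epsilon>1: "0 < \<epsilon>1"
    and wQ: "\<And>s. 0 < s \<Longrightarrow> s < \<epsilon>1 \<Longrightarrow> w s \<le> s / 4 \<and> w s \<le> E s \<and>
       (\<forall>s'. \<bar>s' - s\<bar> < w s \<longrightarrow> (\<forall>j<n. \<bar>U j s' - U j s\<bar> < E s))"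
    and w_mono: "\<And>x y. 0 < x \<Longrightarrow> x < y \<Longrightarrow> y < \<epsilon>1 \<Longrightarrow> w x < w y"
    using modulus[OF U E] by blast
  obtain \<epsilon>2 where \<epsilon>2: "0 < \<epsilon>2"
    and rho_mono: "\<And>x y. 0 < x \<Longrightarrow> x < y \<Longrightarrow> y < \<epsilon>2 \<Longrightarrow> rho n U x < rho n U y"
    using rho_increasing[OF U] by blast
  \<comment> \<open>The half is there because \<open>rho n U\<close> is also evaluated at
    \<open>2 * s\<close>.\<close>
  define \<epsilon> where "\<epsilon> = min \<epsilon>1 (\<epsilon>2 / 2)"
  have \<epsilon>: "0 < \<epsilon>" "\<epsilon> \<le> \<epsilon>1" "2 * \<epsilon> \<le> \<epsilon>2" using \<epsilon>1 \<epsilon>2 by (auto simp: \<epsilon>_def min_def)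
  \<comment> \<open>The parameter at which \<open>R t\<close> will be compared with \<open>w\<close>
    is known only through \<open>t \<le> 4 * rho n U (2 * s)\<close>, so \<open>R t\<close> has to
    lie below \<open>w\<close> at all such parameters.\<close>
  define Q where "Q t d \<longleftrightarrow> d \<le> t / 4 \<and> (\<forall>s. 0 < s \<longrightarrow> s < \<epsilon> \<longrightarrow> t \<le> 4 * rho n U (2 * s) \<longrightarrow> d \<le> w s)" for t d
  have "dfn (\<lambda>v. Q (v 0) (v (Suc 0)))"
    unfolding Q_def by (intro dfn_intros dff_comp1[OF w(1)] dff_comp1[OF dff_rho[OF U]])
  then obtain R where R: "dff1 R" "\<And>t. 0 < R t" "\<And>t d. Q t d \<Longrightarrow> 0 < d \<Longrightarrow> Q t (R t)"
    by (rule dff1_selection) (auto simp: Q_def intro: order_trans)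
  have RQ: "Q t (R t)" if "0 < t" for t
  proof -
    have "ev (\<lambda>s. rho n U s < t / 4 \<and> s < \<epsilon>)"
      using that \<epsilon> by (intro ev_conj ev_rho_less[OF U] ev_less) auto
    then obtain \<eta> where \<eta>: "0 < \<eta>" "\<And>s. 0 < s \<Longrightarrow> s < \<eta> \<Longrightarrow> rho n U s < t / 4 \<and> s < \<epsilon>" by (rule evE) blast
    \<comment> \<open>Below \<open>s0\<close> the condition on \<open>t\<close> fails because
      \<open>rho n U\<close> increases. So \<open>w s0\<close> bounds all relevant values of
      \<open>w\<close> from below, as \<open>w\<close> increases too.\<close>
    define s0 where "s0 = \<eta> / 4"
    have s0: "0 < s0" "s0 < \<epsilon>" "rho n U (2 * s0) < t / 4"
      using \<eta>(1) \<eta>(2)[of s0] \<eta>(2)[of "2 * s0"] by (auto simp: s0_def)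
    have "w s0 \<le> w s" if s: "0 < s" "s < \<epsilon>" "t \<le> 4 * rho n U (2 * s)" for s
    proof -
      have "s0 \<le> s"
      proof (rule ccontr)
        assume "\<not> s0 \<le> s"
        then have "rho n U (2 * s) < rho n U (2 * s0)" using s s0 \<epsilon> by (intro rho_mono) auto
        with s s0 show False by simp
      qed
      then show ?thesis using w_mono[of s0 s] s0 s \<epsilon> by (cases "s0 = s") auto
    qed
    then have "Q t (min (t / 4) (w s0))" unfolding Q_def by (auto simp: min_le_iff_disj)
    then show ?thesis by (rule R(3)) (use that w in simp)
  qed
  have "ev (\<lambda>s. \<forall>j<n. \<bar>U j s - V j s\<bar> < r s)"
    if V: "inf_family n V" and close: "ev (\<lambda>t. hclose_at n U V t (R t))" for V
  proof -
    obtain \<eta> where \<eta>: "0 < \<eta>" "\<And>t. 0 < t \<Longrightarrow> t < \<eta> \<Longrightarrow> hclose_at n U V t (R t)"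
      using close by (elim evE) blast
    have "ev (\<lambda>s. rho n V s < min \<eta> \<epsilon> / 2)" by (rule ev_rho_less[OF V]) (use \<eta> \<epsilon> in simp)
    then show ?thesis
    proof (rule ev_mono, intro allI impI)
      fix s j assume "0 < s" and s: "rho n V s < min \<eta> \<epsilon> / 2" and "j < n"
      \<comment> \<open>The factor 2 puts the point of the second curve strictly inside the ball
        while \<open>t\<close> remains comparable to its distance from \<open>a\<close>.\<close>
      define t where "t = 2 * rho n V s"
      have t: "0 < t" "t < \<eta>" "t < \<epsilon>" using s rho_pos[OF \<open>0 < s\<close>, of n V] by (auto simp: t_def min_def split: if_splits)
      have "rho n V s < t" using rho_pos[OF \<open>0 < s\<close>, of n V] by (simp add: t_def)
      with \<eta>(2)[OF t(1,2)] \<open>0 < s\<close> obtain s' where s': "0 < s'" "rho n U s' < t" "\<bar>s' - s\<bar> < R t"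
        "\<forall>j<n. \<bar>U j s' - V j s\<bar> < R t"
        unfolding hclose_at_def by blast
      have Rt: "R t \<le> t / 4" using RQ[OF t(1)] by (simp add: Q_def)
      have Rw: "R t \<le> w x" if "0 < x" "x < \<epsilon>" "t \<le> 4 * rho n U (2 * x)" for x
        using RQ[OF t(1)] that by (simp add: Q_def)
      have "rho n V s \<le> rho n U s' + R t"
        using s' by (intro rho_le_add) (auto simp: abs_minus_commute less_imp_le)
      then have t4: "t \<le> 4 * rho n U s'" using Rt by (simp add: t_def field_simps)
      have "s' < \<epsilon>" "s < \<epsilon>" using le_rho[of s' n U] s'(2) t le_rho[of s n V] \<open>rho n V s < t\<close> by auto
      \<comment> \<open>A bootstrap: so far the condition in \<open>Q\<close> is known only at
        \<open>s' / 2\<close>. There it already gives \<open>s' < 2 * s\<close>, and with this it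
        follows at \<open>s\<close> itself.\<close>
      have "R t \<le> w (s' / 2)" using t4 s'(1) \<open>s' < \<epsilon>\<close> by (intro Rw) auto
      also have "w (s' / 2) \<le> s' / 2 / 4" using wQ[of "s' / 2"] s'(1) \<open>s' < \<epsilon>\<close> \<epsilon> by auto
      finally have "s' < 2 * s" using s'(1,3) by (simp add: abs_less_iff field_simps)
      then have "rho n U s' < rho n U (2 * s)" using s' \<open>s < \<epsilon>\<close> \<epsilon> by (intro rho_mono) auto
      then have Rws: "R t \<le> w s" using t4 \<open>0 < s\<close> \<open>s < \<epsilon>\<close> by (intro Rw) auto
      have ws: "w s \<le> E s" "\<forall>s'. \<bar>s' - s\<bar> < w s \<longrightarrow> (\<forall>j<n. \<bar>U j s' - U j s\<bar> < E s)"
        using wQ[of s] \<open>0 < s\<close> \<open>s < \<epsilon>\<close> \<epsilon> by auto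
      have "\<bar>U j s' - U j s\<bar> < E s" using ws(2) s'(3) Rws \<open>j < n\<close> by auto
      moreover have "\<bar>U j s' - V j s\<bar> < E s" using s'(4) Rws ws(1) \<open>j < n\<close> by force
      ultimately have "\<bar>U j s - V j s\<bar> < E s + E s"
        using abs_triangle_ineq[of "U j s - U j s'" "U j s' - V j s"] by (simp add: abs_minus_commute)
      then show "\<bar>U j s - V j s\<bar> < r s" by (simp add: E_def)
    qed
  qed
  moreover have "pos_germ R" using R by (simp add: pos_germ_def)
  ultimately show ?thesis by blast
qed

text \<open>A point with parameter \<open>s\<close> on either curve is matched with the point of parameter \<open>s - w s / 2\<close> on
  the other one, which still lies in the ball because \<open>r s\<close> is at most the decrease of \<open>rho n U\<close>.\<close>

lemma close_imp_hclose:
  assumes U: "inf_family n U" and R: "pos_germ R"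
  shows "\<exists>r. pos_germ r \<and> (\<forall>V. inf_family n V \<longrightarrow> ev (\<lambda>s. \<forall>j<n. \<bar>U j s - V j s\<bar> < r s)
           \<longrightarrow> ev (\<lambda>t. hclose_at n U V t (R t)))"
proof -
  \<comment> \<open>Capping by \<open>t\<close> makes the radius tend to zero, so it increases near
    zero and its value at a smaller distance bounds the one at \<open>t\<close> from below.\<close>
  define R1 where "R1 t = min (R t) t" for t
  have Rd: "dff1 R" "ev (\<lambda>t. 0 < R t)" using R by (auto simp: pos_germ_def)
  have R1d: "dff1 R1" unfolding R1_def by (intro dfn_intros Rd)
  have R1pos: "ev (\<lambda>t. 0 < R1 t)" using Rd(2) by (rule ev_mono) (simp add: R1_def)
  moreover have "ev (\<lambda>t. R1 t < e)" if "0 < e" for e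
    using ev_less[OF that] by (rule ev_mono) (simp add: R1_def min_less_iff_disj)
  ultimately obtain \<epsilon>1 where \<epsilon>1: "0 < \<epsilon>1" and R1_mono: "\<And>x y. 0 < x \<Longrightarrow> x < y \<Longrightarrow> y < \<epsilon>1 \<Longrightarrow> R1 x < R1 y"
    using ev_increasing[OF R1d] by blast
  obtain \<epsilon>2 where \<epsilon>2: "0 < \<epsilon>2"
    and rho_mono: "\<And>x y. 0 < x \<Longrightarrow> x < y \<Longrightarrow> y < \<epsilon>2 \<Longrightarrow> rho n U x < rho n U y"
    using rho_increasing[OF U] by blast
  \<comment> \<open>The error allowed at \<open>s\<close> is half the radius at a distance below
    every relevant \<open>t\<close>, since two errors add up. The argument is \<open>s / 2\<close>
    because for a point of the second curve only the partner at \<open>c s > s / 2\<close> on the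
    first is known to lie in the ball.\<close>
  define E where "E s = R1 (rho n U (s / 2)) / 2" for s
  have "pos_germ E"
  proof -
    obtain \<eta> where \<eta>: "0 < \<eta>" "\<And>t. 0 < t \<Longrightarrow> t < \<eta> \<Longrightarrow> 0 < R1 t" using R1pos by (rule evE) blast
    obtain \<eta>' where \<eta>': "0 < \<eta>'" "\<And>t. 0 < t \<Longrightarrow> t < \<eta>' \<Longrightarrow> rho n U t < \<eta>" using ev_rho_less[OF U \<eta>(1)] by (rule evE) blast
    have "ev (\<lambda>s. 0 < E s)"
    proof (rule evI[OF \<eta>'(1)])
      fix s assume "0 < s" "s < \<eta>'"
      then show "0 < E s" unfolding E_def using \<eta>'(2)[of "s / 2"] rho_pos[of "s / 2" n U] \<eta>(2) by simp
    qed
    moreover have "dff1 E" unfolding E_def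
      by (intro dfn_intros dff_comp1[OF R1d] dff_comp1[OF dff_rho[OF U]])
    ultimately show ?thesis by (simp add: pos_germ_def)
  qed
  obtain w \<epsilon>3 where w: "dff1 w" "\<And>s. 0 < w s" and \<epsilon>3: "0 < \<epsilon>3"
    and wQ: "\<And>s. 0 < s \<Longrightarrow> s < \<epsilon>3 \<Longrightarrow> w s \<le> s / 4 \<and> w s \<le> E s \<and>
       (\<forall>s'. \<bar>s' - s\<bar> < w s \<longrightarrow> (\<forall>j<n. \<bar>U j s' - U j s\<bar> < E s))"
    and "\<And>x y. 0 < x \<Longrightarrow> x < y \<Longrightarrow> y < \<epsilon>3 \<Longrightarrow> w x < w y"
    using modulus[OF U \<open>pos_germ E\<close>] by blast
  define \<epsilon>4 where "\<epsilon>4 = min \<epsilon>2 \<epsilon>3"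
  have \<epsilon>4: "0 < \<epsilon>4" "\<epsilon>4 \<le> \<epsilon>2" "\<epsilon>4 \<le> \<epsilon>3" using \<epsilon>2 \<epsilon>3 by (auto simp: \<epsilon>4_def)
  define c where "c s = s - w s / 2" for s
  have c: "s / 2 < c s" "c s < s" "0 < c s" if "0 < s" "s < \<epsilon>4" for s
    using wQ[of s] w(2)[of s] that \<epsilon>4 by (auto simp: c_def field_simps)
  have cw: "\<bar>c s - s\<bar> < w s" for s using w(2)[of s] by (simp add: c_def)
  \<comment> \<open>The entry \<open>s\<close> makes \<open>r\<close> tend to zero and hence
    increase, so \<open>r s\<close> also bounds the distance of the curves at the earlier parameter
    \<open>c s\<close>.\<close>
  define r where "r s = min s (min (E s) (rho n U s - rho n U (c s)))" for s
  have Ed: "dff1 E" "ev (\<lambda>s. 0 < E s)" using \<open>pos_germ E\<close> by (auto simp: pos_germ_def)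
  have rd: "dff1 r" unfolding r_def c_def
    by (intro dfn_intros Ed dff_comp1[OF dff_rho[OF U]] w(1))
  have rpos: "ev (\<lambda>s. 0 < r s)"
    using Ed(2) ev_less[OF \<epsilon>4(1)]
  proof (rule ev_mono2)
    fix s assume s: "0 < s" "0 < E s" "s < \<epsilon>4"
    have "rho n U (c s) < rho n U s" using c[OF s(1,3)] s \<epsilon>4 by (intro rho_mono) auto
    with s show "0 < r s" by (simp add: r_def)
  qed
  moreover have "ev (\<lambda>t. r t < e)" if "0 < e" for e
    using ev_less[OF that] by (rule ev_mono) (simp add: r_def min_less_iff_disj)
  ultimately obtain \<epsilon>5 where \<epsilon>5: "0 < \<epsilon>5" and r_mono: "\<And>x y. 0 < x \<Longrightarrow> x < y \<Longrightarrow> y < \<epsilon>5 \<Longrightarrow> r x < r y"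
    using ev_increasing[OF rd] by blast
  have "ev (\<lambda>t. hclose_at n U V t (R t))"
    if V: "inf_family n V" and close: "ev (\<lambda>s. \<forall>j<n. \<bar>U j s - V j s\<bar> < r s)" for V
  proof -
    have "ev (\<lambda>s. 0 < r s \<and> (\<forall>j<n. \<bar>U j s - V j s\<bar> < r s))" using rpos close by (rule ev_conj)
    then obtain \<eta> where \<eta>: "0 < \<eta>" "\<And>s. 0 < s \<Longrightarrow> s < \<eta> \<Longrightarrow> 0 < r s \<and> (\<forall>j<n. \<bar>U j s - V j s\<bar> < r s)"
      by (rule evE) blast
    define \<epsilon> where "\<epsilon> = min (min \<eta> \<epsilon>1) (min \<epsilon>4 \<epsilon>5)"
    have \<epsilon>: "0 < \<epsilon>" "\<epsilon> \<le> \<eta>" "\<epsilon> \<le> \<epsilon>1" "\<epsilon> \<le> \<epsilon>4" "\<epsilon> \<le> \<epsilon>5" using \<eta> \<epsilon>1 \<epsilon>4 \<epsilon>5 by (auto simp: \<epsilon>_def)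
    show ?thesis
    proof (rule evI[OF \<epsilon>(1)])
      fix t assume t: "0 < t" "t < \<epsilon>"
      have R1R: "R1 t \<le> R t" by (simp add: R1_def)
      have twoE: "E s + E s < R t" if s: "0 < s" "s < \<epsilon>" "rho n U (s / 2) < t" for s
      proof -
        have "R1 (rho n U (s / 2)) < R1 t" using s t \<epsilon> rho_pos[of "s / 2" n U] by (intro R1_mono) auto
        then show ?thesis using R1R by (simp add: E_def)
      qed
      have UV: "0 < r s" "\<And>j. j < n \<Longrightarrow> \<bar>U j s - V j s\<bar> < r s" if "0 < s" "s < \<epsilon>" for s
        using \<eta>(2)[of s] that \<epsilon> by auto
      have UE: "\<bar>U j (c s) - U j s\<bar> < E s" if "0 < s" "s < \<epsilon>" "j < n" for s j
        using wQ[of s] cw[of s] that \<epsilon> \<epsilon>4 by auto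
      have cE: "\<bar>c s - s\<bar> < E s" if "0 < s" "s < \<epsilon>" for s
        using wQ[of s] cw[of s] that \<epsilon> \<epsilon>4 by force
      have rE: "r s \<le> E s" "rho n U (c s) + r s \<le> rho n U s" for s
        by (auto simp: r_def min_def)
      have cs: "s / 2 < c s" "c s < s" "0 < c s" "c s < \<epsilon>" if "0 < s" "s < \<epsilon>" for s
        using c[of s] that \<epsilon> by auto
      have first: "\<exists>s'>0. rho n V s' < t \<and> \<bar>s - s'\<bar> < R t \<and> (\<forall>j<n. \<bar>U j s - V j s'\<bar> < R t)"
        if "0 < s" and st: "rho n U s < t" for s
      proof -
        have s: "s < \<epsilon>" using st t le_rho[of s n U] by auto
        note cs = cs[OF \<open>0 < s\<close> s]
        have "rho n U (s / 2) < rho n U s" using \<open>0 < s\<close> s \<epsilon> \<epsilon>4 by (intro rho_mono) auto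
        then have E2: "E s + E s < R t" using st by (intro twoE \<open>0 < s\<close> s) auto
        have rc: "r (c s) < r s" using cs s \<epsilon> by (intro r_mono) auto
        have "rho n V (c s) \<le> rho n U (c s) + r (c s)"
          using UV[OF cs(3,4)] by (intro rho_le_add) (auto simp: abs_minus_commute less_imp_le)
        then have "rho n V (c s) < t" using rc rE(2)[of s] st by linarith
        moreover have "\<bar>s - c s\<bar> < R t" using cE[OF \<open>0 < s\<close> s] E2 by (simp add: abs_minus_commute)
        moreover have "\<bar>U j s - V j (c s)\<bar> < R t" if "j < n" for j
        proof -
          have "\<bar>U j s - V j (c s)\<bar> \<le> \<bar>U j (c s) - U j s\<bar> + \<bar>U j (c s) - V j (c s)\<bar>"
            using abs_triangle_ineq[of "U j s - U j (c s)" "U j (c s) - V j (c s)"] by (simp add: abs_minus_commute)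
          also have "\<dots> < E s + E s"
            using UE[OF \<open>0 < s\<close> s that] UV(2)[OF cs(3,4) that] rc rE(1)[of s] by linarith
          finally show ?thesis using E2 by linarith
        qed
        ultimately show ?thesis using cs(3) by blast
      qed
      have second: "\<exists>s'>0. rho n U s' < t \<and> \<bar>s' - s\<bar> < R t \<and> (\<forall>j<n. \<bar>U j s' - V j s\<bar> < R t)"
        if "0 < s" and st: "rho n V s < t" for s
      proof -
        have s: "s < \<epsilon>" using st t le_rho[of s n V] by auto
        note cs = cs[OF \<open>0 < s\<close> s]
        have "rho n U s \<le> rho n V s + r s"
          using UV[OF \<open>0 < s\<close> s] by (intro rho_le_add) (auto simp: less_imp_le)
        then have ct: "rho n U (c s) < t" using rE(2)[of s] st by linarith
        have "rho n U (s / 2) < rho n U (c s)" using \<open>0 < s\<close> s cs \<epsilon> \<epsilon>4 by (intro rho_mono) auto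
        then have E2: "E s + E s < R t" using ct by (intro twoE \<open>0 < s\<close> s) auto
        have "\<bar>U j (c s) - V j s\<bar> < R t" if "j < n" for j
        proof -
          have "\<bar>U j (c s) - V j s\<bar> \<le> \<bar>U j (c s) - U j s\<bar> + \<bar>U j s - V j s\<bar>"
            using abs_triangle_ineq[of "U j (c s) - U j s" "U j s - V j s"] by simp
          also have "\<dots> < E s + E s"
            using UE[OF \<open>0 < s\<close> s that] UV(2)[OF \<open>0 < s\<close> s that] rE(1)[of s] by linarith
          finally show ?thesis using E2 by linarith
        qed
        moreover have "\<bar>c s - s\<bar> < R t" using cE[OF \<open>0 < s\<close> s] E2 by simp
        ultimately show ?thesis using cs(3) ct by blast
      qed
      show "hclose_at n U V t (R t)" unfolding hclose_at_def using first second by blast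
    qed
  qed
  moreover have "pos_germ r" using rd rpos by (simp add: pos_germ_def)
  ultimately show ?thesis by blast
qed

end

section \<open>The sup metric and the Hausdorff distance\<close>

lemma sdist_eq: "sdist x y = Max (insert 0 ((\<lambda>j. \<bar>x ! j - y ! j\<bar>) ` {..<length x}))"
proof -
  have "{\<bar>x ! j - y ! j\<bar> |j. j < length x} = (\<lambda>j. \<bar>x ! j - y ! j\<bar>) ` {..<length x}" by auto
  then show ?thesis unfolding sdist_def by simp
qed

lemma sdist_less_iff: "sdist x y < e \<longleftrightarrow> 0 < e \<and> (\<forall>j<length x. \<bar>x ! j - y ! j\<bar> < e)"
  unfolding sdist_eq by (subst Max_less_iff) auto

lemma sdist_le_iff: "sdist x y \<le> e \<longleftrightarrow> 0 \<le> e \<and> (\<forall>j<length x. \<bar>x ! j - y ! j\<bar> \<le> e)"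
  unfolding sdist_eq by (subst Max_le_iff) auto

lemma sdist_nonneg [simp]: "0 \<le> sdist x y"
  using sdist_le_iff[of x y "sdist x y"] by simp

lemma sdist_commute: "length x = length y \<Longrightarrow> sdist x y = sdist y x"
  unfolding sdist_eq by (metis (mono_tags, lifting) abs_minus_commute image_cong)

lemma sdist_triangle:
  assumes "length x = length y"
  shows "sdist x z \<le> sdist x y + sdist y z"
proof -
  have "\<bar>x ! j - z ! j\<bar> \<le> sdist x y + sdist y z" if "j < length x" for j
  proof -
    have "\<bar>x ! j - y ! j\<bar> \<le> sdist x y" "\<bar>y ! j - z ! j\<bar> \<le> sdist y z"
      using sdist_le_iff[of x y "sdist x y"] sdist_le_iff[of y z "sdist y z"] that assms by auto
    then show ?thesis using abs_triangle_ineq[of "x ! j - y ! j" "y ! j - z ! j"] by simp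
  qed
  then show ?thesis by (simp add: sdist_le_iff)
qed

lemma sdist_self [simp]: "sdist x x = 0"
  by (rule order.antisym) (simp_all add: sdist_le_iff)

lemma sdist_eq_0_iff: "length x = length y \<Longrightarrow> sdist x y = 0 \<longleftrightarrow> x = y"
proof
  assume "length x = length y" "sdist x y = 0"
  then show "x = y" using sdist_le_iff[of x y 0] by (intro nth_equalityI) auto
qed simp

text \<open>Maxima over coordinates are handled through their strict upper bounds; this turns such a
  description back into an equation.\<close>

lemma eq_iff_same_upper: "(\<forall>e. x < e \<longleftrightarrow> s < e) \<longleftrightarrow> x = (s::'a::linorder)"
  by (metis less_irrefl linorder_neqE)

text \<open>Hausdorff closeness without infima and suprema. For the definable sets below, distance
  less than \<open>e\<close> implies \<open>hclose A B e\<close>, which in turn gives only distance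
  at most \<open>e\<close>, since strict inequalities do not survive the supremum.\<close>

definition hclose :: "'m::linordered_field list set \<Rightarrow> 'm list set \<Rightarrow> 'm \<Rightarrow> bool" where
  "hclose A B e \<longleftrightarrow> (\<forall>x\<in>A. \<exists>y\<in>B. sdist x y < e) \<and> (\<forall>y\<in>B. \<exists>x\<in>A. sdist x y < e)"

lemma hclose_triangle:
  assumes len: "\<And>x y. x \<in> A \<Longrightarrow> y \<in> B \<Longrightarrow> length x = length y"
    and "hclose A B d" "hclose B C e"
  shows "hclose A C (d + e)"
  unfolding hclose_def
proof (intro conjI ballI)
  fix x assume "x \<in> A"
  with assms obtain y z where "y \<in> B" "z \<in> C" "sdist x y < d" "sdist y z < e"
    unfolding hclose_def by blast
  with sdist_triangle[OF len[OF \<open>x \<in> A\<close>], of y z] show "\<exists>z\<in>C. sdist x z < d + e"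
    by (intro bexI[of _ z]) auto
next
  fix z assume "z \<in> C"
  with assms obtain y x where "y \<in> B" "x \<in> A" "sdist x y < d" "sdist y z < e"
    unfolding hclose_def by blast
  with sdist_triangle[OF len[OF \<open>x \<in> A\<close>], of y z] show "\<exists>x\<in>A. sdist x z < d + e"
    by (intro bexI[of _ x]) auto
qed

lemma hclose_mono: "hclose A B d \<Longrightarrow> d \<le> e \<Longrightarrow> hclose A B e"
  unfolding hclose_def by (meson less_le_trans)

context ominimal_field
begin

text \<open>The lower bounds form a definable set containing 0 and bounded by any attained value, so
  definable completeness gives \<open>GREATEST\<close> its meaning.\<close>

lemma dfn_glb_Greatest:
  assumes "dfn1 Q" "Q t0" "dff1 g" "\<And>t. Q t \<Longrightarrow> 0 \<le> g t"
  shows "(GREATEST s. \<forall>x\<in>{g t |t. Q t}. s \<le> x) < e \<longleftrightarrow> (\<exists>t. Q t \<and> g t < e)"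
proof -
  define P where "P s \<longleftrightarrow> (\<forall>t. Q t \<longrightarrow> s \<le> g t)" for s
  have "dfn1 P" unfolding P_def by (intro dfn_intros dfn_comp1[OF assms(1)] dff_comp1[OF assms(3)])
  moreover have "s \<le> g t0" if "P s" for s using assms(2) that unfolding P_def by blast
  moreover have "P 0" using assms unfolding P_def by auto
  ultimately obtain m where m: "\<And>s. P s \<Longrightarrow> s \<le> m" "\<And>u. (\<And>s. P s \<Longrightarrow> s \<le> u) \<Longrightarrow> m \<le> u"
    by (metis dfn1_lub)
  have "P m" unfolding P_def using m(2) by (metis P_def)
  have "(GREATEST s. \<forall>x\<in>{g t |t. Q t}. s \<le> x) = (GREATEST s. P s)"
    unfolding P_def by (rule arg_cong[where f = Greatest]) auto
  also have "\<dots> = m" using \<open>P m\<close> m(1) by (rule Greatest_equality)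
  finally show ?thesis using \<open>P m\<close> m(1)[of e] unfolding P_def by (metis linorder_not_less order_trans)
qed

text \<open>The inner infimum need not be attained, which is why a partner is required within every
  \<open>e'\<close> above \<open>e\<close> and not within \<open>e\<close> itself.\<close>

lemma sup_inf_le_iff:
  assumes P: "dfn1 P" "P p0" and Q: "dfn1 Q" "Q q0" and g: "dff (\<lambda>v. g (v 0) (v (Suc 0)))"
    and nonneg: "\<And>s t. 0 \<le> g s t" and bound: "\<And>s t. P s \<Longrightarrow> Q t \<Longrightarrow> g s t \<le> u"
  shows "(LEAST s. \<forall>x\<in>{GREATEST r. \<forall>y\<in>{g p t |t. Q t}. r \<le> y |p. P p}. x \<le> s) \<le> e
     \<longleftrightarrow> (\<forall>e'>e. \<forall>p. P p \<longrightarrow> (\<exists>q. Q q \<and> g p q < e'))"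
proof -
  define \<iota> where "\<iota> p = (GREATEST r. \<forall>y\<in>{g p t |t. Q t}. r \<le> y)" for p
  have gp: "dff1 (g p)" for p
  proof -
    have "dfn (\<lambda>v. v 0 = g (v (Suc 0)) (v (Suc (Suc 0))))" using g by (simp add: dff_def)
    from dff_comp2[OF this dff_const[of p] dff_var[of 0]] show ?thesis .
  qed
  have \<iota>: "\<iota> p < e \<longleftrightarrow> (\<exists>t. Q t \<and> g p t < e)" for p e
    unfolding \<iota>_def by (rule dfn_glb_Greatest[OF Q gp nonneg])
  define B where "B s \<longleftrightarrow> (\<forall>p. P p \<longrightarrow> \<iota> p \<le> s)" for s
  have B_iff: "B s \<longleftrightarrow> (\<forall>e. s < e \<longrightarrow> (\<forall>p. P p \<longrightarrow> (\<exists>q. Q q \<and> g p q < e)))" for s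
  proof -
    have "\<iota> p \<le> s \<longleftrightarrow> (\<forall>e>s. \<iota> p < e)" for p
      by (meson dense_ge le_less_trans less_imp_le)
    then show ?thesis unfolding B_def \<iota> by blast
  qed
  \<comment> \<open>\<open>dfn1_lub\<close> provides suprema only, so the least upper bound is found
    as minus the supremum of the negated upper bounds.\<close>
  have "dfn1 (\<lambda>s. B (- s))"
  proof -
    have gd: "dff (\<lambda>v. g (f v) (h v))" if "dff f" "dff h" for f h
    proof -
      have "dfn (\<lambda>v. v 0 = g (v (Suc 0)) (v (Suc (Suc 0))))" using g by (simp add: dff_def)
      from dff_comp2[OF this that] show ?thesis .
    qed
    then show ?thesis
      unfolding B_iff by (intro dfn_intros dfn_comp1[OF P(1)] dfn_comp1[OF Q(1)] gd)
  qed
  moreover have "B u" unfolding B_iff using bound Q(2) by (meson le_less_trans)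
  then have "B (- (- u))" by simp
  moreover have "0 \<le> s" if "B s" for s
  proof -
    have "\<not> \<iota> p0 < 0" unfolding \<iota> using nonneg by (simp add: not_less)
    then show ?thesis using that P(2) unfolding B_def by (meson not_less order_trans)
  qed
  then have "s \<le> 0" if "B (- s)" for s using that by force
  ultimately obtain m where m: "\<And>s. B (- s) \<Longrightarrow> s \<le> m" "\<And>u. (\<And>s. B (- s) \<Longrightarrow> s \<le> u) \<Longrightarrow> m \<le> u"
    using dfn1_lub[of "\<lambda>s. B (- s)"] by metis
  have m': "- m \<le> s" if "B s" for s using m(1)[of "- s"] that by (simp add: minus_le_iff)
  have "B (- m)" unfolding B_def
  proof (intro allI impI)
    fix p assume "P p"
    then have "m \<le> - \<iota> p" by (intro m(2)) (auto simp: B_def le_minus_iff)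
    then show "\<iota> p \<le> - m" by (simp add: le_minus_iff)
  qed
  have "(LEAST s. \<forall>x\<in>{\<iota> p |p. P p}. x \<le> s) = (LEAST s. B s)"
    unfolding B_def by (rule arg_cong[where f = Least]) auto
  also have "\<dots> = - m" using \<open>B (- m)\<close> m' by (rule Least_equality)
  finally have "(LEAST s. \<forall>x\<in>{\<iota> p |p. P p}. x \<le> s) \<le> e \<longleftrightarrow> B e"
    using \<open>B (- m)\<close> m' unfolding B_def by (metis order_trans)
  then show ?thesis unfolding \<iota>_def[symmetric] B_iff by blast
qed

text \<open>Maps are total here, so that the closure rules apply without domain conditions; curves
  are first extended definably beyond their interval.\<close>

definition dmap :: "nat \<Rightarrow> ('m \<Rightarrow> 'm list) \<Rightarrow> bool" where
  "dmap n f \<longleftrightarrow> (\<forall>t. length (f t) = n) \<and> (\<forall>j<n. dff1 (\<lambda>t. f t ! j))"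

lemma dmap_length [simp]: "dmap n f \<Longrightarrow> length (f t) = n"
  by (simp add: dmap_def)

lemma dmap_nth: "dmap n f \<Longrightarrow> j < n \<Longrightarrow> dff1 (\<lambda>t. f t ! j)"
  unfolding dmap_def by blast

lemma dmapI: "(\<And>t. length (f t) = n) \<Longrightarrow> (\<And>j. j < n \<Longrightarrow> dff1 (\<lambda>t. f t ! j)) \<Longrightarrow> dmap n f"
  unfolding dmap_def by blast

lemma dmap_const: "dmap (length a) (\<lambda>_. a)"
  by (simp add: dmap_def dff_const)

lemma dff_sdist:
  assumes "dmap n f" "dmap n g" "dff p" "dff q"
  shows "dff (\<lambda>v. sdist (f (p v)) (g (q v)))"
proof -
  have "dfn (\<lambda>v. \<forall>e. v 0 < e \<longleftrightarrow> 0 < e \<and> (\<forall>j<n. \<bar>f (v (Suc 0)) ! j - g (v (Suc (Suc 0))) ! j\<bar> < e))"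
  proof (intro dfn_all dfn_iff dfn_conj dfn_ball_less dfn_less dff_var dff_const dff_abs dff_diff)
    fix j assume "j < n"
    with assms(1,2) have fj: "dff1 (\<lambda>t. f t ! j)" and gj: "dff1 (\<lambda>t. g t ! j)"
      by (auto intro: dmap_nth)
    show "dff (\<lambda>v. f (v (Suc (Suc 0))) ! j)" by (rule dff_comp1[OF fj dff_var])
    show "dff (\<lambda>v. g (v (Suc (Suc (Suc 0)))) ! j)" by (rule dff_comp1[OF gj dff_var])
  qed
  moreover have "(\<forall>e. x < e \<longleftrightarrow> 0 < e \<and> (\<forall>j<n. \<bar>f s ! j - g t ! j\<bar> < e)) \<longleftrightarrow> x = sdist (f s) (g t)" for x s t
  proof -
    have eq: "(0 < e \<and> (\<forall>j<n. \<bar>f s ! j - g t ! j\<bar> < e)) \<longleftrightarrow> sdist (f s) (g t) < e" for e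
      unfolding sdist_less_iff dmap_length[OF assms(1)] ..
    show ?thesis unfolding eq by (rule eq_iff_same_upper)
  qed
  ultimately have "dfn (\<lambda>v. v 0 = sdist (f (v (Suc 0))) (g (v (Suc (Suc 0)))))" by simp
  from dff_comp2[OF this assms(3,4)] show ?thesis .
qed

lemma hausdorff_le_iff:
  assumes f: "dmap n f" and g: "dmap n g" and P: "dfn1 P" "P p0" and Q: "dfn1 Q" "Q q0"
    and bound: "\<And>s t. P s \<Longrightarrow> Q t \<Longrightarrow> sdist (f s) (g t) \<le> u"
  shows "hausdorff_dist (f ` Collect P) (g ` Collect Q) \<le> e
    \<longleftrightarrow> (\<forall>e'>e. hclose (f ` Collect P) (g ` Collect Q) e')"
proof -
  have A: "{GREATEST s. \<forall>x\<in>{sdist x y |y. y \<in> g ` Collect Q}. s \<le> x |x. x \<in> f ` Collect P}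
    = {GREATEST r. \<forall>y\<in>{sdist (f p) (g t) |t. Q t}. r \<le> y |p. P p}"
  proof -
    have "{sdist x y |y. y \<in> g ` Collect Q} = {sdist x (g t) |t. Q t}" for x by auto
    then show ?thesis by auto
  qed
  have B: "{GREATEST s. \<forall>x\<in>{sdist x y |x. x \<in> f ` Collect P}. s \<le> x |y. y \<in> g ` Collect Q}
    = {GREATEST r. \<forall>y\<in>{sdist (f t) (g p) |t. P t}. r \<le> y |p. Q p}"
  proof -
    have "{sdist x y |x. x \<in> f ` Collect P} = {sdist (f t) y |t. P t}" for y by auto
    then show ?thesis by auto
  qed
  have d1: "dff (\<lambda>v. sdist (f (v 0)) (g (v (Suc 0))))" and d2: "dff (\<lambda>v. sdist (f (v (Suc 0))) (g (v 0)))"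
    by (rule dff_sdist[OF f g]; rule dff_var)+
  have "hausdorff_dist (f ` Collect P) (g ` Collect Q) \<le> e \<longleftrightarrow>
     (\<forall>e'>e. \<forall>p. P p \<longrightarrow> (\<exists>q. Q q \<and> sdist (f p) (g q) < e')) \<and>
     (\<forall>e'>e. \<forall>q. Q q \<longrightarrow> (\<exists>p. P p \<and> sdist (f p) (g q) < e'))"
    unfolding hausdorff_dist_def Let_def A B max.bounded_iff
    using sup_inf_le_iff[OF P Q d1, of u e] sup_inf_le_iff[OF Q P d2, of u e] bound by simp
  also have "\<dots> \<longleftrightarrow> (\<forall>e'>e. hclose (f ` Collect P) (g ` Collect Q) e')"
    unfolding hclose_def by auto
  finally show ?thesis .
qed

text \<open>Off the positive elements, where the sets may be empty, the value is set to zero.\<close>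

lemma dff_hausdorff:
  assumes f: "dmap n f" and g: "dmap n g"
    and P: "dfn (\<lambda>v. P (v 0) (v (Suc 0)))" and Q: "dfn (\<lambda>v. Q (v 0) (v (Suc 0)))"
    and ex: "\<And>t. 0 < t \<Longrightarrow> (\<exists>p. P t p) \<and> (\<exists>q. Q t q)"
    and bound: "\<And>t p q. P t p \<Longrightarrow> Q t q \<Longrightarrow> sdist (f p) (g q) \<le> u t"
  shows "dff1 (\<lambda>t. if 0 < t then hausdorff_dist (f ` Collect (P t)) (g ` Collect (Q t)) else 0)"
proof (rule dff_I)
  define D where "D t = hausdorff_dist (f ` Collect (P t)) (g ` Collect (Q t))" for t
  define H where "H t e \<longleftrightarrow> (\<forall>p. P t p \<longrightarrow> (\<exists>q. Q t q \<and> sdist (f p) (g q) < e)) \<and>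
     (\<forall>q. Q t q \<longrightarrow> (\<exists>p. P t p \<and> sdist (f p) (g q) < e))" for t e
  have H: "hclose (f ` Collect (P t)) (g ` Collect (Q t)) e = H t e" for t e
    unfolding hclose_def H_def by auto
  have Pt: "dfn1 (P t)" and Qt: "dfn1 (Q t)" for t
    by (rule dfn_comp2[OF P dff_const dff_var] dfn_comp2[OF Q dff_const dff_var])+
  have D: "D t \<le> e \<longleftrightarrow> (\<forall>e'>e. H t e')" if t: "0 < t" for t e
  proof -
    obtain p0 q0 where "P t p0" "Q t q0" using ex[OF t] by blast
    from hausdorff_le_iff[OF f g Pt this(1) Qt this(2) bound] show ?thesis by (simp add: H D_def)
  qed
  have "dfn (\<lambda>v. (0 < v (Suc 0) \<and> (\<forall>e. v 0 \<le> e \<longleftrightarrow> (\<forall>e'. e < e' \<longrightarrow> H (v (Suc 0)) e'))) \<or> (\<not> 0 < v (Suc 0) \<and> v 0 = 0))"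
    unfolding H_def by (intro dfn_intros dfn_comp2[OF P] dfn_comp2[OF Q] dff_sdist[OF f g])
  moreover have "(\<forall>e. x \<le> e \<longleftrightarrow> (\<forall>e'>e. H t e')) \<longleftrightarrow> x = D t" if "0 < t" for x t
    unfolding D[OF that, symmetric] by (metis order.antisym order.refl)
  then have "((0 < t \<and> (\<forall>e. x \<le> e \<longleftrightarrow> (\<forall>e'. e < e' \<longrightarrow> H t e'))) \<or> (\<not> 0 < t \<and> x = 0))
      \<longleftrightarrow> x = (if 0 < t then D t else 0)" for x t
    by auto
  ultimately show "dfn (\<lambda>v. v 0 = (if 0 < v (Suc 0) then D (v (Suc 0)) else 0))" by simp
qed

end

section \<open>Germs of curves\<close>

lemma sball_mono: "s \<le> t \<Longrightarrow> sball a s \<subseteq> sball a t"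
  unfolding sball_def by auto

lemma sball_Int_cong:
  assumes "sball a e \<inter> A = sball a e \<inter> B" "t \<le> e"
  shows "sball a t \<inter> A = sball a t \<inter> B"
  using assms sball_mono[of t e a] by blast

text \<open>This is \<open>curve_equiv\<close> for sets, so that a curve can also be compared with a
  set not parametrized by \<open>(0, 1)\<close>.\<close>

definition near_eq :: "'m::linordered_field list \<Rightarrow> 'm list set \<Rightarrow> 'm list set \<Rightarrow> bool" where
  "near_eq a A B \<longleftrightarrow> (\<exists>e>0. sball a e \<inter> A = sball a e \<inter> B)"

lemma near_eqI: "0 < e \<Longrightarrow> sball a e \<inter> A = sball a e \<inter> B \<Longrightarrow> near_eq a A B"
  unfolding near_eq_def by blast

lemma near_eqE:
  assumes "near_eq a A B"
  obtains e where "0 < e" "\<And>t. t \<le> e \<Longrightarrow> sball a t \<inter> A = sball a t \<inter> B"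
proof -
  obtain e where e: "0 < e" "sball a e \<inter> A = sball a e \<inter> B"
    using assms unfolding near_eq_def by auto
  then show thesis using that[OF e(1)] sball_Int_cong[OF e(2)] by blast
qed

lemma near_eq_refl [simp]: "near_eq a A A"
  by (rule near_eqI[of 1]) simp_all

lemma near_eq_sym: "near_eq a A B \<Longrightarrow> near_eq a B A"
  unfolding near_eq_def by metis

lemma near_eq_trans:
  assumes "near_eq a A B" "near_eq a B C"
  shows "near_eq a A C"
proof -
  obtain d where d: "0 < d" "\<And>t. t \<le> d \<Longrightarrow> sball a t \<inter> A = sball a t \<inter> B"
    using assms(1) by (rule near_eqE) blast
  obtain e where e: "0 < e" "\<And>t. t \<le> e \<Longrightarrow> sball a t \<inter> B = sball a t \<inter> C"
    using assms(2) by (rule near_eqE) blast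
  show ?thesis by (rule near_eqI[of "min d e"]) (simp_all add: d e)
qed

lemma near_eq_ev: "near_eq a A B \<Longrightarrow> ev (\<lambda>t. sball a t \<inter> A = sball a t \<inter> B)"
  unfolding near_eq_def ev_def by (meson less_imp_le sball_Int_cong)

lemma curve_equiv_iff: "curve_equiv a \<gamma> \<sigma> \<longleftrightarrow> near_eq a (\<gamma> ` {0<..<1}) (\<sigma> ` {0<..<1})"
  unfolding curve_equiv_def near_eq_def ..

context ominimal_field
begin

section \<open>Shrunk curves and their equivalence classes\<close>

lemma dmap_scale:
  assumes "dmap n f"
  shows "dmap n (\<lambda>t. f (c * t))"
proof (rule dmapI)
  show "dff1 (\<lambda>t. f (c * t) ! j)" if "j < n" for j
    by (rule dff_comp1[OF dmap_nth[OF assms that]]) (intro dfn_intros)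
qed (rule dmap_length[OF assms])

lemma dmap_imp_definable_map:
  assumes "dmap n f" "dfn1 (\<lambda>t. t \<in> A)" "\<And>t. t \<in> A \<Longrightarrow> g t = f t"
  shows "definable_map L M A n g"
proof (rule definable_mapI[where F = "\<lambda>j t. f t ! j"])
  show "dff (\<lambda>v. f (v 0) ! j)" if "j < n" for j by (rule dmap_nth[OF assms(1) that])
qed (simp_all add: assms(2,3) dmap_length[OF assms(1)])

lemma dfn_interval: "dfn1 (\<lambda>t. t \<in> {b<..<c})"
  unfolding greaterThanLessThan_iff by (intro dfn_intros)

definition extend :: "nat \<Rightarrow> ('m \<Rightarrow> 'm list) \<Rightarrow> 'm \<Rightarrow> 'm list" where
  "extend n f t = (if t \<in> {0<..<1} then f t else replicate n 0)"

lemma extend_eq [simp]: "0 < t \<Longrightarrow> t < 1 \<Longrightarrow> extend n f t = f t"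
  by (simp add: extend_def)

lemma dmap_extend:
  assumes "definable_map L M {0<..<1} n f"
  shows "dmap n (extend n f)"
proof -
  have len: "length (f t) = n" if "t \<in> {0<..<1}" for t
    using assms that unfolding definable_map_def by blast
  have "dff1 (\<lambda>t. extend n f t ! j)" if "j < n" for j
  proof -
    have *: "(\<lambda>v. extend n f (v 0) ! j) = (\<lambda>v. if v 0 \<in> {0<..<1} then f (v 0) ! j else 0)"
      using that by (auto simp: extend_def)
    show ?thesis by (rule iffD2[OF arg_cong[OF *, of dff] definable_map_component[OF assms that]])
  qed
  then show ?thesis by (rule dmapI[rotated]) (auto simp: extend_def len)
qed

lemma extend_image: "extend n f ` {0<..<1} = f ` {0<..<1}"
  by (rule image_cong) auto

lemma definable_curvesD:
  assumes "\<gamma> \<in> definable_curves L M a"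
  shows "dmap (length a) (extend (length a) \<gamma>)" "\<And>t. t \<in> {0<..<1} \<Longrightarrow> length (\<gamma> t) = length a"
    "tends_at_zero \<gamma> a"
  using assms dmap_extend unfolding definable_curves_def curve_at_def by auto

lemma definable_curves_scale:
  assumes \<gamma>: "\<gamma> \<in> definable_curves L M a" and c: "0 < c" "c \<le> 1"
  shows "(\<lambda>t. \<gamma> (c * t)) \<in> definable_curves L M a"
proof -
  have ct: "0 < c * t \<and> c * t \<le> t" if "0 < t" for t
    using c that by (simp add: mult_left_le_one_le)
  have in01: "c * t \<in> {0<..<1}" if "t \<in> {0<..<1}" for t
    using ct[of t] that by (meson greaterThanLessThan_iff le_less_trans)
  have "curve_at a (\<lambda>t. \<gamma> (c * t))"
    unfolding curve_at_def
  proof (intro conjI ballI allI impI)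
    show "length (\<gamma> (c * t)) = length a" if "t \<in> {0<..<1}" for t
      using definable_curvesD(2)[OF \<gamma> in01[OF that]] .
    show "tends_at_zero (\<lambda>t. \<gamma> (c * t)) a"
      unfolding tends_at_zero_def
    proof (intro allI impI)
      fix e :: 'm assume "0 < e"
      then obtain d where d: "0 < d" "\<forall>t. 0 < t \<and> t < d \<longrightarrow> sdist (\<gamma> t) a < e"
        using definable_curvesD(3)[OF \<gamma>] unfolding tends_at_zero_def by blast
      show "\<exists>\<delta>>0. \<forall>t. 0 < t \<and> t < \<delta> \<longrightarrow> sdist (\<gamma> (c * t)) a < e"
      proof (intro exI[of _ d] conjI allI impI)
        fix t assume "0 < t \<and> t < d"
        then show "sdist (\<gamma> (c * t)) a < e" using ct[of t] d(2) by (meson le_less_trans)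
      qed (rule d(1))
    qed
    fix t e :: 'm assume t: "t \<in> {0<..<1}" and "0 < e"
    then obtain d where d: "0 < d" "\<forall>s\<in>{0<..<1}. \<bar>s - c * t\<bar> < d \<longrightarrow> sdist (\<gamma> s) (\<gamma> (c * t)) < e"
      using \<gamma> in01[OF t] unfolding definable_curves_def curve_at_def by blast
    show "\<exists>\<delta>>0. \<forall>s\<in>{0<..<1}. \<bar>s - t\<bar> < \<delta> \<longrightarrow> sdist (\<gamma> (c * s)) (\<gamma> (c * t)) < e"
    proof (intro exI[of _ d] conjI ballI impI)
      fix s assume s: "s \<in> {0<..<1}" "\<bar>s - t\<bar> < d"
      have "\<bar>c * s - c * t\<bar> = c * \<bar>s - t\<bar>" using c by (simp add: abs_mult flip: right_diff_distrib)
      also have "\<dots> \<le> \<bar>s - t\<bar>" using c by (simp add: mult_left_le_one_le)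
      finally have "\<bar>c * s - c * t\<bar> < d" using s(2) by simp
      then show "sdist (\<gamma> (c * s)) (\<gamma> (c * t)) < e" using d(2) in01[OF s(1)] by blast
    qed (rule d(1))
  qed
  moreover have "definable_map L M {0<..<1} (length a) (\<lambda>t. \<gamma> (c * t))"
    by (rule dmap_imp_definable_map[OF dmap_scale[OF definable_curvesD(1)[OF \<gamma>], of c] dfn_interval])
       (use in01 in auto)
  ultimately show ?thesis unfolding definable_curves_def by blast
qed

text \<open>Near zero the distance to \<open>a\<close> is strictly monotone or constant. If it does
  not increase, each value is a lower bound of the earlier ones, which tend to zero, so the curve
  rests at \<open>a\<close>.\<close>

lemma exists_shrunk:
  assumes \<gamma>: "\<gamma> \<in> definable_curves L M a"
  shows "\<exists>c. 0 < c \<and> c \<le> 1 \<and> (\<lambda>t. \<gamma> (c * t)) \<in> shrunk_curves L M a"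
proof -
  define f where "f t = sdist (extend (length a) \<gamma> t) a" for t
  have "dff1 f"
    unfolding f_def using dff_sdist[OF definable_curvesD(1)[OF \<gamma>] dmap_const dff_var dff_var[of 0]] .
  then obtain \<epsilon> where "0 < \<epsilon>" and mono: "strictly_monotone_on {0<..<\<epsilon>} f"
    using ev_strictly_monotone by blast
  obtain R where R: "R \<in> {(<), (=), (>)}" "\<And>x y. x \<in> {0<..<\<epsilon>} \<Longrightarrow> y \<in> {0<..<\<epsilon>} \<Longrightarrow> x < y \<Longrightarrow> R (f x) (f y)"
    using strictly_monotone_onE[OF mono] by blast
  define c where "c = min \<epsilon> 1"
  have c: "0 < c" "c \<le> 1" "c \<le> \<epsilon>" using \<open>0 < \<epsilon>\<close> by (auto simp: c_def)
  have f_eq: "f t = sdist (\<gamma> t) a" if "0 < t" "t < c" for t using that c by (simp add: f_def)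
  have small: "\<exists>d>0. \<forall>t. 0 < t \<and> t < d \<longrightarrow> sdist (\<gamma> t) a < e" if "0 < e" for e
    using definable_curvesD(3)[OF \<gamma>] that unfolding tends_at_zero_def by blast
  have fR: "R (f x) (f y)" if "0 < x" "x < y" "y < c" for x y using R(2)[of x y] that c by auto
  have no: "\<not> (\<forall>t. 0 < t \<and> t < y \<longrightarrow> f y \<le> f t)" if y: "0 < y" "y < c" "0 < f y" for y
  proof
    assume *: "\<forall>t. 0 < t \<and> t < y \<longrightarrow> f y \<le> f t"
    obtain d where d: "0 < d" "\<forall>t. 0 < t \<and> t < d \<longrightarrow> sdist (\<gamma> t) a < f y" using small[OF y(3)] by blast
    obtain t where "0 < t" "t < min d y" using dense[of 0 "min d y"] d y by auto
    with * d(2) f_eq[of t] y show False by force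
  qed
  have scaled: "0 < c * t" "c * t < c" if "t \<in> {0<..<1}" for t using that c by auto
  have "(\<forall>t\<in>{0<..<1}. \<gamma> (c * t) = a) \<or> strict_mono_on {0<..<1} (\<lambda>t. sdist (\<gamma> (c * t)) a)"
  proof (cases "R = (<)")
    case True
    have "strict_mono_on {0<..<1} (\<lambda>t. sdist (\<gamma> (c * t)) a)"
    proof (intro strict_mono_onI)
      fix r s :: 'm assume rs: "r \<in> {0<..<1}" "s \<in> {0<..<1}" "r < s"
      then have "f (c * r) < f (c * s)" using fR[of "c * r" "c * s"] True scaled c by auto
      then show "sdist (\<gamma> (c * r)) a < sdist (\<gamma> (c * s)) a" using f_eq scaled rs by auto
    qed
    then show ?thesis ..
  next
    case False
    have "\<gamma> (c * t) = a" if "t \<in> {0<..<1}" for t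
    proof -
      have ct: "0 < c * t" "c * t < c" by (rule scaled[OF that])+
      have "f (c * t) \<le> f s" if "0 < s" "s < c * t" for s
        using fR[OF that ct(2)] R(1) False by auto
      then have "\<not> 0 < f (c * t)" using no[OF ct] by blast
      then have "sdist (\<gamma> (c * t)) a = 0" using f_eq[OF ct] by (simp add: order.strict_iff_order)
      moreover have "c * t \<in> {0<..<1}" using ct c(2) by (meson greaterThanLessThan_iff less_le_trans)
      then have "length (\<gamma> (c * t)) = length a" by (rule definable_curvesD(2)[OF \<gamma>])
      ultimately show ?thesis by (simp add: sdist_eq_0_iff)
    qed
    then show ?thesis by blast
  qed
  then have "(\<lambda>t. \<gamma> (c * t)) \<in> shrunk_curves L M a"
    using definable_curves_scale[OF \<gamma> c(1,2)] unfolding shrunk_curves_def by blast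
  with c show ?thesis by blast
qed

text \<open>As the distance to \<open>a\<close> increases along a nonconstant shrunk curve, a small
  ball meets an initial segment only, and cutting off the rest leaves the germ unchanged.\<close>

lemma shrunk_equiv_scale:
  assumes \<rho>: "\<rho> \<in> shrunk_curves L M a" and b: "0 < b" "b \<le> 1"
  shows "curve_equiv a \<rho> (\<lambda>t. \<rho> (b * t))"
proof -
  have sc: "b * t \<in> {0<..<1}" if "t \<in> {0<..<1}" for t
  proof -
    have "b * t \<le> t" using that b by (simp add: mult_left_le_one_le)
    then show ?thesis using that b by (meson greaterThanLessThan_iff le_less_trans mult_pos_pos)
  qed
  from \<rho> consider (const) "\<forall>t\<in>{0<..<1}. \<rho> t = a" | (inc) "strict_mono_on {0<..<1} (\<lambda>t. sdist (\<rho> t) a)"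
    unfolding shrunk_curves_def by blast
  then show ?thesis
  proof cases
    case const
    then have "\<rho> ` {0<..<1} = (\<lambda>t. \<rho> (b * t)) ` {0<..<1}" using sc by (intro image_cong) auto
    then show ?thesis unfolding curve_equiv_iff by simp
  next
    case inc
    have len: "length (\<rho> t) = length a" if "t \<in> {0<..<1}" for t
      using \<rho> definable_curvesD(2) that unfolding shrunk_curves_def by blast
    \<comment> \<open>The point \<open>b / 2\<close> replaces \<open>b\<close>, which may be 1 and
      then lies outside the domain; \<open>b / 4\<close> shows that \<open>e\<close> is
      positive.\<close>
    define e where "e = sdist (\<rho> (b / 2)) a"
    have b2: "b / 2 \<in> {0<..<1}" "b / 4 \<in> {0<..<1}" using b by auto
    have "sdist (\<rho> (b / 4)) a < e" unfolding e_def using strict_mono_onD[OF inc b2(2,1)] b by simp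
    then have "0 < e" using sdist_nonneg le_less_trans by blast
    moreover have "sball a e \<inter> \<rho> ` {0<..<1} = sball a e \<inter> (\<lambda>t. \<rho> (b * t)) ` {0<..<1}"
    proof
      show "sball a e \<inter> (\<lambda>t. \<rho> (b * t)) ` {0<..<1} \<subseteq> sball a e \<inter> \<rho> ` {0<..<1}" using sc by auto
      show "sball a e \<inter> \<rho> ` {0<..<1} \<subseteq> sball a e \<inter> (\<lambda>t. \<rho> (b * t)) ` {0<..<1}"
      proof
        fix x assume "x \<in> sball a e \<inter> \<rho> ` {0<..<1}"
        then obtain t where t: "t \<in> {0<..<1}" "x = \<rho> t" "sdist a x < e" "x \<in> sball a e" unfolding sball_def by auto
        then have "sdist (\<rho> t) a < e" using sdist_commute[OF len] by simp
        then have "\<not> b / 2 < t" using strict_mono_onD[OF inc b2(1) t(1)] by (auto simp: e_def)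
        moreover have "b / 2 < b" using b by simp
        ultimately have "t < b" by (meson le_less_trans not_less)
        then have "t / b \<in> {0<..<1}" "x = \<rho> (b * (t / b))" using t b by auto
        then show "x \<in> sball a e \<inter> (\<lambda>t. \<rho> (b * t)) ` {0<..<1}" using t(4) by blast
      qed
    qed
    ultimately show ?thesis unfolding curve_equiv_iff by (rule near_eqI)
  qed
qed

definition curve_class :: "'m list \<Rightarrow> ('m \<Rightarrow> 'm list) \<Rightarrow> ('m \<Rightarrow> 'm list) set" where
  "curve_class a \<rho> = {\<sigma> \<in> shrunk_curves L M a. curve_equiv a \<rho> \<sigma>}"

text \<open>Independence of the shrinking factor: of two admissible restrictions, the smaller is a
  rescaling of the larger.\<close>

lemma curve_germ_eq:
  assumes c: "0 < c" "c \<le> 1" "(\<lambda>t. \<gamma> (c * t)) \<in> shrunk_curves L M a"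
  shows "curve_germ L M a \<gamma> = curve_class a (\<lambda>t. \<gamma> (c * t))"
proof -
  have smaller: "curve_equiv a (\<lambda>t. \<gamma> (d * t)) (\<lambda>t. \<gamma> (b * t))"
    if "0 < b" "b \<le> d" "(\<lambda>t. \<gamma> (d * t)) \<in> shrunk_curves L M a" for b d
  proof -
    have "curve_equiv a (\<lambda>t. \<gamma> (d * t)) (\<lambda>t. \<gamma> (d * (b / d * t)))"
      using shrunk_equiv_scale[OF that(3), of "b / d"] that by simp
    then show ?thesis using that by (simp add: mult.assoc[symmetric])
  qed
  have "curve_equiv a (\<lambda>t. \<gamma> (d * t)) (\<lambda>t. \<gamma> (c * t))"
    if "0 < d" "(\<lambda>t. \<gamma> (d * t)) \<in> shrunk_curves L M a" for d
    using smaller[of c d] smaller[of d c] that c near_eq_sym unfolding curve_equiv_iff by (cases "c \<le> d") auto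
  then show ?thesis
    unfolding curve_germ_def curve_class_def curve_equiv_iff using c near_eq_trans near_eq_sym by blast
qed

lemma curve_class_self: "\<rho> \<in> shrunk_curves L M a \<Longrightarrow> \<rho> \<in> curve_class a \<rho>"
  by (simp add: curve_class_def curve_equiv_iff)

lemma curve_germ_shrunk: "\<rho> \<in> shrunk_curves L M a \<Longrightarrow> curve_germ L M a \<rho> = curve_class a \<rho>"
  using curve_germ_eq[of 1 \<rho> a] by simp

lemma curve_germs_eq: "curve_germs L M a = curve_class a ` shrunk_curves L M a"
proof
  show "curve_germs L M a \<subseteq> curve_class a ` shrunk_curves L M a"
    unfolding curve_germs_def using exists_shrunk curve_germ_eq by fast
  show "curve_class a ` shrunk_curves L M a \<subseteq> curve_germs L M a"
  proof
    fix g assume "g \<in> curve_class a ` shrunk_curves L M a"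
    then obtain \<rho> where "\<rho> \<in> shrunk_curves L M a" "g = curve_class a \<rho>" by blast
    moreover from this have "\<rho> \<in> definable_curves L M a" by (simp add: shrunk_curves_def)
    ultimately show "g \<in> curve_germs L M a"
      unfolding curve_germs_def using curve_germ_shrunk by blast
  qed
qed

section \<open>The Hausdorff metric on curve germs\<close>

definition locally_parametrizes :: "'m list \<Rightarrow> ('m \<Rightarrow> 'm list) set \<Rightarrow> 'm list set \<Rightarrow> bool" where
  "locally_parametrizes a g A \<longleftrightarrow>
     g \<noteq> {} \<and> (\<forall>\<gamma>\<in>g. near_eq a (\<gamma> ` {0<..<1}) A)"

text \<open>Sets that agree near \<open>a\<close> have the same part in all small balls. So the
  distance germ may be computed from any convenient reference set, such as one curve of the class or
  a whole arc.\<close>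

lemma germ_dist_eq:
  assumes "locally_parametrizes a g A" "locally_parametrizes a h B"
  shows "germ_dist L M a g h = gm (\<lambda>t. hausdorff_dist (sball a t \<inter> A) (sball a t \<inter> B))"
proof -
  have "gm (\<lambda>t. hausdorff_dist (sball a t \<inter> \<gamma> ` {0<..<1}) (sball a t \<inter> \<sigma> ` {0<..<1}))
     = gm (\<lambda>t. hausdorff_dist (sball a t \<inter> A) (sball a t \<inter> B))" if \<gamma>: "\<gamma> \<in> g" and \<sigma>: "\<sigma> \<in> h" for \<gamma> \<sigma>
  proof (rule gm_cong)
    have "ev (\<lambda>t. sball a t \<inter> \<gamma> ` {0<..<1} = sball a t \<inter> A)" "ev (\<lambda>t. sball a t \<inter> \<sigma> ` {0<..<1} = sball a t \<inter> B)"
      using assms \<gamma> \<sigma> unfolding locally_parametrizes_def by (auto intro: near_eq_ev)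
    then show "ev (\<lambda>t. hausdorff_dist (sball a t \<inter> \<gamma> ` {0<..<1}) (sball a t \<inter> \<sigma> ` {0<..<1})
       = hausdorff_dist (sball a t \<inter> A) (sball a t \<inter> B))"
      by (rule ev_mono2) simp
  qed
  moreover have "g \<noteq> {}" "h \<noteq> {}" using assms unfolding locally_parametrizes_def by blast+
  ultimately show ?thesis unfolding germ_dist_def by simp
qed

text \<open>The common form of an extended curve on \<open>(0, 1)\<close> and of \<open>pt U\<close>
  on the positive elements. The last clause keeps the part in every ball nonempty, without which the
  infimum and supremum in \<open>hausdorff_dist\<close> are undefined.\<close>

definition branch :: "'m list \<Rightarrow> ('m \<Rightarrow> 'm list) \<Rightarrow> ('m \<Rightarrow> bool) \<Rightarrow> bool" where
  "branch a f P \<longleftrightarrow> dmap (length a) f \<and> dfn1 P \<and> (\<forall>t>0. \<exists>p. P p \<and> sdist a (f p) < t)"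

definition ndist :: "'m list \<Rightarrow> 'm list set \<Rightarrow> 'm list set \<Rightarrow> 'm \<Rightarrow> 'm" where
  "ndist a A B t = (if 0 < t then hausdorff_dist (sball a t \<inter> A) (sball a t \<inter> B) else 0)"

lemma sball_Int_branch:
  assumes "branch a f P"
  shows "sball a t \<inter> f ` Collect P = f ` {p. P p \<and> sdist a (f p) < t}"
  using assms unfolding branch_def sball_def by auto

lemma
  assumes f: "branch a f P" and g: "branch a g Q"
  shows dff_ndist: "dff1 (ndist a (f ` Collect P) (g ` Collect Q))"
    and ndist_le_iff: "0 < t \<Longrightarrow> ndist a (f ` Collect P) (g ` Collect Q) t \<le> e
      \<longleftrightarrow> (\<forall>e'>e. hclose (sball a t \<inter> f ` Collect P) (sball a t \<inter> g ` Collect Q) e')"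
proof -
  have fg: "dmap (length a) f" "dmap (length a) g" "dfn1 P" "dfn1 Q"
    using f g unfolding branch_def by auto
  define P' where "P' t p \<longleftrightarrow> P p \<and> sdist a (f p) < t" for t p
  define Q' where "Q' t q \<longleftrightarrow> Q q \<and> sdist a (g q) < t" for t q
  have P'd: "dfn (\<lambda>v. P' (v 0) (v (Suc 0)))" and Q'd: "dfn (\<lambda>v. Q' (v 0) (v (Suc 0)))"
    unfolding P'_def Q'_def
    by (intro dfn_conj dfn_less dff_var dfn_comp1[OF fg(3)] dfn_comp1[OF fg(4)]
        dff_sdist[OF dmap_const fg(1) dff_var[of 0] dff_var] dff_sdist[OF dmap_const fg(2) dff_var[of 0] dff_var])+
  have bound: "sdist (f p) (g q) \<le> t + t" if "P' t p" "Q' t q" for t p q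
  proof -
    have "sdist (f p) (g q) \<le> sdist (f p) a + sdist a (g q)"
      using fg by (intro sdist_triangle) simp
    also have "sdist (f p) a = sdist a (f p)" using fg by (intro sdist_commute) simp
    finally show ?thesis using that unfolding P'_def Q'_def by simp
  qed
  have ex: "(\<exists>p. P' t p) \<and> (\<exists>q. Q' t q)" if "0 < t" for t
    using f g that unfolding branch_def P'_def Q'_def by blast
  have nd: "ndist a (f ` Collect P) (g ` Collect Q) =
      (\<lambda>t. if 0 < t then hausdorff_dist (f ` Collect (P' t)) (g ` Collect (Q' t)) else 0)"
    unfolding ndist_def[abs_def] sball_Int_branch[OF f] sball_Int_branch[OF g] P'_def Q'_def ..
  show "dff1 (ndist a (f ` Collect P) (g ` Collect Q))"
    unfolding nd by (rule dff_hausdorff[OF fg(1,2) P'd Q'd ex bound])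
  assume "0 < t"
  then obtain p q where pq: "P' t p" "Q' t q" using ex by blast
  have "dfn1 (P' t)" "dfn1 (Q' t)"
    by (rule dfn_comp2[OF P'd dff_const dff_var] dfn_comp2[OF Q'd dff_const dff_var])+
  from hausdorff_le_iff[OF fg(1,2) this(1) pq(1) this(2) pq(2) bound[of t], of e]
  show "ndist a (f ` Collect P) (g ` Collect Q) t \<le> e
      \<longleftrightarrow> (\<forall>e'>e. hclose (sball a t \<inter> f ` Collect P) (sball a t \<inter> g ` Collect Q) e')"
    using \<open>0 < t\<close> unfolding nd sball_Int_branch[OF f] sball_Int_branch[OF g] P'_def[symmetric] Q'_def[symmetric] by simp
qed

lemma gm_hausdorff_eq_ndist: "gm (\<lambda>t. hausdorff_dist (sball a t \<inter> A) (sball a t \<inter> B)) = gm (ndist a A B)"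
  by (rule gm_cong, rule ev_mono[OF ev_pos]) (simp add: ndist_def)

lemma ndist_self:
  assumes "branch a f P" "0 < t"
  shows "ndist a (f ` Collect P) (f ` Collect P) t = 0"
proof (rule order.antisym)
  have "hclose A A e" if "0 < e" for e :: 'm and A
    unfolding hclose_def using that by (metis sdist_self)
  then show "ndist a (f ` Collect P) (f ` Collect P) t \<le> 0"
    using ndist_le_iff[OF assms(1,1,2)] by blast
  show "0 \<le> ndist a (f ` Collect P) (f ` Collect P) t"
  proof (rule ccontr)
    assume "\<not> 0 \<le> ndist a (f ` Collect P) (f ` Collect P) t"
    then have "hclose (sball a t \<inter> f ` Collect P) (sball a t \<inter> f ` Collect P) 0"
      using ndist_le_iff[OF assms(1,1,2), of "ndist a (f ` Collect P) (f ` Collect P) t"] by auto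
    moreover obtain p where "P p" "sdist a (f p) < t" using assms unfolding branch_def by blast
    ultimately obtain y where "sdist (f p) y < 0"
      unfolding sball_Int_branch[OF assms(1)] hclose_def by blast
    then show False using sdist_nonneg[of "f p" y] by simp
  qed
qed

lemma ndist_triangle:
  assumes f: "branch a f P" and g: "branch a g Q" and h: "branch a h R" and t: "0 < t"
  shows "ndist a (f ` Collect P) (h ` Collect R) t
    \<le> ndist a (f ` Collect P) (g ` Collect Q) t + ndist a (g ` Collect Q) (h ` Collect R) t"
    (is "_ \<le> ?d + ?e")
  unfolding ndist_le_iff[OF f h t]
proof (intro allI impI)
  fix r assume "?d + ?e < r"
  \<comment> \<open>\<open>hclose\<close> is available only strictly above the two distances, so the
    excess of \<open>r\<close> is shared between them.\<close>
  define \<delta> where "\<delta> = (r - (?d + ?e)) / 2"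
  have \<delta>: "0 < \<delta>" "(?d + \<delta>) + (?e + \<delta>) = r" using \<open>?d + ?e < r\<close> by (auto simp: \<delta>_def field_simps)
  have "hclose (sball a t \<inter> f ` Collect P) (sball a t \<inter> g ` Collect Q) (?d + \<delta>)"
    "hclose (sball a t \<inter> g ` Collect Q) (sball a t \<inter> h ` Collect R) (?e + \<delta>)"
    using ndist_le_iff[OF f g t, of ?d] ndist_le_iff[OF g h t, of ?e] \<delta>(1) by auto
  from hclose_triangle[OF _ this] show "hclose (sball a t \<inter> f ` Collect P) (sball a t \<inter> h ` Collect R) r"
    unfolding \<delta>(2) sball_def by simp
qed

lemma branch_extend:
  assumes \<gamma>: "\<gamma> \<in> definable_curves L M a"
  shows "branch a (extend (length a) \<gamma>) (\<lambda>t. 0 < t \<and> t < 1)"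
  unfolding branch_def
proof (intro conjI allI impI)
  show "dmap (length a) (extend (length a) \<gamma>)" by (rule definable_curvesD[OF \<gamma>])
  show "dfn1 (\<lambda>t. 0 < t \<and> t < 1)" by (intro dfn_intros)
  fix e :: 'm assume "0 < e"
  then obtain d where d: "0 < d" "\<forall>t. 0 < t \<and> t < d \<longrightarrow> sdist (\<gamma> t) a < e"
    using definable_curvesD(3)[OF \<gamma>] unfolding tends_at_zero_def by blast
  obtain t where t: "0 < t" "t < min d 1" using dense[of 0 "min d 1"] d by auto
  then have "sdist (\<gamma> t) a < e" using d by simp
  then have "sdist a (\<gamma> t) < e" using definable_curvesD(2)[OF \<gamma>, of t] t by (simp add: sdist_commute)
  then show "\<exists>p. (0 < p \<and> p < 1) \<and> sdist a (extend (length a) \<gamma> p) < e" using t by (intro exI[of _ t]) auto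
qed

lemma locally_parametrizes_class:
  assumes "\<rho> \<in> shrunk_curves L M a"
  shows "locally_parametrizes a (curve_class a \<rho>) (extend (length a) \<rho> ` {t. 0 < t \<and> t < 1})"
proof -
  have "extend (length a) \<rho> ` {t. 0 < t \<and> t < 1} = \<rho> ` {0<..<1}"
    using extend_image[of "length a" \<rho>] by (simp add: greaterThanLessThan_eq greaterThan_def lessThan_def Collect_conj_eq)
  then show ?thesis
    using curve_class_self[OF assms]
    unfolding locally_parametrizes_def curve_class_def curve_equiv_iff by (auto intro: near_eq_sym)
qed

lemma K_metric_curve_germs: "K_metric (curve_germs L M a) (germ_dist L M a)"
proof -
  have "\<forall>g\<in>curve_germs L M a. \<exists>\<rho>. \<rho> \<in> shrunk_curves L M a \<and> g = curve_class a \<rho>"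
    unfolding curve_germs_eq by blast
  then obtain R where R: "\<And>g. g \<in> curve_germs L M a \<Longrightarrow> R g \<in> shrunk_curves L M a"
    "\<And>g. g \<in> curve_germs L M a \<Longrightarrow> g = curve_class a (R g)"
    by metis
  define A where "A g = extend (length a) (R g) ` {t. 0 < t \<and> t < 1}" for g
  have br: "branch a (extend (length a) (R g)) (\<lambda>t. 0 < t \<and> t < 1)" if "g \<in> curve_germs L M a" for g
    using R(1)[OF that] by (intro branch_extend) (simp add: shrunk_curves_def)
  have lp: "locally_parametrizes a g (A g)" if "g \<in> curve_germs L M a" for g
    using locally_parametrizes_class[OF R(1)[OF that]] R(2)[OF that] unfolding A_def by simp
  show ?thesis
    unfolding K_metric_def
  proof (intro exI[of _ "\<lambda>g h. ndist a (A g) (A h)"] ballI conjI)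
    fix g h k assume g: "g \<in> curve_germs L M a" and h: "h \<in> curve_germs L M a"
    show "germ_dist L M a g h = gm (ndist a (A g) (A h))"
      using germ_dist_eq[OF lp[OF g] lp[OF h]] unfolding gm_hausdorff_eq_ndist .
    show "dff1 (ndist a (A g) (A h))" unfolding A_def by (rule dff_ndist[OF br[OF g] br[OF h]])
    show "ev (\<lambda>t. ndist a (A g) (A g) t = 0)"
      using ev_pos unfolding A_def by (rule ev_mono) (erule ndist_self[OF br[OF g]])
    assume k: "k \<in> curve_germs L M a"
    show "ev (\<lambda>t. ndist a (A g) (A k) t \<le> ndist a (A g) (A h) t + ndist a (A h) (A k) t)"
      using ev_pos unfolding A_def
      by (rule ev_mono) (erule ndist_triangle[OF br[OF g] br[OF h] br[OF k]])
  qed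
qed

end

section \<open>Normalized curves\<close>

text \<open>The increasing enumeration of the positions other than \<open>i - 1\<close>; it is the
  index map of \<open>del\<close> and \<open>ins\<close>.\<close>

definition skip :: "nat \<Rightarrow> nat \<Rightarrow> nat" where
  "skip i j = (if j < i - 1 then j else Suc j)"

lemma skip_less: "1 \<le> i \<Longrightarrow> i \<le> k \<Longrightarrow> j < k - 1 \<Longrightarrow> skip i j < k"
  by (auto simp: skip_def)

lemma all_less_skip:
  assumes "1 \<le> i" "i \<le> k"
  shows "(\<forall>m<k. Q m) \<longleftrightarrow> Q (i - 1) \<and> (\<forall>j<k - 1. Q (skip i j))"
proof
  assume "\<forall>m<k. Q m"
  then show "Q (i - 1) \<and> (\<forall>j<k - 1. Q (skip i j))" using assms skip_less by auto
next
  assume *: "Q (i - 1) \<and> (\<forall>j<k - 1. Q (skip i j))"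
  show "\<forall>m<k. Q m"
  proof (intro allI impI)
    fix m assume "m < k"
    consider "m = i - 1" | "m < i - 1" | "i - 1 < m" by linarith
    then show "Q m"
    proof cases
      case 2
      then have "m < k - 1" "skip i m = m" using assms by (simp_all add: skip_def)
      with * show ?thesis by metis
    next
      case 3
      then have "m - 1 < k - 1" "skip i (m - 1) = m" using \<open>m < k\<close> by (simp_all add: skip_def)
      with * show ?thesis by metis
    qed (use * in simp)
  qed
qed

lemma length_ins: "1 \<le> i \<Longrightarrow> i - 1 \<le> length u \<Longrightarrow> length (ins i u y) = Suc (length u)"
  by (simp add: ins_def)

lemma ins_nth_same: "1 \<le> i \<Longrightarrow> i - 1 \<le> length u \<Longrightarrow> ins i u y ! (i - 1) = y"
  by (simp add: ins_def nth_append)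

lemma ins_nth_skip: "1 \<le> i \<Longrightarrow> i - 1 \<le> length u \<Longrightarrow> j < length u \<Longrightarrow> ins i u y ! skip i j = u ! j"
proof (cases "j < i - 1")
  case False
  assume *: "1 \<le> i" "i - 1 \<le> length u" "j < length u"
  have "Suc j - (i - 1) = Suc (j - (i - 1))" using False by simp
  then have "(take (i - 1) u @ y # drop (i - 1) u) ! Suc j = drop (i - 1) u ! (j - (i - 1))"
    using * False by (simp only: nth_append length_take) simp
  also have "\<dots> = u ! j" using * False by simp
  finally show ?thesis using False by (simp add: ins_def skip_def)
qed (simp add: ins_def nth_append skip_def)

lemma del_nth: "1 \<le> i \<Longrightarrow> i \<le> length a \<Longrightarrow> j < length a - 1 \<Longrightarrow> del i a ! j = a ! skip i j"
  by (auto simp: del_def nth_append skip_def)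

text \<open>Both half-spaces are treated at once: \<open>sg\<close> enters through being its own
  inverse and preserving absolute values.\<close>

locale curve_space = ominimal_field L M
  for L :: "('f, 'r) language" and M :: "('f, 'r, 'm::linordered_field) struct" +
  fixes a :: "'m list" and i :: nat and sg :: 'm
  assumes i: "1 \<le> i" "i \<le> length a" and sg: "sg = 1 \<or> sg = - 1"
begin

abbreviation n :: nat where
  "n \<equiv> length a - 1"

lemma sg_sg [simp]: "sg * sg = 1" "sg * (sg * x) = x"
  using sg by auto

lemma abs_sg_mult [simp]: "\<bar>sg * x\<bar> = \<bar>x\<bar>"
  using sg by auto

text \<open>In these coordinates the parameter is the distance in direction \<open>i\<close>, and
  distances between points depend neither on \<open>a\<close> nor on the side.\<close>

definition pt :: "(nat \<Rightarrow> 'm \<Rightarrow> 'm) \<Rightarrow> 'm \<Rightarrow> 'm list" where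
  "pt U s = ins i (map (\<lambda>j. del i a ! j + U j s) [0..<n]) (a ! (i - 1) + sg * s)"

lemma i_le: "i - 1 \<le> n" and Suc_n: "Suc n = length a"
  using i by auto

lemma length_pt [simp]: "length (pt U s) = length a"
  unfolding pt_def using i i_le Suc_n by (subst length_ins) auto

lemma pt_nth: "pt U s ! (i - 1) = a ! (i - 1) + sg * s"
  "j < n \<Longrightarrow> pt U s ! skip i j = a ! skip i j + U j s"
proof -
  show "pt U s ! (i - 1) = a ! (i - 1) + sg * s"
    unfolding pt_def using i i_le by (intro ins_nth_same) auto
  assume "j < n"
  then show "pt U s ! skip i j = a ! skip i j + U j s"
    unfolding pt_def using i i_le by (subst ins_nth_skip) (auto simp: del_nth)
qed

lemma eq_pt_iff:
  assumes "length x = length a"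
  shows "x = pt U s \<longleftrightarrow> x ! (i - 1) = a ! (i - 1) + sg * s \<and> (\<forall>j<n. x ! skip i j = a ! skip i j + U j s)"
proof -
  have "x = pt U s \<longleftrightarrow> (\<forall>m<length a. x ! m = pt U s ! m)" using assms by (simp add: list_eq_iff_nth_eq)
  then show ?thesis unfolding all_less_skip[OF i] using pt_nth by auto
qed

lemma sdist_pt_less: "sdist (pt U s) (pt V s') < e
    \<longleftrightarrow> 0 < e \<and> \<bar>s - s'\<bar> < e \<and> (\<forall>j<n. \<bar>U j s - V j s'\<bar> < e)"
proof -
  have "\<bar>pt U s ! (i - 1) - pt V s' ! (i - 1)\<bar> = \<bar>s - s'\<bar>"
    unfolding pt_nth using abs_sg_mult[of "s - s'"] by (simp add: right_diff_distrib)
  then show ?thesis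
    unfolding sdist_less_iff length_pt all_less_skip[OF i] by (auto simp: pt_nth(2))
qed

lemma sdist_pt_center: "sdist (pt U s) a = rho n U s"
proof -
  have a: "a = pt (\<lambda>_ _. 0) 0" by (subst eq_pt_iff) auto
  have "sdist (pt U s) (pt (\<lambda>_ _. 0) 0) < e \<longleftrightarrow> rho n U s < e" for e
    unfolding sdist_pt_less rho_less_iff by auto
  then have "sdist (pt U s) (pt (\<lambda>_ _. 0) 0) = rho n U s" using eq_iff_same_upper by blast
  then show ?thesis using a by simp
qed

lemma sdist_center_pt: "sdist a (pt U s) = rho n U s"
  using sdist_pt_center[of U s] sdist_commute[of a "pt U s"] by simp

lemma dmap_pt:
  assumes "inf_family n U"
  shows "dmap (length a) (pt U)"
proof -
  have "\<forall>m<length a. dff1 (\<lambda>s. pt U s ! m)"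
    unfolding all_less_skip[OF i]
  proof (intro conjI allI impI)
    show "dff1 (\<lambda>s. pt U s ! (i - 1))" unfolding pt_nth by (intro dfn_intros)
    fix j assume j: "j < n"
    have "dff1 (U j)" using assms j by (simp add: inf_family_def)
    then show "dff1 (\<lambda>s. pt U s ! skip i j)"
      unfolding pt_nth(2)[OF j] by (intro dff_add dff_const)
  qed
  then show ?thesis by (intro dmapI) auto
qed

text \<open>No bound on the parameter is imposed: the point with parameter \<open>s\<close> is at
  distance at least \<open>s\<close> from \<open>a\<close>, so large parameters do not affect the
  germ.\<close>

definition arc :: "(nat \<Rightarrow> 'm \<Rightarrow> 'm) \<Rightarrow> 'm list set" where
  "arc U = pt U ` {s. 0 < s}"

abbreviation sides :: "('m \<Rightarrow> 'm list) set set" where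
  "sides \<equiv> side_germs L M a i sg"

abbreviation coords :: "('m \<Rightarrow> 'm list) set \<Rightarrow> ('m \<Rightarrow> 'm) set list" where
  "coords \<equiv> iota L M a i sg"

abbreviation nrep :: "('m \<Rightarrow> 'm list) set \<Rightarrow> 'm \<Rightarrow> ('m \<Rightarrow> 'm list) \<Rightarrow> bool" where
  "nrep \<equiv> normalized_rep L M a i sg"

text \<open>Describing the germ by its members avoids choosing an interval on which \<open>U\<close>
  is continuous and \<open>rho n U\<close> increases.\<close>

definition arc_germ :: "(nat \<Rightarrow> 'm \<Rightarrow> 'm) \<Rightarrow> ('m \<Rightarrow> 'm list) set" where
  "arc_germ U = {\<gamma> \<in> shrunk_curves L M a. near_eq a (\<gamma> ` {0<..<1}) (arc U)}"

lemma arc_germ_eq_class: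
  assumes "\<rho> \<in> arc_germ U"
  shows "arc_germ U = curve_class a \<rho>"
  using assms near_eq_sym near_eq_trans
  unfolding arc_germ_def curve_class_def curve_equiv_iff by blast

definition regular :: "(nat \<Rightarrow> 'm \<Rightarrow> 'm) \<Rightarrow> 'm \<Rightarrow> bool" where
  "regular U \<epsilon> \<longleftrightarrow> 0 < \<epsilon> \<and> (\<forall>s. 0 < s \<longrightarrow> s < \<epsilon> \<longrightarrow> jointly_continuous_at n U s) \<and>
     (\<forall>x y. 0 < x \<longrightarrow> x < y \<longrightarrow> y < \<epsilon> \<longrightarrow> rho n U x < rho n U y)"

lemma exists_regular:
  assumes "inf_family n U"
  obtains \<epsilon> where "regular U \<epsilon>"
proof -
  obtain \<epsilon> where \<epsilon>: "0 < \<epsilon>" "\<And>s. 0 < s \<Longrightarrow> s < \<epsilon> \<Longrightarrow> jointly_continuous_at n U s"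
    using ev_jointly_continuous[OF assms] by (rule evE) blast
  obtain \<epsilon>' where \<epsilon>': "0 < \<epsilon>'" "\<And>x y. 0 < x \<Longrightarrow> x < y \<Longrightarrow> y < \<epsilon>' \<Longrightarrow> rho n U x < rho n U y"
    using rho_increasing[OF assms] by blast
  have "regular U (min \<epsilon> \<epsilon>')" using \<epsilon> \<epsilon>' unfolding regular_def by simp
  then show thesis by (rule that)
qed

lemma pt_scale_shrunk:
  assumes U: "inf_family n U" and \<epsilon>: "regular U \<epsilon>"
  shows "(\<lambda>t. pt U (\<epsilon> * t)) \<in> shrunk_curves L M a"
proof -
  have "0 < \<epsilon>" and cont: "\<And>s. 0 < s \<Longrightarrow> s < \<epsilon> \<Longrightarrow> jointly_continuous_at n U s"
    and mono: "\<And>x y. 0 < x \<Longrightarrow> x < y \<Longrightarrow> y < \<epsilon> \<Longrightarrow> rho n U x < rho n U y"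
    using \<epsilon> unfolding regular_def by auto
  have sc: "0 < \<epsilon> * t" "\<epsilon> * t < \<epsilon>" if "t \<in> {0<..<1}" for t using that \<open>0 < \<epsilon>\<close> by auto
  have "curve_at a (\<lambda>t. pt U (\<epsilon> * t))"
    unfolding curve_at_def
  proof (intro conjI ballI allI impI)
    fix t e :: 'm assume t: "t \<in> {0<..<1}" and "0 < e"
    obtain d where d: "0 < d" "\<forall>s'. \<bar>s' - \<epsilon> * t\<bar> < d \<longrightarrow> (\<forall>j<n. \<bar>U j s' - U j (\<epsilon> * t)\<bar> < e)"
      using cont[OF sc[OF t]] \<open>0 < e\<close> unfolding jointly_continuous_at_def by blast
    show "\<exists>\<delta>>0. \<forall>s\<in>{0<..<1}. \<bar>s - t\<bar> < \<delta> \<longrightarrow> sdist (pt U (\<epsilon> * s)) (pt U (\<epsilon> * t)) < e"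
    \<comment> \<open>\<open>d\<close> controls the coordinates given by \<open>U\<close> and
      \<open>e\<close> the distinguished one; the division undoes the scaling.\<close>
    proof (intro exI[of _ "min d e / \<epsilon>"] conjI ballI impI)
      fix s assume "\<bar>s - t\<bar> < min d e / \<epsilon>"
      then have "\<epsilon> * \<bar>s - t\<bar> < min d e" using \<open>0 < \<epsilon>\<close> by (simp add: pos_less_divide_eq mult.commute)
      moreover have "\<epsilon> * \<bar>s - t\<bar> = \<bar>\<epsilon> * s - \<epsilon> * t\<bar>"
        using \<open>0 < \<epsilon>\<close> by (simp add: abs_mult flip: right_diff_distrib)
      ultimately have "\<bar>\<epsilon> * s - \<epsilon> * t\<bar> < d" "\<bar>\<epsilon> * s - \<epsilon> * t\<bar> < e" by auto
      then show "sdist (pt U (\<epsilon> * s)) (pt U (\<epsilon> * t)) < e"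
        unfolding sdist_pt_less using d(2) \<open>0 < e\<close> by blast
    qed (use d \<open>0 < e\<close> \<open>0 < \<epsilon>\<close> in simp)
  next
    show "tends_at_zero (\<lambda>t. pt U (\<epsilon> * t)) a"
      unfolding tends_at_zero_def sdist_pt_center
    proof (intro allI impI)
      fix e :: 'm assume "0 < e"
      obtain d where d: "0 < d" "\<And>s. 0 < s \<Longrightarrow> s < d \<Longrightarrow> rho n U s < e"
        using ev_rho_less[OF U \<open>0 < e\<close>] by (rule evE) blast
      show "\<exists>\<delta>>0. \<forall>t. 0 < t \<and> t < \<delta> \<longrightarrow> rho n U (\<epsilon> * t) < e"
      proof (intro exI[of _ "d / \<epsilon>"] conjI allI impI)
        fix t assume "0 < t \<and> t < d / \<epsilon>"
        then show "rho n U (\<epsilon> * t) < e"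
          using d(2)[of "\<epsilon> * t"] \<open>0 < \<epsilon>\<close> by (simp add: pos_less_divide_eq mult.commute)
      qed (use d \<open>0 < \<epsilon>\<close> in simp)
    qed
  qed simp
  moreover have "definable_map L M {0<..<1} (length a) (\<lambda>t. pt U (\<epsilon> * t))"
    by (rule dmap_imp_definable_map[OF dmap_scale[OF dmap_pt[OF U], of \<epsilon>] dfn_interval refl])
  moreover have "strict_mono_on {0<..<1} (\<lambda>t. sdist (pt U (\<epsilon> * t)) a)"
    unfolding sdist_pt_center
    by (rule strict_mono_onI, rule mono) (use sc \<open>0 < \<epsilon>\<close> in auto)
  ultimately show ?thesis unfolding shrunk_curves_def definable_curves_def by blast
qed

lemma sball_Int_arc:
  assumes "e \<le> \<epsilon>"
  shows "sball a e \<inter> pt U ` {0<..<\<epsilon>} = sball a e \<inter> arc U"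
proof -
  have "s < \<epsilon>" if "pt U s \<in> sball a e" for s
    using that le_rho[of s n U] assms unfolding sball_def by (simp add: sdist_center_pt)
  then show ?thesis unfolding arc_def by auto
qed

lemma scale_image: "0 < \<epsilon> \<Longrightarrow> (\<lambda>t. f (\<epsilon> * t)) ` {0<..<1} = f ` {0<..<\<epsilon>::'m}"
proof -
  assume "0 < \<epsilon>"
  then have "(*) \<epsilon> ` {0<..<1} = {0<..<\<epsilon>}"
    by (auto intro!: image_eqI[of _ _ "_ / \<epsilon>"] simp: divide_simps)
  then show ?thesis by (metis image_image)
qed

lemma pt_scale_arc_germ:
  assumes U: "inf_family n U" and \<epsilon>: "regular U \<epsilon>"
  shows "(\<lambda>t. pt U (\<epsilon> * t)) \<in> arc_germ U"
proof -
  have "0 < \<epsilon>" using \<epsilon> by (simp add: regular_def)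
  then show ?thesis
    unfolding arc_germ_def using pt_scale_shrunk[OF assms] sball_Int_arc[of \<epsilon> \<epsilon> U]
    by (auto simp: scale_image intro!: near_eqI[of \<epsilon>])
qed

lemma curve_germ_pt_scale:
  assumes U: "inf_family n U" and \<epsilon>: "regular U \<epsilon>"
  shows "curve_germ L M a (\<lambda>t. pt U (\<epsilon> * t)) = arc_germ U"
  using arc_germ_eq_class[OF pt_scale_arc_germ[OF assms]] curve_germ_shrunk[OF pt_scale_shrunk[OF assms]] by simp

lemma arc_germ_nonempty: "inf_family n U \<Longrightarrow> arc_germ U \<noteq> {}"
  using exists_regular pt_scale_arc_germ by blast

lemma arc_germ_in_side_germs:
  assumes U: "inf_family n U"
  shows "arc_germ U \<in> sides"
  unfolding side_germs_def
proof (intro CollectI conjI ballI)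
  obtain \<epsilon> where \<epsilon>: "regular U \<epsilon>" using exists_regular[OF U] .
  show "arc_germ U \<in> curve_germs L M a"
    using arc_germ_eq_class[OF pt_scale_arc_germ[OF U \<epsilon>]] pt_scale_shrunk[OF U \<epsilon>]
    unfolding curve_germs_eq by blast
  fix \<gamma> assume "\<gamma> \<in> arc_germ U"
  then have \<gamma>: "\<gamma> \<in> definable_curves L M a" and "near_eq a (\<gamma> ` {0<..<1}) (arc U)"
    unfolding arc_germ_def shrunk_curves_def by auto
  then obtain e where e: "0 < e" "sball a e \<inter> \<gamma> ` {0<..<1} = sball a e \<inter> arc U"
    unfolding near_eq_def by auto
  obtain d where d: "0 < d" "\<forall>t. 0 < t \<and> t < d \<longrightarrow> sdist (\<gamma> t) a < e"
    using definable_curvesD(3)[OF \<gamma>] e(1) unfolding tends_at_zero_def by blast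
  show "ev (\<lambda>t. 0 < sg * (\<gamma> t ! (i - 1) - a ! (i - 1)))"
  proof (rule evI[of "min d 1"])
    fix t assume t: "0 < t" "t < min d 1"
    then have t01: "t \<in> {0<..<1}" by simp
    have len: "length (\<gamma> t) = length a" by (rule definable_curvesD(2)[OF \<gamma> t01])
    have "sdist a (\<gamma> t) = sdist (\<gamma> t) a" using len by (simp add: sdist_commute)
    also have "\<dots> < e" using d(2) t by simp
    finally have "\<gamma> t \<in> sball a e" using len unfolding sball_def by simp
    then have "\<gamma> t \<in> arc U" using e(2) t01 by blast
    then obtain s where "0 < s" "\<gamma> t = pt U s" unfolding arc_def by blast
    then show "0 < sg * (\<gamma> t ! (i - 1) - a ! (i - 1))"
      by (simp only: pt_nth add_diff_cancel_left' sg_sg)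
  qed (use d in simp)
qed

text \<open>The \<open>i\<close>-th coordinate of a curve on the given side of \<open>a\<close> eventually increases strictly, and the
  domain of its inverse is definable, so it contains an interval \<open>(0, \<epsilon>)\<close>. Substituting the inverse
  into the other coordinates normalizes the curve.\<close>

lemma side_germs_arc_germ:
  assumes g: "g \<in> sides"
  obtains U where "inf_family n U" "g = arc_germ U"
proof -
  obtain \<rho> where \<rho>: "\<rho> \<in> shrunk_curves L M a" and g_eq: "g = curve_class a \<rho>"
    using g unfolding side_germs_def curve_germs_eq by auto
  have \<rho>d: "\<rho> \<in> definable_curves L M a" using \<rho> by (simp add: shrunk_curves_def)
  define \<gamma> where "\<gamma> = extend (length a) \<rho>"
  have \<gamma>d: "dmap (length a) \<gamma>" unfolding \<gamma>_def by (rule definable_curvesD(1)[OF \<rho>d])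
  have \<gamma>\<rho>: "\<gamma> t = \<rho> t" if "0 < t" "t < 1" for t using that by (simp add: \<gamma>_def)
  define h where "h t = sg * (\<gamma> t ! (i - 1) - a ! (i - 1))" for t
  have hd: "dff1 h"
    unfolding h_def by (intro dff_mult dff_diff dff_const dmap_nth[OF \<gamma>d]) (use i in simp)
  have tends: "ev (\<lambda>t. sdist (\<gamma> t) a < e)" if e: "0 < e" for e
  proof -
    obtain d where d: "0 < d" "\<forall>t. 0 < t \<and> t < d \<longrightarrow> sdist (\<rho> t) a < e"
      using definable_curvesD(3)[OF \<rho>d] e unfolding tends_at_zero_def by blast
    show ?thesis by (rule evI[of "min d 1"]) (use d \<gamma>\<rho> in auto)
  qed
  have coord: "\<bar>\<gamma> t ! m - a ! m\<bar> \<le> sdist (\<gamma> t) a" if "m < length a" for m t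
    using sdist_le_iff[of "\<gamma> t" a "sdist (\<gamma> t) a"] dmap_length[OF \<gamma>d] that by simp
  have h_le: "\<bar>h t\<bar> \<le> sdist (\<gamma> t) a" for t
    unfolding h_def abs_sg_mult by (rule coord) (use i in simp)
  have "ev (\<lambda>t. 0 < sg * (\<rho> t ! (i - 1) - a ! (i - 1)))"
    using g curve_class_self[OF \<rho>] unfolding side_germs_def g_eq by auto
  from ev_conj[OF this ev_less[OF zero_less_one]] have h_pos: "ev (\<lambda>t. 0 < h t)"
    by (rule ev_mono) (auto simp: h_def \<gamma>\<rho>)
  have "ev (\<lambda>t. h t < e)" if "0 < e" for e
    using tends[OF that] by (rule ev_mono) (use h_le in \<open>auto simp: abs_le_iff intro: le_less_trans\<close>)
  then obtain \<epsilon>1 where \<epsilon>1: "0 < \<epsilon>1" "\<And>x y. 0 < x \<Longrightarrow> x < y \<Longrightarrow> y < \<epsilon>1 \<Longrightarrow> h x < h y"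
    using ev_increasing[OF hd h_pos] by blast
  obtain \<epsilon>2 where \<epsilon>2: "0 < \<epsilon>2" "\<And>t. 0 < t \<Longrightarrow> t < \<epsilon>2 \<Longrightarrow> 0 < h t" using h_pos by (rule evE) blast
  define \<epsilon> where "\<epsilon> = min 1 (min \<epsilon>1 \<epsilon>2)"
  have \<epsilon>: "0 < \<epsilon>" "\<epsilon> \<le> 1" using \<epsilon>1 \<epsilon>2 by (auto simp: \<epsilon>_def)
  have mono: "h x < h y" if "0 < x" "x < y" "y < \<epsilon>" for x y using \<epsilon>1(2) that by (simp add: \<epsilon>_def)
  have pos: "0 < h t" if "0 < t" "t < \<epsilon>" for t using \<epsilon>2(2) that by (simp add: \<epsilon>_def)
  have inj: "x = y" if "0 < x" "x < \<epsilon>" "0 < y" "y < \<epsilon>" "h x = h y" for x y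
    using mono[of x y] mono[of y x] that by (metis less_irrefl linorder_neqE)
  define dom where "dom s \<longleftrightarrow> (\<exists>t. 0 < t \<and> t < \<epsilon> \<and> h t = s)" for s
  define \<tau> where "\<tau> s = (THE t. if dom s then 0 < t \<and> t < \<epsilon> \<and> h t = s else t = 0)" for s
  have ex1: "\<exists>!t. if dom s then 0 < t \<and> t < \<epsilon> \<and> h t = s else t = 0" for s
  proof (cases "dom s")
    case True
    then show ?thesis using inj unfolding dom_def by auto
  qed simp
  have \<tau>: "0 < \<tau> s" "\<tau> s < \<epsilon>" "h (\<tau> s) = s" if "dom s" for s
    using theI'[OF ex1, of s] that unfolding \<tau>_def by auto
  have \<tau>_h: "dom (h t)" "\<tau> (h t) = t" if "0 < t" "t < \<epsilon>" for t
  proof -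
    show "dom (h t)" using that unfolding dom_def by blast
    from \<tau>[OF this] that inj show "\<tau> (h t) = t" by blast
  qed
  have domd: "dfn1 dom" unfolding dom_def by (intro dfn_intros dff_comp1[OF hd])
  have "dff1 \<tau>" unfolding \<tau>_def
  proof (rule dff_The[OF _ ex1])
    have "dfn (\<lambda>v. (dom (v (Suc 0)) \<longrightarrow> 0 < v 0 \<and> v 0 < \<epsilon> \<and> h (v 0) = v (Suc 0)) \<and> (\<not> dom (v (Suc 0)) \<longrightarrow> v 0 = 0))"
      by (intro dfn_intros dfn_comp1[OF domd] dff_comp1[OF hd])
    then show "dfn (\<lambda>v. if dom (v (Suc 0)) then 0 < v 0 \<and> v 0 < \<epsilon> \<and> h (v 0) = v (Suc 0) else v 0 = 0)"
      unfolding if_bool_eq_conj .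
  qed
  \<comment> \<open>The range of \<open>h\<close> is definable, so otherwise it would miss a whole
    interval \<open>(0, \<eta>)\<close>, although \<open>h\<close> takes arbitrarily small positive
    values.\<close>
  have "ev dom"
  proof (rule ccontr)
    assume "\<not> ev dom"
    then have "ev (\<lambda>s. \<not> dom s)" using dfn1_ev[OF domd] by blast
    then obtain \<eta> where \<eta>: "0 < \<eta>" "\<And>s. 0 < s \<Longrightarrow> s < \<eta> \<Longrightarrow> \<not> dom s" by (rule evE) blast
    have "ev (\<lambda>t. h t < \<eta> \<and> t < \<epsilon>)"
      by (rule ev_conj[OF \<open>\<And>e. 0 < e \<Longrightarrow> ev (\<lambda>t. h t < e)\<close>[OF \<eta>(1)] ev_less[OF \<epsilon>(1)]])
    then have "ev (\<lambda>t::'m. False)"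
      by (rule ev_mono) (use \<eta>(2) pos \<tau>_h(1) in blast)
    then show False by simp
  qed
  then obtain \<eta> where \<eta>: "0 < \<eta>" "\<And>s. 0 < s \<Longrightarrow> s < \<eta> \<Longrightarrow> dom s" by (rule evE) blast
  define U where "U j s = \<gamma> (\<tau> s) ! skip i j - a ! skip i j" for j s
  have pt_eq: "pt U s = \<gamma> (\<tau> s)" if "dom s" for s
  proof -
    have "sg * h (\<tau> s) = \<gamma> (\<tau> s) ! (i - 1) - a ! (i - 1)" by (simp add: h_def)
    then have "\<gamma> (\<tau> s) = pt U s"
      using \<tau>(3)[OF that] dmap_length[OF \<gamma>d] by (subst eq_pt_iff) (simp_all add: U_def)
    then show ?thesis ..
  qed
  have fam: "inf_family n U"
    unfolding inf_family_def
  proof (intro allI impI conjI)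
    fix j assume "j < n"
    then have sk: "skip i j < length a" using skip_less[OF i] by blast
    have "dff1 (\<lambda>s. \<gamma> (\<tau> s) ! skip i j)" by (rule dff_comp1[OF dmap_nth[OF \<gamma>d sk] \<open>dff1 \<tau>\<close>])
    then show "dff1 (U j)" unfolding U_def by (intro dff_diff dff_const)
    fix c :: 'm assume "0 < c"
    obtain d where d: "0 < d" "\<And>t. 0 < t \<Longrightarrow> t < d \<Longrightarrow> sdist (\<gamma> t) a < c" using tends[OF \<open>0 < c\<close>] by (rule evE) blast
    define t0 where "t0 = min d \<epsilon> / 2"
    have t0: "0 < t0" "t0 < d" "t0 < \<epsilon>" using d(1) \<epsilon>(1) by (auto simp: t0_def min_def field_simps)
    show "ev (\<lambda>s. \<bar>U j s\<bar> < c)"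
    proof (rule evI[of "min \<eta> (h t0)"])
      fix s assume s: "0 < s" "s < min \<eta> (h t0)"
      then have "dom s" using \<eta>(2) by simp
      note \<tau> = \<tau>[OF this]
      have "\<tau> s < t0"
      proof (rule ccontr)
        assume "\<not> \<tau> s < t0"
        then have "h t0 \<le> h (\<tau> s)" using mono[of t0 "\<tau> s"] \<tau> t0 by (cases "t0 = \<tau> s") auto
        with \<tau> s show False by simp
      qed
      then have "sdist (\<gamma> (\<tau> s)) a < c" using d(2) \<tau> t0 by simp
      then show "\<bar>U j s\<bar> < c" using coord[OF sk, of "\<tau> s"] unfolding U_def by simp
    qed (use \<eta>(1) pos t0 in simp)
  qed
  have "\<not> (\<forall>t\<in>{0<..<1}. \<rho> t = a)"
  proof
    assume *: "\<forall>t\<in>{0<..<1}. \<rho> t = a"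
    have "0 < h (\<epsilon> / 2)" using \<epsilon> by (intro pos) auto
    moreover have "\<gamma> (\<epsilon> / 2) = a" using * \<epsilon> \<gamma>\<rho>[of "\<epsilon> / 2"] by simp
    ultimately show False by (simp add: h_def)
  qed
  then have inc: "strict_mono_on {0<..<1} (\<lambda>t. sdist (\<rho> t) a)"
    using \<rho> unfolding shrunk_curves_def by blast
  \<comment> \<open>Within distance \<open>e\<close>, the entry \<open>\<eta>\<close> forces points
    of the arc to have a parameter in the domain of \<open>\<tau>\<close>, and the other entry
    forces points of \<open>\<rho>\<close> to come from \<open>t \<le> \<epsilon> / 2\<close>, where
    \<open>\<tau>\<close> inverts \<open>h\<close>.\<close>
  define e where "e = min \<eta> (sdist (\<rho> (\<epsilon> / 2)) a)"
  have e2: "0 < \<epsilon> / 2" "\<epsilon> / 2 < \<epsilon>" "\<epsilon> / 2 < 1" using \<epsilon> by auto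
  have "0 < sdist (\<rho> (\<epsilon> / 2)) a"
    using h_le[of "\<epsilon> / 2"] pos[OF e2(1,2)] \<gamma>\<rho>[OF e2(1,3)] by simp
  then have "0 < e" using \<eta> by (simp add: e_def)
  have "sball a e \<inter> \<rho> ` {0<..<1} = sball a e \<inter> arc U"
  proof (intro set_eqI iffI)
    fix x assume x: "x \<in> sball a e \<inter> \<rho> ` {0<..<1}"
    then obtain t where t: "t \<in> {0<..<1}" "x = \<rho> t" by blast
    have "sdist a x < e" "length x = length a" using x unfolding sball_def by auto
    then have "sdist (\<rho> t) a < sdist (\<rho> (\<epsilon> / 2)) a" using t(2) sdist_commute[of "\<rho> t" a] by (simp add: e_def)
    then have "\<not> \<epsilon> / 2 < t" using strict_mono_onD[OF inc _ t(1), of "\<epsilon> / 2"] e2 by auto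
    then have t\<epsilon>: "0 < t" "t < \<epsilon>" using t(1) e2 by auto
    have "x = pt U (h t)" using pt_eq \<tau>_h[OF t\<epsilon>] \<gamma>\<rho>[of t] t by simp
    then show "x \<in> sball a e \<inter> arc U" using x pos[OF t\<epsilon>] unfolding arc_def by blast
  next
    fix x assume x: "x \<in> sball a e \<inter> arc U"
    then obtain s where s: "0 < s" "x = pt U s" unfolding arc_def by blast
    have "rho n U s < e" using x s unfolding sball_def by (simp add: sdist_center_pt)
    then have "s < \<eta>" using le_rho[of s n U] by (simp add: e_def)
    then have "dom s" using \<eta>(2) s by simp
    then have "x = \<rho> (\<tau> s)" "\<tau> s \<in> {0<..<1}" using pt_eq \<tau>[of s] \<gamma>\<rho>[of "\<tau> s"] s \<epsilon> by auto
    then show "x \<in> sball a e \<inter> \<rho> ` {0<..<1}" using x by blast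
  qed
  then have "\<rho> \<in> arc_germ U" unfolding arc_germ_def using \<rho> near_eqI[OF \<open>0 < e\<close>] by blast
  then have "g = arc_germ U" using arc_germ_eq_class g_eq by simp
  with fam that show thesis by blast
qed

section \<open>The coordinate map on arc germs and its bijectivity\<close>

lemma arc_germ_cong:
  assumes "\<And>j. j < n \<Longrightarrow> ev (\<lambda>s. U j s = V j s)"
  shows "arc_germ U = arc_germ V"
proof -
  have "ev (\<lambda>s. \<forall>j<n. U j s = V j s)" using assms by (rule ev_ball_less)
  then obtain \<epsilon> where \<epsilon>: "0 < \<epsilon>" "\<And>s. 0 < s \<Longrightarrow> s < \<epsilon> \<Longrightarrow> \<forall>j<n. U j s = V j s" by (rule evE) blast
  have "pt U ` {0<..<\<epsilon>} = pt V ` {0<..<\<epsilon>}"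
  proof (intro image_cong refl)
    fix s assume "s \<in> {0<..<\<epsilon>}"
    then have "\<forall>j<n. U j s = V j s" using \<epsilon>(2) by simp
    then have "map (\<lambda>j. del i a ! j + U j s) [0..<n] = map (\<lambda>j. del i a ! j + V j s) [0..<n]"
      by (intro map_cong refl) auto
    then show "pt U s = pt V s" unfolding pt_def by (simp only:)
  qed
  then have "near_eq a (arc U) (arc V)"
    using sball_Int_arc[of \<epsilon> \<epsilon> U] sball_Int_arc[of \<epsilon> \<epsilon> V] \<epsilon>(1) by (intro near_eqI[of \<epsilon>]) auto
  then show ?thesis unfolding arc_germ_def using near_eq_trans near_eq_sym by blast
qed

text \<open>Near zero every normalized representative runs inside \<open>arc U\<close>. Both curves
  display their parameter in the distinguished coordinate, so coinciding points have equal
  parameters and their other coordinates agree. This is the uniqueness required by the description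
  in \<open>iota\<close>.\<close>

lemma normalized_rep_germ:
  assumes U: "inf_family n U" and rep: "nrep (arc_germ U) \<epsilon> u"
  shows "map (\<lambda>j. gm (\<lambda>s. u s ! j - del i a ! j)) [0..<n] = tup n U"
proof -
  define \<gamma> where "\<gamma> t = ins i (u t) (a ! (i - 1) + sg * t)" for t
  have "0 < \<epsilon>" and ud: "definable_map L M {0<..<\<epsilon>} n u"
    and \<gamma>d: "(\<lambda>t. \<gamma> (\<epsilon> * t)) \<in> definable_curves L M a" and \<gamma>g: "curve_germ L M a (\<lambda>t. \<gamma> (\<epsilon> * t)) = arc_germ U"
    using rep unfolding normalized_rep_def \<gamma>_def Let_def by auto
  have len: "length (u s) = n" if "0 < s" "s < \<epsilon>" for s
    using ud that unfolding definable_map_def image_subset_iff by auto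
  obtain c where c: "0 < c" "c \<le> 1" "(\<lambda>t. \<gamma> (\<epsilon> * (c * t))) \<in> shrunk_curves L M a"
    using exists_shrunk[OF \<gamma>d] by blast
  from curve_germ_eq[of c "\<lambda>t. \<gamma> (\<epsilon> * t)" a] c \<gamma>g curve_class_self[OF c(3)]
  have "(\<lambda>t. \<gamma> (\<epsilon> * (c * t))) \<in> arc_germ U" by simp
  then obtain e where e: "0 < e" "sball a e \<inter> (\<lambda>t. \<gamma> (\<epsilon> * (c * t))) ` {0<..<1} = sball a e \<inter> arc U"
    unfolding arc_germ_def near_eq_def by auto
  obtain d where d: "0 < d" "\<forall>t. 0 < t \<and> t < d \<longrightarrow> sdist (\<gamma> (\<epsilon> * t)) a < e"
    using definable_curvesD(3)[OF \<gamma>d] e(1) unfolding tends_at_zero_def by blast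
  \<comment> \<open>The bound \<open>\<epsilon> * c\<close> keeps \<open>s\<close> on the shrunk
    restriction, and \<open>\<epsilon> * d\<close> places the point in the ball where the curve
    coincides with the arc.\<close>
  have u_eq: "\<forall>j<n. u s ! j - del i a ! j = U j s" if s: "0 < s" "s < \<epsilon> * min c d" for s
  proof -
    define t where "t = s / (\<epsilon> * c)"
    have st: "s = \<epsilon> * (c * t)" "0 < t" "t < 1" "0 < c * t" "c * t < d" "c * t < 1"
    proof -
      show st: "s = \<epsilon> * (c * t)" "0 < t" using s \<open>0 < \<epsilon>\<close> c by (auto simp: t_def)
      have "s / \<epsilon> < min c d" using s \<open>0 < \<epsilon>\<close> by (simp only: pos_divide_less_eq mult.commute)
      moreover have "s / \<epsilon> = c * t" using st \<open>0 < \<epsilon>\<close> by simp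
      ultimately have ct: "c * t < c" "c * t < d" by simp_all
      then show "t < 1" "0 < c * t" "c * t < d" using c(1) st by auto
      show "c * t < 1" using ct(1) c(2) by (rule less_le_trans)
    qed
    have "length (\<gamma> s) = length a" using st definable_curvesD(2)[OF \<gamma>d, of "c * t"] by simp
    moreover from this have "sdist a (\<gamma> s) = sdist (\<gamma> s) a" by (simp add: sdist_commute)
    moreover have "sdist (\<gamma> s) a < e" using d(2)[rule_format, of "c * t"] st by simp
    ultimately have "\<gamma> s \<in> sball a e" unfolding sball_def by simp
    moreover have "\<gamma> s \<in> (\<lambda>t. \<gamma> (\<epsilon> * (c * t))) ` {0<..<1}" using st by auto
    ultimately have "\<gamma> s \<in> arc U" using e(2) by blast
    then obtain s' where s': "\<gamma> s = pt U s'" unfolding arc_def by blast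
    have "s < \<epsilon>" using st(1,6) \<open>0 < \<epsilon>\<close> by simp
    note len = len[OF s(1) this]
    have "\<gamma> s ! (i - 1) = a ! (i - 1) + sg * s" unfolding \<gamma>_def using i len by (intro ins_nth_same) auto
    then have "sg * s = sg * s'" unfolding s' pt_nth by (metis add_left_cancel)
    then have "s = s'" by (metis sg_sg(2))
    have "u s ! j - del i a ! j = U j s" if "j < n" for j
    proof -
      have "u s ! j = \<gamma> s ! skip i j" unfolding \<gamma>_def using i len that by (subst ins_nth_skip) auto
      then show ?thesis using s' \<open>s = s'\<close> that i by (simp add: pt_nth del_nth)
    qed
    then show ?thesis by blast
  qed
  have "gm (\<lambda>s. u s ! j - del i a ! j) = gm (U j)" if "j < n" for j
  proof (rule gm_cong, rule evI)
    show "0 < \<epsilon> * min c d" using \<open>0 < \<epsilon>\<close> c d by simp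
  qed (use u_eq that in blast)
  then show ?thesis unfolding tup_def by simp
qed

lemma exists_normalized_rep:
  assumes U: "inf_family n U"
  shows "\<exists>\<epsilon> u. nrep (arc_germ U) \<epsilon> u"
proof -
  obtain \<epsilon> where \<epsilon>: "regular U \<epsilon>" using exists_regular[OF U] .
  define u where "u s = map (\<lambda>j. del i a ! j + U j s) [0..<n]" for s
  have Ud: "dff1 (U j)" if "j < n" for j using U that by (simp add: inf_family_def)
  have "definable_map L M {0<..<\<epsilon>} n u"
  proof (rule definable_mapI[where F = "\<lambda>j s. del i a ! j + U j s"])
    show "dff (\<lambda>v. del i a ! j + U j (v 0))" if "j < n" for j by (intro dff_add dff_const Ud that)
    show "dfn1 (\<lambda>s. s \<in> {0<..<\<epsilon>})" by (rule dfn_interval)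
  qed (simp_all add: u_def)
  moreover have "tends_at_zero u (del i a)"
    unfolding tends_at_zero_def
  proof (intro allI impI)
    fix e :: 'm assume "0 < e"
    obtain d where d: "0 < d" "\<And>s. 0 < s \<Longrightarrow> s < d \<Longrightarrow> rho n U s < e"
      using ev_rho_less[OF U \<open>0 < e\<close>] by (rule evE) blast
    have "sdist (u t) (del i a) < e" if "0 < t" "t < d" for t
      using d(2)[OF that] \<open>0 < e\<close> unfolding rho_less_iff sdist_less_iff by (simp add: u_def)
    with d(1) show "\<exists>\<delta>>0. \<forall>t. 0 < t \<and> t < \<delta> \<longrightarrow> sdist (u t) (del i a) < e" by blast
  qed
  moreover have "(\<lambda>t. ins i (u (\<epsilon> * t)) (a ! (i - 1) + sg * (\<epsilon> * t))) = (\<lambda>t. pt U (\<epsilon> * t))"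
    by (simp add: u_def pt_def)
  moreover have "(\<lambda>t. pt U (\<epsilon> * t)) \<in> definable_curves L M a"
    using pt_scale_shrunk[OF U \<epsilon>] by (simp add: shrunk_curves_def)
  ultimately have "nrep (arc_germ U) \<epsilon> u"
    unfolding normalized_rep_def Let_def using \<epsilon> curve_germ_pt_scale[OF U \<epsilon>] by (simp add: regular_def)
  then show ?thesis by blast
qed

lemma coords_arc_germ:
  assumes U: "inf_family n U"
  shows "coords (arc_germ U) = tup n U"
  unfolding iota_def
proof (rule the_equality)
  obtain \<epsilon> u where "nrep (arc_germ U) \<epsilon> u"
    using exists_normalized_rep[OF U] by blast
  with normalized_rep_germ[OF U this] show "\<exists>\<epsilon> u. nrep (arc_germ U) \<epsilon> u \<and>
      tup n U = map (\<lambda>j. gm (\<lambda>s. u s ! j - del i a ! j)) [0..<n]"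
    by (intro exI[of _ \<epsilon>] exI[of _ u] conjI) simp_all
next
  fix x
  assume "\<exists>\<epsilon> u. nrep (arc_germ U) \<epsilon> u \<and>
      x = map (\<lambda>j. gm (\<lambda>s. u s ! j - del i a ! j)) [0..<n]"
  then obtain \<epsilon> u where "nrep (arc_germ U) \<epsilon> u"
      "x = map (\<lambda>j. gm (\<lambda>s. u s ! j - del i a ! j)) [0..<n]" by blast
  with normalized_rep_germ[OF U this(1)] show "x = tup n U" by (simp only:)
qed

lemma bij_betw_coords:
  "bij_betw (coords) (sides) (infinitesimal_tuples L M n)"
  unfolding bij_betw_def
proof
  show "inj_on (coords) (sides)"
  proof (rule inj_onI)
    fix g h assume gh: "g \<in> sides" "h \<in> sides"
      "coords g = coords h"
    obtain U V where U: "inf_family n U" "g = arc_germ U" and V: "inf_family n V" "h = arc_germ V"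
      using side_germs_arc_germ gh(1,2) by metis
    then have "tup n U = tup n V" using gh(3) coords_arc_germ by simp
    then show "g = h" using tup_eq_iff[OF U(1)] arc_germ_cong U V by blast
  qed
  show "coords ` sides = infinitesimal_tuples L M n"
  proof
    show "coords ` sides \<subseteq> infinitesimal_tuples L M n"
      unfolding infinitesimal_tuples_eq using side_germs_arc_germ coords_arc_germ by (smt (verit) imageE imageI mem_Collect_eq subsetI)
    show "infinitesimal_tuples L M n \<subseteq> coords ` sides"
      unfolding infinitesimal_tuples_eq using arc_germ_in_side_germs coords_arc_germ by (smt (verit) imageE imageI mem_Collect_eq subsetI)
  qed
qed

section \<open>Hausdorff distance of arcs and comparison of the topologies\<close>

lemma branch_pt:
  assumes U: "inf_family n U"
  shows "branch a (pt U) (\<lambda>s. 0 < s)"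
  unfolding branch_def sdist_center_pt
proof (intro conjI allI impI)
  show "dmap (length a) (pt U)" by (rule dmap_pt[OF U])
  show "dfn1 (\<lambda>s. 0 < s)" by (intro dfn_intros)
  fix t :: 'm assume "0 < t"
  then have "ev (\<lambda>s. rho n U s < t)" by (rule ev_rho_less[OF U])
  then have "ev (\<lambda>s::'m. \<exists>p. 0 < p \<and> rho n U p < t)" by (rule ev_mono) blast
  then show "\<exists>p. 0 < p \<and> rho n U p < t" by simp
qed

lemma hclose_arc_iff:
  assumes "0 < e"
  shows "hclose (sball a t \<inter> arc U) (sball a t \<inter> arc V) e \<longleftrightarrow> hclose_at n U V t e"
proof -
  have sb: "sball a t \<inter> arc W = pt W ` {s. 0 < s \<and> rho n W s < t}" for W
    unfolding arc_def sball_def by (auto simp: sdist_center_pt)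
  show ?thesis
    unfolding sb hclose_def hclose_at_def ball_simps bex_simps using assms by (auto simp: sdist_pt_less)
qed

text \<open>The directions use different radii because closeness within \<open>r t\<close> bounds
  the Hausdorff distance only by \<open>r t\<close>; halving restores the strict inequality.\<close>

lemma Kless_germ_dist:
  assumes U: "inf_family n U" and V: "inf_family n V" and r: "pos_germ r"
  shows "Kless (germ_dist L M a (arc_germ U) (arc_germ V)) (gm r) \<Longrightarrow> ev (\<lambda>t. hclose_at n U V t (r t))"
    and "ev (\<lambda>t. hclose_at n U V t (r t / 2)) \<Longrightarrow> Kless (germ_dist L M a (arc_germ U) (arc_germ V)) (gm r)"
proof -
  have lp: "locally_parametrizes a (arc_germ W) (arc W)" if "inf_family n W" for W
    using arc_germ_nonempty[OF that] unfolding locally_parametrizes_def arc_germ_def by blast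
  have dist: "germ_dist L M a (arc_germ U) (arc_germ V) = gm (ndist a (arc U) (arc V))"
    unfolding germ_dist_eq[OF lp[OF U] lp[OF V]] by (rule gm_hausdorff_eq_ndist)
  have nd: "dff1 (ndist a (arc U) (arc V))"
    unfolding arc_def by (rule dff_ndist[OF branch_pt[OF U] branch_pt[OF V]])
  have nd_le: "ndist a (arc U) (arc V) t \<le> e \<longleftrightarrow> (\<forall>e'>e. hclose (sball a t \<inter> arc U) (sball a t \<inter> arc V) e')"
    if "0 < t" for t e
    unfolding arc_def using ndist_le_iff[OF branch_pt[OF U] branch_pt[OF V] that] by simp
  have rd: "dff1 r" "ev (\<lambda>t. 0 < r t)" using r by (auto simp: pos_germ_def)
  have Kl: "Kless (germ_dist L M a (arc_germ U) (arc_germ V)) (gm r) \<longleftrightarrow> ev (\<lambda>t. ndist a (arc U) (arc V) t < r t)"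
    unfolding dist by (rule Kless_gm[OF nd rd(1)])
  show "ev (\<lambda>t. hclose_at n U V t (r t))" if "Kless (germ_dist L M a (arc_germ U) (arc_germ V)) (gm r)"
    using that[unfolded Kl] rd(2)
  proof (rule ev_mono2)
    fix t assume t: "0 < t" "ndist a (arc U) (arc V) t < r t" "0 < r t"
    then have "hclose (sball a t \<inter> arc U) (sball a t \<inter> arc V) (r t)" using nd_le[OF t(1)] by blast
    then show "hclose_at n U V t (r t)" using hclose_arc_iff[OF t(3)] by simp
  qed
  show "Kless (germ_dist L M a (arc_germ U) (arc_germ V)) (gm r)" if "ev (\<lambda>t. hclose_at n U V t (r t / 2))"
    unfolding Kl using that rd(2)
  proof (rule ev_mono2)
    fix t assume t: "0 < t" "hclose_at n U V t (r t / 2)" "0 < r t"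
    then have "hclose (sball a t \<inter> arc U) (sball a t \<inter> arc V) (r t / 2)" using hclose_arc_iff[of "r t / 2"] by simp
    then have "ndist a (arc U) (arc V) t \<le> r t / 2" unfolding nd_le[OF t(1)] using hclose_mono less_imp_le by blast
    also have "\<dots> < r t" using t(3) by simp
    finally show "ndist a (arc U) (arc V) t < r t" .
  qed
qed

theorem homeomorphic_map_iota:
  "homeomorphic_map
     (subtopology (K_metric_topology L M (curve_germs L M a) (germ_dist L M a)) (side_germs L M a i sg))
     (K_metric_topology L M (infinitesimal_tuples L M n) (Kdist L M)) (iota L M a i sg)"
proof (rule K_homeomorphic_map[OF K_metric_curve_germs K_metric_infinitesimal_tuples _ bij_betw_coords])
  show "sides \<subseteq> curve_germs L M a" unfolding side_germs_def by blast
next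
  fix g r assume g: "g \<in> sides" and r: "pos_germ r"
  obtain U where U: "inf_family n U" "g = arc_germ U" using side_germs_arc_germ[OF g] .
  obtain R where R: "pos_germ R" "\<And>V. inf_family n V \<Longrightarrow> ev (\<lambda>t. hclose_at n U V t (R t))
      \<Longrightarrow> ev (\<lambda>s. \<forall>j<n. \<bar>U j s - V j s\<bar> < r s)"
    using hclose_imp_close[OF U(1) r] by blast
  have "Kless (Kdist L M (coords g) (coords h)) (gm r)"
    if h: "h \<in> sides" and "Kless (germ_dist L M a g h) (gm R)" for h
  proof -
    obtain V where V: "inf_family n V" "h = arc_germ V" using side_germs_arc_germ[OF h] .
    have "ev (\<lambda>t. hclose_at n U V t (R t))"
      using Kless_germ_dist(1)[OF U(1) V(1) R(1)] that(2) U V by simp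
    from R(2)[OF V(1) this] show ?thesis
      using Kless_Kdist[OF U(1) V(1) r] U V by (simp add: coords_arc_germ)
  qed
  with R(1) show "\<exists>r'. pos_germ r' \<and> (\<forall>h\<in>sides. Kless (germ_dist L M a g h) (gm r') \<longrightarrow>
      Kless (Kdist L M (coords g) (coords h)) (gm r))" by blast
next
  fix g r assume g: "g \<in> sides" and r: "pos_germ r"
  obtain U where U: "inf_family n U" "g = arc_germ U" using side_germs_arc_germ[OF g] .
  have "pos_germ (\<lambda>t. r t / 2)" using r unfolding pos_germ_def by (auto intro: dff_divide_const)
  then obtain R where R: "pos_germ R" "\<And>V. inf_family n V \<Longrightarrow> ev (\<lambda>s. \<forall>j<n. \<bar>U j s - V j s\<bar> < R s)
      \<Longrightarrow> ev (\<lambda>t. hclose_at n U V t (r t / 2))"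
    using close_imp_hclose[OF U(1)] by blast
  have "Kless (germ_dist L M a g h) (gm r)"
    if h: "h \<in> sides" and "Kless (Kdist L M (coords g) (coords h)) (gm R)" for h
  proof -
    obtain V where V: "inf_family n V" "h = arc_germ V" using side_germs_arc_germ[OF h] .
    have "ev (\<lambda>s. \<forall>j<n. \<bar>U j s - V j s\<bar> < R s)"
      using Kless_Kdist[OF U(1) V(1) R(1)] that(2) U V by (simp add: coords_arc_germ)
    from Kless_germ_dist(2)[OF U(1) V(1) r R(2)[OF V(1) this]] show ?thesis using U V by simp
  qed
  with R(1) show "\<exists>r'. pos_germ r' \<and> (\<forall>h\<in>sides.
      Kless (Kdist L M (coords g) (coords h)) (gm r') \<longrightarrow> Kless (germ_dist L M a g h) (gm r))" by blast
qed

end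

theorem proposition6p4:
  fixes L :: "('f, 'r) language" and T :: "('f, 'r) fm set"
    and M :: "('f, 'r, 'm::linordered_field) struct" and a :: "'m list" and k i :: nat
  assumes "ordered_ring_language L"
    and "complete_theory L T"
    and "\<forall>p\<in>RCF L. entails L T p"
    and "ominimal_theory L T TYPE('m)"
    and "quantifier_elimination L T"
    and "universally_axiomatizable L T"
    and "is_model L T M"
    and "expands_field L M"
    and "length a = k"
    and "1 \<le> i" and "i \<le> k"
  shows "homeomorphic_map
           (subtopology (K_metric_topology L M (curve_germs L M a) (germ_dist L M a))
              (side_germs L M a i 1))
           (K_metric_topology L M (infinitesimal_tuples L M (k - 1)) (Kdist L M))
           (iota L M a i 1)
       \<and> homeomorphic_map
           (subtopology (K_metric_topology L M (curve_germs L M a) (germ_dist L M a))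
              (side_germs L M a i (- 1)))
           (K_metric_topology L M (infinitesimal_tuples L M (k - 1)) (Kdist L M))
           (iota L M a i (- 1))"
proof -
  have "ominimal L M" using assms(4,7) unfolding ominimal_theory_def by blast
  then interpret ominimal_field L M
    by (intro ominimal_field.intro assms(1,8))
  have "curve_space L M a i sg" if "sg = 1 \<or> sg = - 1" for sg
    by unfold_locales (use assms(9-11) that in auto)
  from curve_space.homeomorphic_map_iota[OF this] show ?thesis
    using assms(9) by blast
qed

end
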